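(* Let $1<p<\infty$, $A\in\mathbb{R}^{n\times d}$, $b\in\mathbb{R}^n$, $c\in\ker(A)^{\perp}$ and $\varepsilon>0$. Run the homotopy algorithm (described in the context) with initial parameter $$t_{0}=\max\left(\left(2c^{\top}(A^{\top}A)^{\dagger}c\right)^{\frac{1}{p-1}},\,2\|b\|_{2}\right).$$ Then the algorithm finds a point $x(t_{k})$ such that $$c\cdot x(t_{k})+\|Ax(t_{k})-b\|_{p}^{p}\leq\varepsilon+\min_{x\in\mathbb{R}^{d}}\left(c\cdot x+\|Ax-b\|_{p}^{p}\right)$$ in $k=O(1)\cdot\log\left(\frac{np}{\varepsilon}t_{0}^{p}\right)$ phases. Furthermore, each run of accelerated gradient descent (AGD) terminates after $O_{p}\left(n^{\left|\frac{1}{2}-\frac{1}{p}\right|}\log(n)\right)$ iterations, and each step of AGD involves applying $P_t$ (or $P'_t$, in the variant of the algorithm using $P_t'$ as preconditioner) constantly many times plus some linear-time work.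
   Context: Notation: $M^{\dagger}$ is the Moore–Penrose pseudo-inverse. $O_p(\cdot)$ hides factors polynomial in $p^2/(p-1)$. All powers $(\cdot)^{p/2}$ and $(\cdot)^{2/p}$ of possibly negative reals are signed powers, $u^{\alpha}:=\mathrm{sign}(u)|u|^{\alpha}$. Problem: $\ell_p$ regression, $\min_{x\in\mathbb{R}^d} c\cdot x+\|Ax-b\|_p^p$, with $n\ge d$. Smoothed functions: for $t>0$, $$f_t(s)=\begin{cases}\frac p2 t^{p-2}s^2 & |s|\le t,\\ |s|^p+(\frac p2-1)t^p & |s|>t,\end{cases}\qquad f_t''(s)=\begin{cases}pt^{p-2}&|s|\le t,\\ p(p-1)|s|^{p-2}&|s|>t.\end{cases}$$ Homotopy path: $x(t):=\mathrm{argmin}_{x\in\ker(A)^\perp}\ c\cdot x+\sum_{i=1}^n f_t((Ax-b)_i)$, and $s(t):=Ax(t)-b$; also $s(x):=Ax-b$. Parameters: $h=\frac1{2p}$, $t_k:=(1-h)^kt_0$, and for given $t$, $\gamma:=\left(1+\frac{p^3}{p-1}\sqrt n\,h\right)t^{p/2}$. $D_t$ is the $n\times n$ diagonal matrix with $i$-th diagonal entry $\frac{p-1}{2}\max\left(t^{p/2},|s_i(t)|^{p/2}-\mathrm{sign}(p-2)\gamma\right)^{2-4/p}$. Preconditioners: $P_t:=((A^\top D_tA)^\dagger)^{1/2}$, and $P_t':=(A^\top D_tA)^\dagger A^\top\sqrt{D_t}$. Quadratic extension: for $\ell\le u$, $f_{t,\ell,u}(s)$ equals $f_t(s)$ on $[\ell,u]$,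 equals $f_t(u)+f_t'(u)(s-u)+\frac12f_t''(u)(s-u)^2$ for $s\ge u$, and $f_t(\ell)+f_t'(\ell)(s-\ell)+\frac12f_t''(\ell)(s-\ell)^2$ for $s\le \ell$. Set $\tilde f_t(s):=\sum_{i=1}^n f_{(1-h)t,\ell_i,u_i}(s_i)$ with $\ell_i=(s_i(t)^{p/2}-\gamma)^{2/p}$, $u_i=(s_i(t)^{p/2}+\gamma)^{2/p}$, and $g_t(y):=c\cdot P_ty+\tilde f_t(s(P_ty))$ (with $P_t'$ in place of $P_t$ in the variant). Algorithm: find $x(t_0)$ (by solving a linear system) and compute $P_{t_0}$. For $k=0,1,\dots$ (each $k$ is one phase): given $x(t_k)$ and $P_{t_k}$, run AGD on $g_{t_k}$ to obtain (an approximation of) $y(t_{k+1})$ with $P_{t_k}y(t_{k+1})=x(t_{k+1})$; set $x(t_{k+1})=P_{t_k}y(t_{k+1})$ and compute $P_{t_{k+1}}$. AGD is Nesterov's accelerated gradient descent: for convex $f$ with $D\preceq\nabla^2f\preceq\kappa D$ for a fixed diagonal matrix $D$, starting at $x_0$ and for $0<\delta<\frac12$, it outputs $x$ with $f(x)-\min f\le\delta(f(x_0)-\min f)$ in $O(\sqrt\kappa\log(\kappa/\delta))$ iterations, each computing one gradient plus linear-time work. Each run is executed to accuracy $\delta$ inverse-polynomial in $n$ (up to $O_p$ factors), sufficient for the subsequent phase.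
   Formalization: The algorithm starts at the exact minimiser x(t_0), not at the solution of a linear system: with the stated t_0 that solution need not be x(t_0) and the bound can fail (n=d=1, A=1, b=0, p=3, small c). The log(n) factor is read as log(n+1). *)

theory Defs
  imports "HOL-Analysis.Analysis" "Jordan_Normal_Form.Matrix_Kernel"
begin

definition euclid_norm :: "real Matrix.vec \<Rightarrow> real" where
  "euclid_norm v = sqrt (scalar_prod v v)"

definition ker_perp :: "real Matrix.mat \<Rightarrow> real Matrix.vec set" where
  "ker_perp A = {x \<in> carrier_vec (dim_col A). \<forall>y \<in> mat_kernel A. scalar_prod x y = 0}"

definition is_pinv :: "real Matrix.mat \<Rightarrow> real Matrix.mat \<Rightarrow> bool" where
  "is_pinv M X \<longleftrightarrow> X \<in> carrier_mat (dim_col M) (dim_row M) \<and>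
     M * X * M = M \<and> X * M * X = X \<and>
     transpose_mat (M * X) = M * X \<and> transpose_mat (X * M) = X * M"

definition pinv :: "real Matrix.mat \<Rightarrow> real Matrix.mat" where
  "pinv M = (THE X. is_pinv M X)"

definition psd :: "real Matrix.mat \<Rightarrow> bool" where
  "psd M \<longleftrightarrow> square_mat M \<and> transpose_mat M = M \<and>
     (\<forall>v \<in> carrier_vec (dim_row M). 0 \<le> scalar_prod v (M *\<^sub>v v))"

definition psd_sqrt :: "real Matrix.mat \<Rightarrow> real Matrix.mat" where
  "psd_sqrt M = (THE R. psd R \<and> dim_row R = dim_row M \<and> R * R = M)"

definition nnz :: "real Matrix.mat \<Rightarrow> nat" where
  "nnz A = card {(i, j). i < dim_row A \<and> j < dim_col A \<and> A $$ (i, j) \<noteq> 0}"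

definition residual :: "real Matrix.mat \<Rightarrow> real Matrix.vec \<Rightarrow> real Matrix.vec \<Rightarrow> real Matrix.vec" where
  "residual A b x = A *\<^sub>v x - b"

definition lp_objective ::
  "real \<Rightarrow> real Matrix.mat \<Rightarrow> real Matrix.vec \<Rightarrow> real Matrix.vec \<Rightarrow> real Matrix.vec \<Rightarrow> real" where
  "lp_objective p A b c x =
     scalar_prod c x + (\<Sum>i<dim_row A. \<bar>vec_index (residual A b x) i\<bar> powr p)"

definition spow :: "real \<Rightarrow> real \<Rightarrow> real" where
  "spow u \<alpha> = sgn u * \<bar>u\<bar> powr \<alpha>"

definition smoothed :: "real \<Rightarrow> real \<Rightarrow> real \<Rightarrow> real" where
  "smoothed p t s =
     (if \<bar>s\<bar> \<le> t then p / 2 * t powr (p - 2) * s\<^sup>2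
      else \<bar>s\<bar> powr p + (p / 2 - 1) * t powr p)"

text \<open>
  The second derivative of \<open>smoothed p t\<close>; it has a jump at \<open>\<bar>s\<bar> = t\<close>, where the
  value of the quadratic piece is used.
\<close>

definition smoothed_dd :: "real \<Rightarrow> real \<Rightarrow> real \<Rightarrow> real" where
  "smoothed_dd p t s =
     (if \<bar>s\<bar> \<le> t then p * t powr (p - 2) else p * (p - 1) * \<bar>s\<bar> powr (p - 2))"

definition smoothed_ext :: "real \<Rightarrow> real \<Rightarrow> real \<Rightarrow> real \<Rightarrow> real \<Rightarrow> real" where
  "smoothed_ext p t l u s =
     (if u < s then smoothed p t u + deriv (smoothed p t) u * (s - u)
                    + smoothed_dd p t u / 2 * (s - u)\<^sup>2
      else if s < l then smoothed p t l + deriv (smoothed p t) l * (s - l)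
                    + smoothed_dd p t l / 2 * (s - l)\<^sup>2
      else smoothed p t s)"

definition smoothed_objective ::
  "real \<Rightarrow> real Matrix.mat \<Rightarrow> real Matrix.vec \<Rightarrow> real Matrix.vec \<Rightarrow> real \<Rightarrow> real Matrix.vec \<Rightarrow> real"
where
  "smoothed_objective p A b c t x =
     scalar_prod c x + (\<Sum>i<dim_row A. smoothed p t (vec_index (residual A b x) i))"

definition path_point ::
  "real \<Rightarrow> real Matrix.mat \<Rightarrow> real Matrix.vec \<Rightarrow> real Matrix.vec \<Rightarrow> real \<Rightarrow> real Matrix.vec" where
  "path_point p A b c t = arg_min (smoothed_objective p A b c t) (\<lambda>x. x \<in> ker_perp A)"

definition step_h :: "real \<Rightarrow> real" where
  "step_h p = 1 / (2 * p)"

definition t_init :: "real \<Rightarrow> real Matrix.mat \<Rightarrow> real Matrix.vec \<Rightarrow> real Matrix.vec \<Rightarrow> real" where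
  "t_init p A b c =
     max ((2 * scalar_prod c (pinv (transpose_mat A * A) *\<^sub>v c)) powr (1 / (p - 1)))
         (2 * euclid_norm b)"

definition t_seq :: "real \<Rightarrow> real \<Rightarrow> nat \<Rightarrow> real" where
  "t_seq p t\<^sub>0 k = (1 - step_h p) ^ k * t\<^sub>0"

definition radius :: "real \<Rightarrow> nat \<Rightarrow> real \<Rightarrow> real" where
  "radius p n t = (1 + p ^ 3 / (p - 1) * sqrt (real n) * step_h p) * t powr (p / 2)"

text \<open>
  Weights, box and preconditioners are functions of the residual vector \<open>s\<close> of the current point,
  so that they can be evaluated at the points the algorithm actually computes.
\<close>

definition weight :: "real \<Rightarrow> nat \<Rightarrow> real \<Rightarrow> real \<Rightarrow> real" where
  "weight p n t s\<^sub>i =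
     (p - 1) / 2 *
     max (t powr (p / 2)) (\<bar>s\<^sub>i\<bar> powr (p / 2) - sgn (p - 2) * radius p n t) powr (2 - 4 / p)"

definition weight_mat :: "real \<Rightarrow> real \<Rightarrow> real Matrix.vec \<Rightarrow> real Matrix.mat" where
  "weight_mat p t s = mat_diag (dim_vec s) (\<lambda>i. weight p (dim_vec s) t (vec_index s i))"

definition sqrt_weight_mat :: "real \<Rightarrow> real \<Rightarrow> real Matrix.vec \<Rightarrow> real Matrix.mat" where
  "sqrt_weight_mat p t s = mat_diag (dim_vec s) (\<lambda>i. sqrt (weight p (dim_vec s) t (vec_index s i)))"

definition precond :: "real \<Rightarrow> real Matrix.mat \<Rightarrow> real \<Rightarrow> real Matrix.vec \<Rightarrow> real Matrix.mat" where
  "precond p A t s = psd_sqrt (pinv (transpose_mat A * weight_mat p t s * A))"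

definition precond' :: "real \<Rightarrow> real Matrix.mat \<Rightarrow> real \<Rightarrow> real Matrix.vec \<Rightarrow> real Matrix.mat" where
  "precond' p A t s =
     pinv (transpose_mat A * weight_mat p t s * A) * transpose_mat A * sqrt_weight_mat p t s"

definition box_lo :: "real \<Rightarrow> nat \<Rightarrow> real \<Rightarrow> real \<Rightarrow> real" where
  "box_lo p n t s\<^sub>i = spow (spow s\<^sub>i (p / 2) - radius p n t) (2 / p)"

definition box_hi :: "real \<Rightarrow> nat \<Rightarrow> real \<Rightarrow> real \<Rightarrow> real" where
  "box_hi p n t s\<^sub>i = spow (spow s\<^sub>i (p / 2) + radius p n t) (2 / p)"

definition phase_loss :: "real \<Rightarrow> real \<Rightarrow> real Matrix.vec \<Rightarrow> nat \<Rightarrow> real \<Rightarrow> real" where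
  "phase_loss p t s i =
     smoothed_ext p ((1 - step_h p) * t)
       (box_lo p (dim_vec s) t (vec_index s i)) (box_hi p (dim_vec s) t (vec_index s i))"

definition phase_objective ::
  "real \<Rightarrow> real Matrix.mat \<Rightarrow> real Matrix.vec \<Rightarrow> real Matrix.vec \<Rightarrow> real \<Rightarrow> real Matrix.vec
   \<Rightarrow> real Matrix.mat \<Rightarrow> real Matrix.vec \<Rightarrow> real" where
  "phase_objective p A b c t s P y =
     scalar_prod c (P *\<^sub>v y) +
     (\<Sum>i<dim_row A. phase_loss p t s i (vec_index (residual A b (P *\<^sub>v y)) i))"

definition gradient :: "(real Matrix.vec \<Rightarrow> real) \<Rightarrow> real Matrix.vec \<Rightarrow> real Matrix.vec" where
  "gradient f y =
     Matrix.vec (dim_vec y)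
       (\<lambda>j. deriv (\<lambda>r. f (y + r \<cdot>\<^sub>v unit_vec (dim_vec y) j)) 0)"

text \<open>
  Nesterov's method with constant momentum, in the normalisation where the reference diagonal matrix
  is the identity: the Hessian of \<open>f\<close> lies between \<open>1\<close> and \<open>\<kappa>\<close>, on the subspace spanned by the
  gradients. The number of iterations is fixed beforehand from \<open>\<kappa>\<close> and the relative accuracy \<open>\<delta>\<close>.
\<close>

definition agd_step ::
  "real \<Rightarrow> (real Matrix.vec \<Rightarrow> real) \<Rightarrow> real Matrix.vec \<times> real Matrix.vec
   \<Rightarrow> real Matrix.vec \<times> real Matrix.vec" where
  "agd_step \<kappa> f = (\<lambda>(y, z).
     let y' = z - (1 / \<kappa>) \<cdot>\<^sub>v gradient f z
     in (y', y' + ((sqrt \<kappa> - 1) / (sqrt \<kappa> + 1)) \<cdot>\<^sub>v (y' - y)))"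

definition agd_iterations :: "real \<Rightarrow> real \<Rightarrow> nat" where
  "agd_iterations \<kappa> \<delta> = nat \<lceil>2 * sqrt \<kappa> * ln (\<kappa> / \<delta>)\<rceil>"

definition agd ::
  "real \<Rightarrow> real \<Rightarrow> (real Matrix.vec \<Rightarrow> real) \<Rightarrow> real Matrix.vec \<Rightarrow> real Matrix.vec" where
  "agd \<kappa> \<delta> f y\<^sub>0 = fst ((agd_step \<kappa> f ^^ agd_iterations \<kappa> \<delta>) (y\<^sub>0, y\<^sub>0))"

text \<open>
  \<open>pre\<close> is either \<open>precond\<close> or \<open>precond'\<close>. A phase with parameter \<open>t\<close> starts at the current point
  \<open>x\<close>; its starting vector \<open>y\<close> for AGD is the least-norm solution of \<open>P y = x\<close>.
\<close>

type_synonym precond_fun =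
  "real \<Rightarrow> real Matrix.mat \<Rightarrow> real \<Rightarrow> real Matrix.vec \<Rightarrow> real Matrix.mat"

definition phase_precond ::
  "precond_fun \<Rightarrow> real \<Rightarrow> real Matrix.mat \<Rightarrow> real Matrix.vec \<Rightarrow> real \<Rightarrow> real Matrix.vec
   \<Rightarrow> real Matrix.mat" where
  "phase_precond pre p A b t x = pre p A t (residual A b x)"

definition phase_start ::
  "precond_fun \<Rightarrow> real \<Rightarrow> real Matrix.mat \<Rightarrow> real Matrix.vec \<Rightarrow> real \<Rightarrow> real Matrix.vec
   \<Rightarrow> real Matrix.vec" where
  "phase_start pre p A b t x = pinv (phase_precond pre p A b t x) *\<^sub>v x"

definition phase_g ::
  "precond_fun \<Rightarrow> real \<Rightarrow> real Matrix.mat \<Rightarrow> real Matrix.vec \<Rightarrow> real Matrix.vec \<Rightarrow> real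
   \<Rightarrow> real Matrix.vec \<Rightarrow> real Matrix.vec \<Rightarrow> real" where
  "phase_g pre p A b c t x =
     phase_objective p A b c t (residual A b x) (phase_precond pre p A b t x)"

definition phase_output ::
  "precond_fun \<Rightarrow> real \<Rightarrow> real \<Rightarrow> real \<Rightarrow> real Matrix.mat \<Rightarrow> real Matrix.vec \<Rightarrow> real Matrix.vec
   \<Rightarrow> real \<Rightarrow> real Matrix.vec \<Rightarrow> real Matrix.vec" where
  "phase_output pre \<kappa> \<delta> p A b c t x =
     agd \<kappa> \<delta> (phase_g pre p A b c t x) (phase_start pre p A b t x)"

primrec homotopy ::
  "precond_fun \<Rightarrow> real \<Rightarrow> real \<Rightarrow> real \<Rightarrow> real Matrix.mat \<Rightarrow> real Matrix.vec \<Rightarrow> real Matrix.vec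
   \<Rightarrow> real \<Rightarrow> nat \<Rightarrow> real Matrix.vec" where
  "homotopy pre \<kappa> \<delta> p A b c t\<^sub>0 0 = path_point p A b c t\<^sub>0"
| "homotopy pre \<kappa> \<delta> p A b c t\<^sub>0 (Suc k) =
     (let t = t_seq p t\<^sub>0 k; x = homotopy pre \<kappa> \<delta> p A b c t\<^sub>0 k
      in phase_precond pre p A b t x *\<^sub>v phase_output pre \<kappa> \<delta> p A b c t x)"

text \<open>
  Straight-line programs over a growing list of vector registers. Operands are register indices;
  each instruction appends its result. Applications of the preconditioner \<open>P\<close> or of its transpose
  are counted by \<open>applications\<close>; everything else is charged by \<open>work\<close>, where a product with \<open>A\<close> or
  its transpose costs one multiplication and one addition per nonzero entry of \<open>A\<close>, and an
  evaluation of one of the scalar functions \<open>\<phi> i\<close> is one elementary operation.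
\<close>

datatype instr =
  ApplyP nat | ApplyPT nat | ApplyA nat | ApplyAT nat | Lin real nat real nat | Pointwise nat

fun exec_instr ::
  "real Matrix.mat \<Rightarrow> real Matrix.mat \<Rightarrow> (nat \<Rightarrow> real \<Rightarrow> real) \<Rightarrow> instr \<Rightarrow> real Matrix.vec list
   \<Rightarrow> real Matrix.vec" where
  "exec_instr P A \<phi> (ApplyP r) rs = P *\<^sub>v (rs ! r)"
| "exec_instr P A \<phi> (ApplyPT r) rs = transpose_mat P *\<^sub>v (rs ! r)"
| "exec_instr P A \<phi> (ApplyA r) rs = A *\<^sub>v (rs ! r)"
| "exec_instr P A \<phi> (ApplyAT r) rs = transpose_mat A *\<^sub>v (rs ! r)"
| "exec_instr P A \<phi> (Lin \<alpha> q \<beta> r) rs = \<alpha> \<cdot>\<^sub>v (rs ! q) + \<beta> \<cdot>\<^sub>v (rs ! r)"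
| "exec_instr P A \<phi> (Pointwise r) rs =
     Matrix.vec (dim_vec (rs ! r)) (\<lambda>i. \<phi> i (vec_index (rs ! r) i))"

fun instr_work :: "real Matrix.mat \<Rightarrow> instr \<Rightarrow> real Matrix.vec \<Rightarrow> nat" where
  "instr_work A (ApplyP _) v = 0"
| "instr_work A (ApplyPT _) v = 0"
| "instr_work A (ApplyA _) v = 2 * nnz A + dim_vec v"
| "instr_work A (ApplyAT _) v = 2 * nnz A + dim_vec v"
| "instr_work A (Lin _ _ _ _) v = 3 * dim_vec v"
| "instr_work A (Pointwise _) v = dim_vec v"

fun exec ::
  "real Matrix.mat \<Rightarrow> real Matrix.mat \<Rightarrow> (nat \<Rightarrow> real \<Rightarrow> real) \<Rightarrow> instr list \<Rightarrow> real Matrix.vec list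
   \<Rightarrow> real Matrix.vec list" where
  "exec P A \<phi> [] rs = rs"
| "exec P A \<phi> (i # prog) rs = exec P A \<phi> prog (rs @ [exec_instr P A \<phi> i rs])"

fun work ::
  "real Matrix.mat \<Rightarrow> real Matrix.mat \<Rightarrow> (nat \<Rightarrow> real \<Rightarrow> real) \<Rightarrow> instr list \<Rightarrow> real Matrix.vec list
   \<Rightarrow> nat" where
  "work P A \<phi> [] rs = 0"
| "work P A \<phi> (i # prog) rs =
     (let v = exec_instr P A \<phi> i rs in instr_work A i v + work P A \<phi> prog (rs @ [v]))"

definition applications :: "instr list \<Rightarrow> nat" where
  "applications prog = length (filter (\<lambda>i. \<exists>r. i = ApplyP r \<or> i = ApplyPT r) prog)"

text \<open>
  The program \<open>prog\<close> turns the registers \<open>b, c, y, z\<close> into the next AGD state, left in the last two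
  registers, using the coordinatewise derivatives \<open>\<phi>\<close> of the loss.
\<close>

definition implements_step ::
  "instr list \<Rightarrow> real Matrix.mat \<Rightarrow> real Matrix.mat \<Rightarrow> real Matrix.vec \<Rightarrow> real Matrix.vec
   \<Rightarrow> (nat \<Rightarrow> real \<Rightarrow> real) \<Rightarrow> real \<Rightarrow> (real Matrix.vec \<Rightarrow> real)
   \<Rightarrow> real Matrix.vec \<Rightarrow> real Matrix.vec \<Rightarrow> bool" where
  "implements_step prog P A b c \<phi> \<kappa> g y z \<longleftrightarrow>
     (let rs = exec P A \<phi> prog [b, c, y, z]
      in 2 \<le> length prog \<and>
         (rs ! (length rs - 2), rs ! (length rs - 1)) = agd_step \<kappa> g (y, z))"

end

theory Submission
  imports Defs "Jordan_Normal_Form.Spectral_Radius"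
begin

text \<open>
  Let \<open>F t\<close> be the smoothed objective and let \<open>u\<close> be the signed power \<open>p / 2\<close> of a residual coordinate.
  Comparing the stationarity conditions of \<open>F t\<close> and \<open>F t'\<close> for \<open>t' = (1 - h) t\<close>, the monotonicity gaps of
  the derivatives sum to \<open>O(n t powr p)\<close>, and a gap controls the displacement in \<open>u\<close>; so along the path
  every \<open>u\<close> moves by at most the radius \<open>\<gamma>\<close> minus \<open>t powr (p / 2) / 4\<close>. This slack absorbs the error of
  the computed point, and the next path point lies in the interior of the box around the current
  iterate. There the extended loss agrees with the smoothed one, so both have the same minimiser, and
  the curvature of the extended loss in coordinate \<open>i\<close> lies between \<open>D\<^sub>i\<close> and \<open>\<kappa> D\<^sub>i\<close>.

  Both preconditioners satisfy \<open>P P\<^sup>T = (A\<^sup>T D A)\<^sup>+\<close>, which makes \<open>y \<mapsto> sqrt D A P y\<close> an isometry on the row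
  space of \<open>P\<close>. Accelerated gradient descent never leaves this space, hence it runs with condition
  number \<open>\<kappa>\<close>. Its output has a small Bregman distance to the path point, coordinate by coordinate,
  which keeps it inside the box and re-establishes the invariant \<open>F t x - min (F t) \<le> \<tau> t powr p\<close>.
\<close>

text \<open>The hard range is \<open>1 < p < 2\<close>: the curvature of the loss decays at infinity
  and the signed power \<open>p / 2\<close> has unbounded slope at 0, so neither a global curvature
  bound nor a direct comparison with \<open>spow\<close> is available. Hence the case splits, the
  coordinate \<open>flat_coord\<close> and the pairing of Lipschitz with Hoelder estimates. The
  invariant is about values because stationarity turns a gap into a sum of nonnegative
  coordinatewise distances, each at most the whole gap; so its tolerance \<open>closeness\<close> is
  independent of \<open>n\<close>. AGD restores it afresh in every phase, and errors do not
  accumulate. The factor \<open>1 / n\<close> in \<open>accuracy\<close> pays for the change of the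
  objective, of order \<open>n * p * t powr p\<close>, when \<open>t\<close> shrinks. The choice
  \<open>p * step_h p = 1 / 2\<close> keeps \<open>(1 - step_h p) powr p\<close> between
  \<open>1 / 2\<close> and \<open>exp (- 1 / 2)\<close>: scales stay comparable within a phase and
  still decay geometrically. The two ends of a box differ in scale by \<open>O_p (sqrt n)\<close>;
  the power \<open>\<bar>2 - 4 / p\<bar>\<close> of this governs the condition number, whose square
  root gives the exponent in the iteration bound.\<close>

no_notation vec_nth (infixl "$" 90)
no_notation inner (infix "\<bullet>" 70)

subsection \<open>Spectral theorem, pseudo-inverses and the preconditioners\<close>

text \<open>Over the complex numbers the spectrum is non-empty. Symmetry forces the eigenvalue found
  there to be real, and then the real or the imaginary part of its eigenvector is a real
  eigenvector.\<close>

lemma symmetric_eigenvector: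
  fixes A :: "real Matrix.mat"
  assumes A: "A \<in> carrier_mat n n" and sym: "transpose_mat A = A" and n: "0 < n"
  obtains v l where "v \<in> carrier_vec n" "v \<noteq> 0\<^sub>v n" "A *\<^sub>v v = l \<cdot>\<^sub>v v"
proof -
  let ?B = "map_mat complex_of_real A"
  have B: "?B \<in> carrier_mat n n" using A by simp
  from spectrum_non_empty[OF B n] obtain z where "eigenvalue ?B z"
    unfolding spectrum_def by auto
  then obtain w where w: "w \<in> carrier_vec n" "w \<noteq> 0\<^sub>v n" and ev: "?B *\<^sub>v w = z \<cdot>\<^sub>v w"
    unfolding eigenvalue_def eigenvector_def using B by auto
  define a where "a = Matrix.vec n (\<lambda>i. Re (w $ i))"
  define b where "b = Matrix.vec n (\<lambda>i. Im (w $ i))"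
  have ab[simp]: "a \<in> carrier_vec n" "b \<in> carrier_vec n" by (auto simp: a_def b_def)
  have comp: "(\<Sum>j<n. A $$ (i,j) * a $ j) = Re z * a $ i - Im z * b $ i \<and>
              (\<Sum>j<n. A $$ (i,j) * b $ j) = Re z * b $ i + Im z * a $ i" if i: "i < n" for i
  proof -
    have "(\<Sum>j<n. complex_of_real (A $$ (i,j)) * w $ j) = z * w $ i"
      using arg_cong[OF ev, of "\<lambda>v. v $ i"] i A w
      by (simp add: scalar_prod_def atLeast0LessThan)
    from arg_cong[OF this, of Re] arg_cong[OF this, of Im] show ?thesis
      using i by (simp add: a_def b_def)
  qed
  have Aab: "A *\<^sub>v a = Re z \<cdot>\<^sub>v a - Im z \<cdot>\<^sub>v b" "A *\<^sub>v b = Re z \<cdot>\<^sub>v b + Im z \<cdot>\<^sub>v a"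
    using comp A by (auto intro!: eq_vecI simp: scalar_prod_def atLeast0LessThan a_def b_def)
  \<comment> \<open>Expanding both sides with \<open>Aab\<close> leaves \<open>Im z\<close> times
    the squared length of the complex eigenvector.\<close>
  have "(A *\<^sub>v b) \<bullet> a = b \<bullet> (A *\<^sub>v a)"
    using transpose_vec_mult_scalar[OF A ab(1) ab(2)] sym by simp
  hence "Im z * (a \<bullet> a + b \<bullet> b) = 0"
    unfolding Aab by (simp add: add_scalar_prod_distrib[of _ n] scalar_prod_minus_distrib[of _ n]
        comm_scalar_prod[of b n a] algebra_simps smult_scalar_prod_distrib[of _ n] scalar_prod_smult_distrib[of _ n])
  moreover have "a \<bullet> a + b \<bullet> b \<noteq> 0"
  proof
    assume 0: "a \<bullet> a + b \<bullet> b = 0"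
    have "\<forall>i<n. w $ i = 0"
    proof (intro allI impI)
      fix i assume i: "i < n"
      have "(\<Sum>i<n. (a $ i)\<^sup>2 + (b $ i)\<^sup>2) = 0"
        using 0 by (simp add: scalar_prod_def atLeast0LessThan sum.distrib power2_eq_square a_def b_def)
      hence "(a $ i)\<^sup>2 + (b $ i)\<^sup>2 = 0" using i
        by (subst (asm) sum_nonneg_eq_0_iff) auto
      thus "w $ i = 0" using i by (auto simp: a_def b_def complex_eq_iff sum_power2_eq_zero_iff)
    qed
    hence "w = 0\<^sub>v n" using w by (intro eq_vecI) auto
    with w show False by simp
  qed
  ultimately have im: "Im z = 0" by simp
  have "a \<noteq> 0\<^sub>v n \<or> b \<noteq> 0\<^sub>v n"
  proof (rule ccontr)
    assume "\<not> ?thesis"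
    hence "\<forall>i<n. a $ i = 0 \<and> b $ i = 0" by auto
    hence "w = 0\<^sub>v n" using w by (intro eq_vecI) (auto simp: a_def b_def complex_eq_iff)
    with w show False by simp
  qed
  moreover have "A *\<^sub>v a = Re z \<cdot>\<^sub>v a" "A *\<^sub>v b = Re z \<cdot>\<^sub>v b"
    unfolding Aab im by (auto intro!: eq_vecI simp: a_def b_def)
  ultimately show thesis using that[of a "Re z"] that[of b "Re z"] by auto
qed

lemma mult_mat_unit_vec:
  fixes A :: "real Matrix.mat"
  assumes "A \<in> carrier_mat m n" "j < n"
  shows "A *\<^sub>v unit_vec n j = col A j"
  using assms by (intro eq_vecI) auto

lemma scalar_prod_self_nonneg: "0 \<le> (v::real Matrix.vec) \<bullet> v"
  by (simp add: scalar_prod_def sum_nonneg)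

lemma scalar_prod_self_eq_0:
  assumes "(v::real Matrix.vec) \<in> carrier_vec n" "v \<bullet> v = 0"
  shows "v = 0\<^sub>v n"
proof -
  have "\<forall>i\<in>{0..<dim_vec v}. v $ i * v $ i = 0"
    using assms(2) unfolding scalar_prod_def by (subst (asm) sum_nonneg_eq_0_iff) auto
  thus ?thesis using assms(1) by (intro eq_vecI) auto
qed

text \<open>\<open>H\<close> is the reflection exchanging the first unit vector with
  \<open>u\<close>; being its own inverse, it can be conjugated with directly. The squared length of
  \<open>w\<close> is \<open>2 * c\<close>, which vanishes only if \<open>u\<close> already is the
  first unit vector.\<close>

lemma householder:
  fixes u :: "real Matrix.vec"
  assumes u: "u \<in> carrier_vec n" and n: "0 < n" and uu: "u \<bullet> u = 1"
  obtains H where "H \<in> carrier_mat n n" "transpose_mat H = H" "H * H = 1\<^sub>m n" "col H 0 = u"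
proof (cases "u = unit_vec n 0")
  case True
  show ?thesis by (rule that[of "1\<^sub>m n"]) (use True n in auto)
next
  case False
  define w where "w i = u $ i - (if i = 0 then 1 else 0)" for i
  define c where "c = 1 - u $ 0"
  define H where "H = Matrix.mat n n (\<lambda>(i,j). (if i = j then 1 else 0) - w i * w j / c)"
  have uu': "(\<Sum>i<n. u $ i * u $ i) = 1" using uu u by (simp add: scalar_prod_def atLeast0LessThan)
  have "(\<Sum>i<n. w i * w i) = (\<Sum>i<n. u $ i * u $ i + (if i = 0 then 1 - 2 * u $ i else 0))"
    by (rule sum.cong) (auto simp: w_def algebra_simps)
  also have "\<dots> = 2 * c" using n uu' by (simp add: sum.distrib c_def)
  finally have ww: "(\<Sum>i<n. w i * w i) = 2 * c" .
  have c: "c \<noteq> 0"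
  proof
    assume "c = 0"
    hence "(\<Sum>i<n. w i * w i) = 0" using ww by simp
    hence "\<forall>i<n. w i = 0" by (subst (asm) sum_nonneg_eq_0_iff) auto
    hence "u = unit_vec n 0" using u by (intro eq_vecI) (auto simp: w_def unit_vec_def split: if_splits)
    with False show False by simp
  qed
  show ?thesis
  proof (rule that[of H])
    show H: "H \<in> carrier_mat n n" by (simp add: H_def)
    show "transpose_mat H = H" by (rule eq_matI) (auto simp: H_def)
    show "col H 0 = u" using n u c
      by (intro eq_vecI) (auto simp: H_def w_def c_def field_simps)
    show "H * H = 1\<^sub>m n"
    proof (rule eq_matI)
      fix i j assume "i < dim_row (1\<^sub>m n)" "j < dim_col (1\<^sub>m n)"
      hence ij: "i < n" "j < n" by auto
      have "(H * H) $$ (i,j) = (\<Sum>k<n. ((if i = k then 1 else 0) - w i * w k / c) * ((if k = j then 1 else 0) - w k * w j / c))"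
        using ij by (simp add: H_def scalar_prod_def atLeast0LessThan)
      also have "\<dots> = (\<Sum>k<n. (if i = k then (if k = j then 1 else 0) - w k * w j / c else 0)
             - (if k = j then w i * w k / c else 0) + (w k * w k) * (w i * w j / c\<^sup>2))"
        by (rule sum.cong) (auto simp: algebra_simps power2_eq_square)
      also have "\<dots> = (if i = j then 1 else 0) - w i * w j / c - w i * w j / c + 2 * c * (w i * w j / c\<^sup>2)"
        using ij by (simp add: sum.distrib sum_subtractf sum_distrib_right[symmetric] sum_divide_distrib[symmetric] ww)
      also have "\<dots> = 1\<^sub>m n $$ (i,j)" using ij c by (simp add: field_simps power2_eq_square)
      finally show "(H * H) $$ (i,j) = 1\<^sub>m n $$ (i,j)" .
    qed (auto simp: H_def)
  qed
qed

text \<open>Induction on the dimension. Conjugation by a Householder reflection moves an eigenvector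
  to the first unit vector; by symmetry the first row is cleared together with the first column, and
  a smaller symmetric block remains.\<close>

theorem symmetric_diagonalisation:
  fixes A :: "real Matrix.mat"
  assumes "A \<in> carrier_mat n n" "transpose_mat A = A"
  shows "\<exists>U d. U \<in> carrier_mat n n \<and> transpose_mat U * U = 1\<^sub>m n \<and> A = U * mat_diag n d * transpose_mat U"
  using assms
proof (induction n arbitrary: A)
  case 0
  then show ?case by (intro exI[of _ "1\<^sub>m 0"]) (auto intro!: eq_matI)
next
  case (Suc n A)
  note A = Suc.prems(1) and sym = Suc.prems(2)
  from symmetric_eigenvector[OF A sym] obtain v l
    where v: "v \<in> carrier_vec (Suc n)" "v \<noteq> 0\<^sub>v (Suc n)" and ev: "A *\<^sub>v v = l \<cdot>\<^sub>v v" by auto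
  have vv: "v \<bullet> v > 0" using scalar_prod_self_nonneg[of v] scalar_prod_self_eq_0[OF v(1)] v(2) by fastforce
  define u where "u = (1 / sqrt (v \<bullet> v)) \<cdot>\<^sub>v v"
  have u: "u \<in> carrier_vec (Suc n)" using v by (simp add: u_def)
  have uu: "u \<bullet> u = 1" using v vv by (simp add: u_def)
  have evu: "A *\<^sub>v u = l \<cdot>\<^sub>v u" using ev v A
    by (simp add: u_def mult_mat_vec smult_smult_assoc mult.commute)
  obtain H where H: "H \<in> carrier_mat (Suc n) (Suc n)" "transpose_mat H = H" "H * H = 1\<^sub>m (Suc n)" "col H 0 = u"
    using householder[OF u _ uu] by auto
  define A1 where "A1 = H * A * H"
  have A1: "A1 \<in> carrier_mat (Suc n) (Suc n)" using H A by (simp add: A1_def)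
  have "transpose_mat A1 = transpose_mat H * (transpose_mat A * transpose_mat H)"
    unfolding A1_def using H(1) A by (simp add: transpose_mult[of _ "Suc n" "Suc n" _ "Suc n"])
  also have "\<dots> = A1" unfolding A1_def H(2) sym using H(1) A by (simp add: assoc_mult_mat[of _ "Suc n" "Suc n" _ "Suc n" _ "Suc n"])
  finally have symA1: "transpose_mat A1 = A1" .
  have e0: "unit_vec (Suc n) 0 \<in> carrier_vec (Suc n)" by simp
  have He0: "H *\<^sub>v unit_vec (Suc n) 0 = u" using H by (simp add: mult_mat_unit_vec)
  have Hu: "H *\<^sub>v u = unit_vec (Suc n) 0"
    using assoc_mult_mat_vec[OF H(1) H(1) e0] H(3) He0 by simp
  have "A1 *\<^sub>v unit_vec (Suc n) 0 = H *\<^sub>v (A *\<^sub>v (H *\<^sub>v unit_vec (Suc n) 0))"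
    unfolding A1_def using H(1) A by (simp add: assoc_mult_mat_vec[of _ "Suc n" "Suc n" _ "Suc n"])
  also have "\<dots> = l \<cdot>\<^sub>v unit_vec (Suc n) 0"
    unfolding He0 evu using H(1) u Hu by (simp add: mult_mat_vec)
  finally have colA1: "col A1 0 = l \<cdot>\<^sub>v unit_vec (Suc n) 0" using A1 by (simp add: mult_mat_unit_vec)
  have A1i0: "A1 $$ (i,0) = (if i = 0 then l else 0)" if "i < Suc n" for i
    using arg_cong[OF colA1, of "\<lambda>v. v $ i"] that A1 by simp
  have A10i: "A1 $$ (0,i) = (if i = 0 then l else 0)" if "i < Suc n" for i
    using A1i0[OF that] arg_cong[OF symA1, of "\<lambda>M. M $$ (0,i)"] that A1 by simp
  define A' where "A' = Matrix.mat n n (\<lambda>(i,j). A1 $$ (Suc i, Suc j))"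
  have A': "A' \<in> carrier_mat n n" by (simp add: A'_def)
  have symA': "transpose_mat A' = A'"
  proof (rule eq_matI)
    fix i j assume "i < dim_row A'" "j < dim_col A'"
    hence ij: "i < n" "j < n" by (auto simp: A'_def)
    show "transpose_mat A' $$ (i,j) = A' $$ (i,j)"
      using ij arg_cong[OF symA1, of "\<lambda>M. M $$ (Suc i, Suc j)"] A1 by (simp add: A'_def)
  qed (auto simp: A'_def)
  from Suc.IH[OF A' symA'] obtain U' d' where U': "U' \<in> carrier_mat n n"
    and UU': "transpose_mat U' * U' = 1\<^sub>m n" and dec: "A' = U' * mat_diag n d' * transpose_mat U'" by auto
  define V where "V = four_block_mat (1\<^sub>m 1) (0\<^sub>m 1 n) (0\<^sub>m n 1) U'"
  define d where "d i = (case i of 0 \<Rightarrow> l | Suc j \<Rightarrow> d' j)" for i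
  have V: "V \<in> carrier_mat (Suc n) (Suc n)" unfolding V_def using U' four_block_carrier_mat[of "1\<^sub>m 1" 1 1 U' n n] by auto
  have VT: "transpose_mat V = four_block_mat (1\<^sub>m 1) (0\<^sub>m 1 n) (0\<^sub>m n 1) (transpose_mat U')"
    unfolding V_def using U' by (subst transpose_four_block_mat[of _ 1 1 _ n _ n]) auto
  have one: "four_block_mat (1\<^sub>m 1) (0\<^sub>m 1 n) (0\<^sub>m n 1) (1\<^sub>m n) = 1\<^sub>m (Suc n)"
    by (rule eq_matI) auto
  have VV: "transpose_mat V * V = 1\<^sub>m (Suc n)"
    unfolding VT unfolding V_def
    using U' UU' by (subst mult_four_block_mat[of _ 1 1 _ n _ n _ _ 1 _ n]) (auto simp: one)
  have D: "mat_diag (Suc n) d = four_block_mat (l \<cdot>\<^sub>m 1\<^sub>m 1) (0\<^sub>m 1 n) (0\<^sub>m n 1) (mat_diag n d')"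
    by (rule eq_matI) (auto simp: d_def mat_diag_def split: nat.split)
  have A1dec: "A1 = four_block_mat (l \<cdot>\<^sub>m 1\<^sub>m 1) (0\<^sub>m 1 n) (0\<^sub>m n 1) A'"
  proof (rule eq_matI)
    fix i j assume "i < dim_row (four_block_mat (l \<cdot>\<^sub>m 1\<^sub>m 1) (0\<^sub>m 1 n) (0\<^sub>m n 1) A')"
      "j < dim_col (four_block_mat (l \<cdot>\<^sub>m 1\<^sub>m 1) (0\<^sub>m 1 n) (0\<^sub>m n 1) A')"
    hence "i < Suc n" "j < Suc n" by (auto simp: A'_def)
    thus "A1 $$ (i,j) = four_block_mat (l \<cdot>\<^sub>m 1\<^sub>m 1) (0\<^sub>m 1 n) (0\<^sub>m n 1) A' $$ (i,j)"
      using A1i0[of i] A10i[of j] by (cases i; cases j) (auto simp: A'_def)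
  qed (use A1 in \<open>auto simp: A'_def\<close>)
  have VDV: "V * mat_diag (Suc n) d * transpose_mat V = A1"
  proof -
    have "V * mat_diag (Suc n) d = four_block_mat (l \<cdot>\<^sub>m 1\<^sub>m 1) (0\<^sub>m 1 n) (0\<^sub>m n 1) (U' * mat_diag n d')"
      unfolding V_def D using U'
      by (subst mult_four_block_mat[of _ 1 1 _ n _ n _ _ 1 _ n]) (auto simp: mat_diag_def)
    thus ?thesis unfolding VT A1dec dec using U'
      by (simp, subst mult_four_block_mat[of _ 1 1 _ n _ n _ _ 1 _ n]) (auto simp: mat_diag_def)
  qed
  define U where "U = H * V"
  have U: "U \<in> carrier_mat (Suc n) (Suc n)" using H V by (simp add: U_def)
  have UT: "transpose_mat U = transpose_mat V * H" unfolding U_def using H V by (simp add: transpose_mult[of _ "Suc n" "Suc n" _ "Suc n"])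
  note assoc = assoc_mult_mat[of _ "Suc n" "Suc n" _ "Suc n" _ "Suc n"]
  have Dc: "mat_diag (Suc n) d \<in> carrier_mat (Suc n) (Suc n)" by (simp add: mat_diag_def)
  have VTc: "transpose_mat V \<in> carrier_mat (Suc n) (Suc n)" using V by simp
  have "transpose_mat U * U = transpose_mat V * (H * H) * V"
    unfolding UT unfolding U_def using H(1) V VTc by (simp add: assoc)
  also have "\<dots> = 1\<^sub>m (Suc n)" unfolding H(3) using VTc V VV by simp
  finally have 1: "transpose_mat U * U = 1\<^sub>m (Suc n)" .
  have "U * mat_diag (Suc n) d * transpose_mat U = H * (V * mat_diag (Suc n) d * transpose_mat V) * H"
    unfolding UT unfolding U_def using H(1) V VTc Dc
    by (simp add: assoc mult_carrier_mat[of _ "Suc n" "Suc n" _ "Suc n"])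
  also have "\<dots> = (H * H) * A * (H * H)" unfolding VDV A1_def using H(1) A by (simp add: assoc)
  also have "\<dots> = A" unfolding H(3) using A by simp
  finally have 2: "A = U * mat_diag (Suc n) d * transpose_mat U" by simp
  show ?case using U 1 2 by blast
qed

section \<open>Moore-Penrose pseudo-inverses\<close>

lemma mat_assoc:
  "dim_col A = dim_row B \<Longrightarrow> dim_col B = dim_row C \<Longrightarrow> (A * B) * C = A * (B * (C :: 'a::semiring_0 Matrix.mat))"
  by (rule assoc_mult_mat[of A "dim_row A" "dim_row B" B "dim_row C" C "dim_col C"]) auto

lemma mat_vec_assoc:
  "dim_col A = dim_row B \<Longrightarrow> dim_col B = dim_vec v \<Longrightarrow> (A * B) *\<^sub>v v = A *\<^sub>v (B *\<^sub>v (v :: 'a::semiring_0 Matrix.vec))"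
  by (rule assoc_mult_mat_vec[of A "dim_row A" "dim_row B" B "dim_vec v"]) (auto intro: carrier_vecI)

lemma mat_transpose_mult:
  "dim_col A = dim_row B \<Longrightarrow> transpose_mat (A * B) = transpose_mat B * transpose_mat (A :: 'a::comm_semiring_0 Matrix.mat)"
  by (rule transpose_mult[of A "dim_row A" "dim_row B" B "dim_col B"]) auto

lemmas mat_normalise = mat_assoc mat_transpose_mult

lemma scalar_prod_mult_mat_vec:
  fixes A :: "real Matrix.mat"
  assumes "dim_row A = dim_vec v" "dim_col A = dim_vec w"
  shows "v \<bullet> (A *\<^sub>v w) = (transpose_mat A *\<^sub>v v) \<bullet> w"
  using transpose_vec_mult_scalar[of A "dim_vec v" "dim_vec w" w v] assms
  by (metis carrier_matI carrier_vec_dim_vec comm_scalar_prod dim_mult_mat_vec index_transpose_mat(2)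
      carrier_vecI)

text \<open>The diagonal of the product consists of the squared lengths of the columns of
  \<open>X\<close>. Later identities between matrices are obtained by showing that the Gram matrix
  of their defect vanishes.\<close>

lemma gram_eq_0:
  fixes X :: "real Matrix.mat"
  assumes X: "X \<in> carrier_mat m n" and 0: "transpose_mat X * X = 0\<^sub>m n n"
  shows "X = 0\<^sub>m m n"
proof (rule eq_matI)
  fix i j assume "i < dim_row (0\<^sub>m m n)" "j < dim_col (0\<^sub>m m n)"
  hence ij: "i < m" "j < n" by auto
  have "col X j \<bullet> col X j = 0"
    using arg_cong[OF 0, of "\<lambda>M. M $$ (j,j)"] ij X by simp
  hence "col X j = 0\<^sub>v m" using X by (intro scalar_prod_self_eq_0) auto
  thus "X $$ (i,j) = 0\<^sub>m m n $$ (i,j)" using ij X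
    by (metis carrier_matD index_col index_zero_mat(1) index_zero_vec(1))
qed (use X in auto)

text \<open>\<open>M * X\<close> and \<open>M * Y\<close> are both the orthogonal projection onto
  the column space of \<open>M\<close>, and \<open>X * M\<close> and \<open>Y * M\<close> that onto
  its row space; transposing one product shows that they agree.\<close>

lemma is_pinv_unique:
  assumes X: "is_pinv M X" and Y: "is_pinv M Y"
  shows "X = Y"
proof -
  have d[simp]: "dim_row X = dim_col M" "dim_col X = dim_row M" "dim_row Y = dim_col M" "dim_col Y = dim_row M"
    using X Y by (auto simp: is_pinv_def)
  have X': "M * (X * M) = M" "X * (M * X) = X" "transpose_mat (M * X) = M * X" "transpose_mat (X * M) = X * M"
    using X by (auto simp: is_pinv_def mat_assoc)
  have Y': "M * (Y * M) = M" "Y * (M * Y) = Y" "transpose_mat (M * Y) = M * Y" "transpose_mat (Y * M) = Y * M"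
    using Y by (auto simp: is_pinv_def mat_assoc)
  have X0: "M * X * M = M" and Y0: "M * Y * M = M" using X Y by (auto simp: is_pinv_def)
  have "M * X = (M * Y * M) * X" unfolding Y0 ..
  also have "\<dots> = (M * Y) * (M * X)" by (simp add: mat_assoc)
  finally have "transpose_mat (M * X) = transpose_mat ((M * Y) * (M * X))" by simp
  also have "\<dots> = transpose_mat (M * X) * transpose_mat (M * Y)" by (rule mat_transpose_mult) simp
  also have "\<dots> = (M * X * M) * Y" unfolding X'(3) Y'(3) by (simp add: mat_assoc)
  finally have 1: "M * X = M * Y" unfolding X'(3) X0 .
  have "X * M = X * (M * Y * M)" unfolding Y0 ..
  also have "\<dots> = (X * M) * (Y * M)" by (simp add: mat_assoc)
  finally have "transpose_mat (X * M) = transpose_mat ((X * M) * (Y * M))" by simp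
  also have "\<dots> = transpose_mat (Y * M) * transpose_mat (X * M)" by (rule mat_transpose_mult) simp
  also have "\<dots> = Y * (M * X * M)" unfolding X'(4) Y'(4) by (simp add: mat_assoc)
  finally have 2: "X * M = Y * M" unfolding X'(4) X0 .
  have "X = (X * M) * X" using X'(2) by (simp add: mat_assoc)
  also have "\<dots> = Y * (M * X)" unfolding 2 by (simp add: mat_assoc)
  also have "\<dots> = Y" unfolding 1 using Y'(2) .
  finally show ?thesis .
qed

lemma mat_diag_transpose[simp]: "transpose_mat (mat_diag n d) = mat_diag n d"
  by (rule eq_matI) (auto simp: mat_diag_def)

lemma mat_diag_dim[simp]: "dim_row (mat_diag n d) = n" "dim_col (mat_diag n d) = n"
  by (auto simp: mat_diag_def)

lemma orthogonal_cancel: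
  fixes U :: "real Matrix.mat"
  assumes "U \<in> carrier_mat n n" "transpose_mat U * U = 1\<^sub>m n" "dim_row X = n"
  shows "transpose_mat U * (U * X) = X" "U * (transpose_mat U * X) = X"
proof -
  have "U * transpose_mat U = 1\<^sub>m n"
    using mat_mult_left_right_inverse[OF _ assms(1,2)] assms(1) by simp
  thus "transpose_mat U * (U * X) = X" "U * (transpose_mat U * X) = X"
    using assms by (auto simp: mat_assoc[symmetric])
qed

lemma mat_diag_mult_assoc:
  "dim_row X = n \<Longrightarrow> mat_diag n d * (mat_diag n e * X) = mat_diag n (\<lambda>i. d i * e i :: real) * X"
  by (subst mat_assoc[symmetric]) (auto simp: mat_diag_diag)

lemma is_pinv_symmetric:
  fixes S :: "real Matrix.mat"
  assumes S: "S \<in> carrier_mat n n" and sym: "transpose_mat S = S"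
  shows "\<exists>X. is_pinv S X"
proof -
  obtain U d where U: "U \<in> carrier_mat n n" and UU: "transpose_mat U * U = 1\<^sub>m n"
    and dec: "S = U * mat_diag n d * transpose_mat U"
    using symmetric_diagonalisation[OF S sym] by auto
  note c = orthogonal_cancel[OF U UU]
  have [simp]: "dim_row U = n" "dim_col U = n" using U by auto
  \<comment> \<open>With \<open>inverse 0 = 0\<close> zero eigenvalues stay zero, as the
    pseudo-inverse demands.\<close>
  define e where "e i = inverse (d i)" for i
  have eq: "(\<lambda>i. d i * (e i * d i)) = d" "(\<lambda>i. e i * (d i * e i)) = e"
    "(\<lambda>i. e i * d i) = (\<lambda>i. d i * e i)"
    "(\<lambda>i. d i * e i * d i) = d" "(\<lambda>i. d i * e i * e i) = e"
    by (auto simp: e_def fun_eq_iff field_simps)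
  have "is_pinv S (U * mat_diag n e * transpose_mat U)"
    unfolding is_pinv_def dec
    by (auto simp: mat_normalise c mat_diag_mult_assoc eq intro!: carrier_matI)
  thus ?thesis by blast
qed

lemma is_pinv_transpose:
  assumes "is_pinv M X"
  shows "is_pinv (transpose_mat M) (transpose_mat X)"
proof -
  have d[simp]: "dim_row X = dim_col M" "dim_col X = dim_row M" using assms by (auto simp: is_pinv_def)
  have X': "M * X * M = M" "X * M * X = X" "transpose_mat (M * X) = M * X" "transpose_mat (X * M) = X * M"
    using assms by (auto simp: is_pinv_def)
  from arg_cong[OF X'(1), of transpose_mat] arg_cong[OF X'(2), of transpose_mat] X'(3,4)
  show ?thesis by (auto simp: is_pinv_def mat_normalise intro!: carrier_matI)
qed

text \<open>Reduction to the symmetric matrix \<open>S\<close>: if \<open>T\<close> is its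
  pseudo-inverse, \<open>T * transpose_mat M\<close> is that of \<open>M\<close>. The point is
  \<open>M * (T * S) = M\<close>; the defect \<open>Z\<close> is annihilated by
  \<open>transpose_mat M\<close> and factors through \<open>M\<close>, so its Gram matrix is
  zero.\<close>

lemma is_pinv_exists: "\<exists>X. is_pinv (M :: real Matrix.mat) X"
proof -
  define S where "S = transpose_mat M * M"
  have d[simp]: "dim_row S = dim_col M" "dim_col S = dim_col M" by (auto simp: S_def)
  have sym: "transpose_mat S = S" by (simp add: S_def mat_transpose_mult)
  obtain T where T: "is_pinv S T" using is_pinv_symmetric[of S "dim_col M", OF carrier_matI[OF d] sym] by auto
  have dT[simp]: "dim_row T = dim_col M" "dim_col T = dim_col M" using T by (auto simp: is_pinv_def)
  have T1: "S * (T * S) = S" "T * (S * T) = T" "transpose_mat (S * T) = S * T" "transpose_mat (T * S) = T * S"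
    using T by (auto simp: is_pinv_def mat_assoc)
  have "is_pinv S (transpose_mat T)" using is_pinv_transpose[OF T] sym by simp
  from is_pinv_unique[OF this T] have symT: "transpose_mat T = T" .
  define Z where "Z = M * (T * S) - M"
  have Zc: "Z \<in> carrier_mat (dim_row M) (dim_col M)" by (auto simp: Z_def)
  have MTZ: "transpose_mat M * Z = 0\<^sub>m (dim_col M) (dim_col M)"
  proof -
    have "transpose_mat M * Z = transpose_mat M * (M * (T * S)) - transpose_mat M * M"
      unfolding Z_def by (rule mult_minus_distrib_mat[of _ "dim_col M" "dim_row M" _ "dim_col M"]) auto
    also have "transpose_mat M * (M * (T * S)) = S * (T * S)" by (simp add: S_def mat_assoc)
    finally show ?thesis using T1(1) by (auto simp: S_def)
  qed
  have "Z = M * (T * S - 1\<^sub>m (dim_col M))"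
    unfolding Z_def by (subst mult_minus_distrib_mat[of _ "dim_row M" "dim_col M" _ "dim_col M"]) (auto intro: carrier_matI)
  hence "transpose_mat Z = transpose_mat (T * S - 1\<^sub>m (dim_col M)) * transpose_mat M"
    by (simp add: mat_transpose_mult)
  hence "transpose_mat Z * Z = transpose_mat (T * S - 1\<^sub>m (dim_col M)) * (transpose_mat M * Z)"
    using Zc by (simp add: mat_assoc)
  also have "\<dots> = 0\<^sub>m (dim_col M) (dim_col M)" unfolding MTZ
    by (rule right_mult_zero_mat) (auto intro: carrier_matI)
  finally have "Z = 0\<^sub>m (dim_row M) (dim_col M)" by (rule gram_eq_0[OF Zc])
  hence MTS: "M * (T * S) = M"
  proof (intro eq_matI)
    fix i j assume ij: "i < dim_row M" "j < dim_col M"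
    assume "Z = 0\<^sub>m (dim_row M) (dim_col M)"
    hence "Z $$ (i,j) = 0" using ij by simp
    thus "(M * (T * S)) $$ (i,j) = M $$ (i,j)" using ij by (simp add: Z_def)
  qed auto
  have XMX: "T * (transpose_mat M * (M * (T * transpose_mat M))) = T * transpose_mat M"
    using arg_cong[OF T1(2), of "\<lambda>N. N * transpose_mat M"] by (simp add: S_def mat_assoc)
  have sXM: "transpose_mat (T * transpose_mat M * M) = T * transpose_mat M * M"
    using T1(4) by (simp add: S_def mat_assoc)
  have "is_pinv M (T * transpose_mat M)"
    unfolding is_pinv_def
  proof (intro conjI)
    show "M * (T * transpose_mat M) * M = M" using MTS by (simp add: S_def mat_assoc)
    show "T * transpose_mat M * M * (T * transpose_mat M) = T * transpose_mat M" using XMX by (simp add: mat_assoc)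
  qed (use sXM in \<open>auto simp: mat_normalise symT intro: carrier_matI\<close>)
  thus ?thesis by blast
qed

lemma is_pinv_pinv: "is_pinv M (pinv M)"
  unfolding pinv_def using is_pinv_exists[of M] is_pinv_unique[of M] by (blast intro: theI)

lemma pinv_dim[simp]: "dim_row (pinv M) = dim_col M" "dim_col (pinv M) = dim_row M"
  using is_pinv_pinv[of M] by (auto simp: is_pinv_def)

lemma pinv_eqs:
  "M * (pinv M * M) = M" "pinv M * (M * pinv M) = pinv M"
  "transpose_mat (M * pinv M) = M * pinv M" "transpose_mat (pinv M * M) = pinv M * M"
  using is_pinv_pinv[of M] by (auto simp: is_pinv_def mat_assoc)

lemma pinv_transpose: "pinv (transpose_mat M) = transpose_mat (pinv M)"
  using is_pinv_unique[OF is_pinv_pinv is_pinv_transpose[OF is_pinv_pinv]] .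

section \<open>Square roots of positive semidefinite matrices\<close>

lemma mat_diag_mult_vec:
  assumes "w \<in> carrier_vec n"
  shows "mat_diag n d *\<^sub>v w = Matrix.vec n (\<lambda>i. d i * w $ i :: real)"
proof (rule eq_vecI)
  fix i assume "i < dim_vec (Matrix.vec n (\<lambda>i. d i * w $ i))"
  hence i: "i < n" by simp
  have "(mat_diag n d *\<^sub>v w) $ i = (\<Sum>j<n. (if i = j then d j else 0) * w $ j)"
    using i assms by (auto simp: mat_diag_def scalar_prod_def atLeast0LessThan intro!: sum.cong)
  also have "\<dots> = (\<Sum>j<n. if i = j then d j * w $ j else 0)" by (rule sum.cong) auto
  finally show "(mat_diag n d *\<^sub>v w) $ i = Matrix.vec n (\<lambda>i. d i * w $ i) $ i" using i by simp
qed auto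

lemma scalar_prod_conj_diag:
  fixes U :: "real Matrix.mat"
  assumes U: "U \<in> carrier_mat n n" and v: "v \<in> carrier_vec n"
  shows "v \<bullet> (U * mat_diag n d * transpose_mat U *\<^sub>v v)
    = (\<Sum>i<n. d i * ((transpose_mat U *\<^sub>v v) $ i)\<^sup>2)"
proof -
  define w where "w = transpose_mat U *\<^sub>v v"
  have w: "w \<in> carrier_vec n" using U v by (simp add: w_def)
  note dw = mat_diag_mult_vec[OF w, of d]
  have "v \<bullet> (U * mat_diag n d * transpose_mat U *\<^sub>v v) = v \<bullet> (U *\<^sub>v (mat_diag n d *\<^sub>v w))"
    using U v by (simp add: mat_vec_assoc mat_assoc w_def)
  also have "\<dots> = w \<bullet> (mat_diag n d *\<^sub>v w)"
    unfolding w_def using U v by (subst scalar_prod_mult_mat_vec) auto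
  also have "\<dots> = (\<Sum>i<n. d i * (w $ i)\<^sup>2)"
    unfolding dw using w by (auto simp: scalar_prod_def atLeast0LessThan power2_eq_square mult_ac intro!: sum.cong)
  finally show ?thesis by (simp add: w_def)
qed

lemma psd_sqrt_exists:
  assumes M: "psd M"
  shows "\<exists>R. psd R \<and> dim_row R = dim_row M \<and> R * R = M"
proof -
  define n where "n = dim_row M"
  have Mc: "M \<in> carrier_mat n n" and sym: "transpose_mat M = M" using M by (auto simp: psd_def n_def)
  obtain U d where U: "U \<in> carrier_mat n n" and UU: "transpose_mat U * U = 1\<^sub>m n"
    and dec: "M = U * mat_diag n d * transpose_mat U"
    using symmetric_diagonalisation[OF Mc sym] by auto
  note c = orthogonal_cancel[OF U UU]
  have [simp]: "dim_row U = n" "dim_col U = n" using U by auto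
  have d: "0 \<le> d i" if i: "i < n" for i
  proof -
    \<comment> \<open>Testing the quadratic form at an eigenvector isolates the eigenvalue
      \<open>d i\<close>.\<close>
    have "transpose_mat U *\<^sub>v col U i = col (transpose_mat U * U) i" using U i by (intro eq_vecI) auto
    also have "\<dots> = unit_vec n i" unfolding UU using i by simp
    finally have 1: "transpose_mat U *\<^sub>v col U i = unit_vec n i" .
    have "0 \<le> col U i \<bullet> (M *\<^sub>v col U i)" using M Mc U i by (auto simp: psd_def)
    also have "\<dots> = (\<Sum>j<n. d j * (unit_vec n i $ j)\<^sup>2)"
      unfolding dec using U i by (subst scalar_prod_conj_diag[OF U]) (auto simp: 1)
    also have "\<dots> = (\<Sum>j<n. if j = i then d j else 0)" using i by (intro sum.cong) auto
    finally show ?thesis using i by simp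
  qed
  define R where "R = U * mat_diag n (\<lambda>i. sqrt (d i)) * transpose_mat U"
  have Rc: "R \<in> carrier_mat n n" by (auto simp: R_def intro!: carrier_matI)
  have "mat_diag n (\<lambda>i. sqrt (d i) * sqrt (d i)) = mat_diag n d"
    using d by (intro eq_matI) (auto simp: mat_diag_def)
  hence "R * R = M" unfolding R_def dec by (simp add: mat_normalise c mat_diag_mult_assoc)
  moreover have "psd R"
    unfolding psd_def using Rc scalar_prod_conj_diag[OF U] d
    by (auto simp: R_def mat_normalise intro!: sum_nonneg)
  ultimately show ?thesis using Rc by (auto simp: n_def)
qed

text \<open>Let \<open>u\<close> be an eigenvector of \<open>R - S\<close> with eigenvalue
  \<open>d \<noteq> 0\<close>. Equal squares give \<open>R u\<close> and \<open>S u\<close> the same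
  length, whence \<open>d * (u \<bullet> R u + u \<bullet> S u) = 0\<close>. Both products are
  nonnegative, so both vanish, yet they differ by \<open>d\<close>.\<close>

lemma psd_sqrt_unique:
  assumes R: "psd R" and S: "psd S" and dim: "dim_row R = dim_row S" and RS: "R * R = S * S"
  shows "R = S"
proof -
  define n where "n = dim_row R"
  have Rc: "R \<in> carrier_mat n n" and Sc: "S \<in> carrier_mat n n"
    and symR: "transpose_mat R = R" and symS: "transpose_mat S = S"
    using R S dim by (auto simp: psd_def n_def)
  have Dc: "R - S \<in> carrier_mat n n" using Rc Sc by auto
  have symD: "transpose_mat (R - S) = R - S" using symR symS Rc Sc by (simp add: transpose_minus)
  obtain U d where U: "U \<in> carrier_mat n n" and UU: "transpose_mat U * U = 1\<^sub>m n"
    and dec: "R - S = U * mat_diag n d * transpose_mat U"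
    using symmetric_diagonalisation[OF Dc symD] by auto
  note c = orthogonal_cancel[OF U UU]
  have [simp]: "dim_row U = n" "dim_col U = n" "dim_row R = n" "dim_col R = n" "dim_row S = n" "dim_col S = n"
    using U Rc Sc by auto
  have DU: "(R - S) * U = U * mat_diag n d"
    unfolding dec by (simp add: mat_assoc UU)
  have d0: "d i = 0" if i: "i < n" for i
  proof (rule ccontr)
    assume d: "d i \<noteq> 0"
    define u where "u = col U i"
    have u: "u \<in> carrier_vec n" using U i by (simp add: u_def)
    have uu: "u \<bullet> u = 1" using arg_cong[OF UU, of "\<lambda>M. M $$ (i,i)"] i by (simp add: u_def)
    have "(R - S) *\<^sub>v u = col ((R - S) * U) i" unfolding u_def using i by (intro eq_vecI) auto
    also have "\<dots> = d i \<cdot>\<^sub>v u"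
    proof (rule eq_vecI)
      fix j assume "j < dim_vec (d i \<cdot>\<^sub>v u)"
      hence j: "j < n" using u by simp
      have "col ((R - S) * U) i $ j = (\<Sum>k<n. U $$ (j,k) * (if k = i then d i else 0))"
        unfolding DU using i j U by (auto simp: scalar_prod_def atLeast0LessThan mat_diag_def intro!: sum.cong)
      also have "\<dots> = (\<Sum>k<n. if k = i then U $$ (j,k) * d i else 0)" by (rule sum.cong) auto
      finally show "col ((R - S) * U) i $ j = (d i \<cdot>\<^sub>v u) $ j" using i j U by (simp add: u_def)
    qed (use u in auto)
    finally have ev: "R *\<^sub>v u - S *\<^sub>v u = d i \<cdot>\<^sub>v u"
      using u Rc Sc by (simp add: minus_mult_distrib_mat_vec[of _ n n])
    define a where "a = R *\<^sub>v u"
    define b where "b = S *\<^sub>v u"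
    have ab: "a \<in> carrier_vec n" "b \<in> carrier_vec n" using u Rc Sc by (auto simp: a_def b_def)
    have aa: "a \<bullet> a = b \<bullet> b"
    proof -
      have "a \<bullet> a = u \<bullet> ((R * R) *\<^sub>v u)"
        using u symR by (simp add: mat_vec_assoc scalar_prod_mult_mat_vec a_def)
      also have "\<dots> = u \<bullet> ((S * S) *\<^sub>v u)" unfolding RS ..
      also have "\<dots> = b \<bullet> b"
        using u symS by (simp add: mat_vec_assoc scalar_prod_mult_mat_vec b_def)
      finally show ?thesis .
    qed
    have a_eq: "a = b + d i \<cdot>\<^sub>v u"
    proof (rule eq_vecI)
      fix j assume "j < dim_vec (b + d i \<cdot>\<^sub>v u)"
      hence "j < n" using u ab by simp
      thus "a $ j = (b + d i \<cdot>\<^sub>v u) $ j"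
        using arg_cong[OF ev, of "\<lambda>v. v $ j"] ab u by (simp add: a_def[symmetric] b_def[symmetric])
    qed (use u ab in auto)
    have uab: "u \<bullet> a = u \<bullet> b + d i"
      unfolding a_eq using ab u uu by (simp add: scalar_prod_add_distrib[of _ n])
    have "a \<bullet> a = a \<bullet> b + d i * (u \<bullet> a)"
      using ab u by (subst (2) a_eq) (simp add: scalar_prod_add_distrib[of _ n] comm_scalar_prod[of a n u])
    moreover have "a \<bullet> b = b \<bullet> b + d i * (u \<bullet> b)"
      using ab u by (subst a_eq) (simp add: add_scalar_prod_distrib[of _ n])
    ultimately have "d i * (u \<bullet> a + u \<bullet> b) = 0" using aa by (simp add: algebra_simps)
    moreover have "0 \<le> u \<bullet> a" "0 \<le> u \<bullet> b" using R S u by (auto simp: psd_def a_def b_def)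
    ultimately show False using uab d by auto
  qed
  have "mat_diag n d = 0\<^sub>m n n" using d0 by (intro eq_matI) (auto simp: mat_diag_def)
  hence "R - S = 0\<^sub>m n n" unfolding dec using U by simp
  hence "(R - S) $$ (i,j) = 0" if "i < n" "j < n" for i j using that by simp
  thus ?thesis by (intro eq_matI) auto
qed

lemma psd_sqrt:
  assumes "psd M"
  shows "psd (psd_sqrt M)" "dim_row (psd_sqrt M) = dim_row M" "psd_sqrt M * psd_sqrt M = M"
proof -
  have "\<exists>!R. psd R \<and> dim_row R = dim_row M \<and> R * R = M"
    using psd_sqrt_exists[OF assms] psd_sqrt_unique by metis
  from theI'[OF this] show "psd (psd_sqrt M)" "dim_row (psd_sqrt M) = dim_row M" "psd_sqrt M * psd_sqrt M = M"
    unfolding psd_sqrt_def by auto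
qed

section \<open>Weighted Gram matrices on the orthogonal complement of the kernel\<close>

lemma ker_perp_carrier: "x \<in> ker_perp A \<Longrightarrow> x \<in> carrier_vec (dim_col A)"
  by (simp add: ker_perp_def)

lemma transpose_mult_in_ker_perp:
  assumes w: "w \<in> carrier_vec (dim_row A)"
  shows "transpose_mat A *\<^sub>v w \<in> ker_perp A"
proof -
  have "(transpose_mat A *\<^sub>v w) \<bullet> y = 0" if y: "y \<in> mat_kernel A" for y
  proof -
    have y': "y \<in> carrier_vec (dim_col A)" "A *\<^sub>v y = 0\<^sub>v (dim_row A)" using y by (auto simp: mat_kernel_def)
    have "w \<bullet> (A *\<^sub>v y) = (transpose_mat A *\<^sub>v w) \<bullet> y"
      using w y' by (intro scalar_prod_mult_mat_vec) auto
    thus ?thesis using w y' by simp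
  qed
  thus ?thesis by (auto simp: ker_perp_def intro: carrier_vecI)
qed

lemma ker_perp_kernel_0:
  assumes x: "x \<in> ker_perp A" and 0: "A *\<^sub>v x = 0\<^sub>v (dim_row A)"
  shows "x = 0\<^sub>v (dim_col A)"
proof -
  have "x \<in> mat_kernel A" using x 0 by (auto simp: ker_perp_def mat_kernel_def)
  with x have "x \<bullet> x = 0" by (auto simp: ker_perp_def)
  thus ?thesis using ker_perp_carrier[OF x] scalar_prod_self_eq_0 by blast
qed

lemma ker_perp_diff:
  assumes x: "x \<in> ker_perp A" and y: "y \<in> ker_perp A"
  shows "x - y \<in> ker_perp A"
  unfolding ker_perp_def
proof safe
  show "x - y \<in> carrier_vec (dim_col A)" using ker_perp_carrier[OF x] ker_perp_carrier[OF y] by simp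
  fix z assume z: "z \<in> mat_kernel A"
  hence "z \<in> carrier_vec (dim_col A)" by (auto simp: mat_kernel_def)
  thus "(x - y) \<bullet> z = 0" using ker_perp_carrier[OF x] ker_perp_carrier[OF y] x y z
    by (subst minus_scalar_prod_distrib[of _ "dim_col A"]) (auto simp: ker_perp_def)
qed

lemma vec_diff_eq_0:
  fixes a b :: "real Matrix.vec"
  assumes "a \<in> carrier_vec n" "b \<in> carrier_vec n" "a - b = 0\<^sub>v n"
  shows "a = b"
proof (rule eq_vecI)
  fix i assume "i < dim_vec b"
  hence i: "i < n" "i < dim_vec b" using assms by auto
  have "(a - b) $ i = 0" unfolding assms(3) using i by simp
  thus "a $ i = b $ i" using i by simp
qed (use assms in auto)

text \<open>Arbitrary weights give one treatment for the matrix behind the preconditioners and, with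
  unit weights, for the matrix in \<open>t_init\<close>.\<close>

definition gram :: "real Matrix.mat \<Rightarrow> (nat \<Rightarrow> real) \<Rightarrow> real Matrix.mat" where
  "gram A W = transpose_mat A * mat_diag (dim_row A) W * A"

lemma gram_dim[simp]: "dim_row (gram A W) = dim_col A" "dim_col (gram A W) = dim_col A"
  by (auto simp: gram_def)

lemma gram_transpose[simp]: "transpose_mat (gram A W) = gram A W"
  by (simp add: gram_def mat_normalise)

lemma gram_quadratic:
  assumes v: "v \<in> carrier_vec (dim_col A)"
  shows "v \<bullet> (gram A W *\<^sub>v v) = (\<Sum>i<dim_row A. W i * ((A *\<^sub>v v) $ i)\<^sup>2)"
proof -
  have Av: "A *\<^sub>v v \<in> carrier_vec (dim_row A)" using v by (auto intro: carrier_vecI)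
  have "v \<bullet> (gram A W *\<^sub>v v) = v \<bullet> (transpose_mat A *\<^sub>v (mat_diag (dim_row A) W *\<^sub>v (A *\<^sub>v v)))"
    using v by (simp add: gram_def mat_vec_assoc)
  also have "\<dots> = (A *\<^sub>v v) \<bullet> (mat_diag (dim_row A) W *\<^sub>v (A *\<^sub>v v))"
    using v by (subst scalar_prod_mult_mat_vec) auto
  also have "\<dots> = (\<Sum>i<dim_row A. W i * ((A *\<^sub>v v) $ i)\<^sup>2)"
    unfolding mat_diag_mult_vec[OF Av]
    by (auto simp: scalar_prod_def atLeast0LessThan power2_eq_square mult_ac simp del: index_mult_mat_vec intro!: sum.cong)
  finally show ?thesis .
qed

text \<open>With positive weights the quadratic form of the Gram matrix vanishes only on the kernel
  of \<open>A\<close>. The defect \<open>r\<close> of the first identity is killed by the Gram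
  matrix, and it lies in \<open>ker_perp A\<close> because a symmetric matrix commutes with its
  pseudo-inverse; so it is 0.\<close>

lemma gram_inverse_on_ker_perp:
  assumes W: "\<And>i. i < dim_row A \<Longrightarrow> 0 < W i" and x: "x \<in> ker_perp A"
  shows "pinv (gram A W) *\<^sub>v (gram A W *\<^sub>v x) = x" "gram A W *\<^sub>v (pinv (gram A W) *\<^sub>v x) = x"
proof -
  define B where "B = gram A W"
  define M where "M = pinv B"
  note xc = ker_perp_carrier[OF x]
  have [simp]: "dim_vec x = dim_col A" using xc by auto
  have dB[simp]: "dim_row B = dim_col A" "dim_col B = dim_col A" "dim_row M = dim_col A" "dim_col M = dim_col A"
    by (auto simp: B_def M_def)
  have symB: "transpose_mat B = B" by (simp add: B_def)
  have symM: "transpose_mat M = M" using pinv_transpose[of B] symB by (simp add: M_def)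
  have comm: "M * B = B * M"
    using pinv_eqs(3)[of B] by (simp add: mat_transpose_mult symB symM M_def[symmetric])
  have MBx: "M *\<^sub>v (B *\<^sub>v x) = B *\<^sub>v (M *\<^sub>v x)"
    using arg_cong[OF comm, of "\<lambda>N. N *\<^sub>v x"] by (simp add: mat_vec_assoc)
  have range: "B *\<^sub>v (M *\<^sub>v x) = transpose_mat A *\<^sub>v ((mat_diag (dim_row A) W * A) *\<^sub>v (M *\<^sub>v x))"
    by (simp add: B_def gram_def mat_vec_assoc)
  have "(mat_diag (dim_row A) W * A) *\<^sub>v (M *\<^sub>v x) \<in> carrier_vec (dim_row A)" by (intro carrier_vecI) simp
  hence "B *\<^sub>v (M *\<^sub>v x) \<in> ker_perp A" unfolding range by (rule transpose_mult_in_ker_perp)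
  hence rk: "x - M *\<^sub>v (B *\<^sub>v x) \<in> ker_perp A" unfolding MBx using x by (intro ker_perp_diff)
  define r where "r = x - M *\<^sub>v (B *\<^sub>v x)"
  have rc: "r \<in> carrier_vec (dim_col A)" using rk ker_perp_carrier by (auto simp: r_def)
  have "B *\<^sub>v r = B *\<^sub>v x - B *\<^sub>v (M *\<^sub>v (B *\<^sub>v x))"
    unfolding r_def using xc by (intro mult_minus_distrib_mat_vec[of _ "dim_col A" "dim_col A"]) (auto intro: carrier_matI carrier_vecI)
  also have "B *\<^sub>v (M *\<^sub>v (B *\<^sub>v x)) = B *\<^sub>v x"
    using arg_cong[OF pinv_eqs(1)[of B], of "\<lambda>N. N *\<^sub>v x"] by (simp add: mat_vec_assoc M_def[symmetric])
  finally have "B *\<^sub>v r = 0\<^sub>v (dim_col A)" by (auto simp: intro!: eq_vecI)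
  hence "(\<Sum>i<dim_row A. W i * ((A *\<^sub>v r) $ i)\<^sup>2) = 0"
    using gram_quadratic[OF rc, of W] rc by (simp add: B_def)
  hence "\<forall>i<dim_row A. W i * ((A *\<^sub>v r) $ i)\<^sup>2 = 0"
    using W by (subst (asm) sum_nonneg_eq_0_iff) (auto intro!: mult_nonneg_nonneg simp: less_imp_le simp del: index_mult_mat_vec)
  hence "\<forall>i<dim_row A. (A *\<^sub>v r) $ i = 0" using W by (metis less_irrefl mult_eq_0_iff zero_eq_power2)
  hence "A *\<^sub>v r = 0\<^sub>v (dim_row A)" by (intro eq_vecI) auto
  hence "r = 0\<^sub>v (dim_col A)" using ker_perp_kernel_0 rk r_def by blast
  hence "x - M *\<^sub>v (B *\<^sub>v x) = 0\<^sub>v (dim_col A)" by (simp add: r_def)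
  hence "x = M *\<^sub>v (B *\<^sub>v x)" by (rule vec_diff_eq_0[rotated 2]) (use xc in \<open>auto intro: carrier_vecI\<close>)
  thus "pinv (gram A W) *\<^sub>v (gram A W *\<^sub>v x) = x" "gram A W *\<^sub>v (pinv (gram A W) *\<^sub>v x) = x"
    using MBx by (auto simp: M_def B_def)
qed

lemma gram_psd:
  assumes W: "\<And>i. i < dim_row A \<Longrightarrow> 0 \<le> W i"
  shows "psd (gram A W)"
  unfolding psd_def using gram_quadratic[of _ A W] W
  by (auto intro!: sum_nonneg mult_nonneg_nonneg)

text \<open>The form of \<open>pinv B\<close> at \<open>v\<close> is the form of \<open>B\<close> at
  \<open>pinv B *\<^sub>v v\<close>.\<close>

lemma pinv_psd:
  assumes B: "psd B"
  shows "psd (pinv B)"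
proof -
  have dB: "dim_col B = dim_row B" and symB: "transpose_mat B = B" using B by (auto simp: psd_def)
  have symM: "transpose_mat (pinv B) = pinv B" using pinv_transpose[of B] symB by simp
  have "0 \<le> v \<bullet> (pinv B *\<^sub>v v)" if v: "v \<in> carrier_vec (dim_row B)" for v
  proof -
    have "v \<bullet> (pinv B *\<^sub>v v) = v \<bullet> (pinv B *\<^sub>v (B *\<^sub>v (pinv B *\<^sub>v v)))"
      using arg_cong[OF pinv_eqs(2)[of B], of "\<lambda>N. N *\<^sub>v v"] v dB by (simp add: mat_vec_assoc)
    also have "\<dots> = (pinv B *\<^sub>v v) \<bullet> (B *\<^sub>v (pinv B *\<^sub>v v))"
      using v dB by (subst scalar_prod_mult_mat_vec) (auto simp: symM)
    also have "\<dots> \<ge> 0"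
    proof -
      have "pinv B *\<^sub>v v \<in> carrier_vec (dim_row B)" using dB by (intro carrier_vecI) simp
      thus ?thesis using B by (simp add: psd_def)
    qed
    finally show ?thesis .
  qed
  thus ?thesis using symM dB by (auto simp: psd_def)
qed

text \<open>All that later proofs know about the two preconditioners, so that both are treated
  alike. The bound on the number of columns limits the cost of vector operations in the domain of
  \<open>P\<close>.\<close>

lemma precond_gram:
  fixes p t :: real and A :: "real Matrix.mat" and s :: "real Matrix.vec" and pre :: precond_fun
  assumes pre: "pre \<in> {precond, precond'}" and s: "dim_vec s = dim_row A" and p: "1 < p"
  defines "P \<equiv> pre p A t s" and "W \<equiv> \<lambda>i. weight p (dim_row A) t (s $ i)"
  shows "P * transpose_mat P = pinv (gram A W)" "dim_row P = dim_col A"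
    "dim_col P \<le> max (dim_row A) (dim_col A)"
proof -
  have W0: "0 \<le> W i" for i unfolding W_def weight_def using p by (intro mult_nonneg_nonneg) auto
  have psdB: "psd (gram A W)" using W0 by (intro gram_psd) auto
  have wm: "weight_mat p t s = mat_diag (dim_row A) W" by (simp add: weight_mat_def W_def s)
  have swm: "sqrt_weight_mat p t s = mat_diag (dim_row A) (\<lambda>i. sqrt (W i))" by (simp add: sqrt_weight_mat_def W_def s)
  \<comment> \<open>Simplification turns \<open>sqrt (W i) * sqrt (W i)\<close> into
    \<open>\<bar>W i\<bar>\<close>.\<close>
  have ww: "mat_diag (dim_row A) (\<lambda>i. \<bar>W i\<bar>) = mat_diag (dim_row A) W"
    using W0 by (intro eq_matI) (auto simp: mat_diag_def)
  define M where "M = pinv (gram A W)"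
  have dM[simp]: "dim_row M = dim_col A" "dim_col M = dim_col A" by (auto simp: M_def)
  have symM: "transpose_mat M = M" using pinv_transpose[of "gram A W"] by (simp add: M_def)
  consider "P = psd_sqrt M" | "P = M * transpose_mat A * mat_diag (dim_row A) (\<lambda>i. sqrt (W i))"
  proof -
    assume 1: "P = psd_sqrt M \<Longrightarrow> thesis"
      and 2: "P = M * transpose_mat A * mat_diag (dim_row A) (\<lambda>i. sqrt (W i)) \<Longrightarrow> thesis"
    from pre have "pre = precond \<or> pre = precond'" by simp
    thus thesis
    proof
      assume "pre = precond"
      thus thesis by (intro 1) (simp only: P_def M_def gram_def wm[symmetric] precond_def)
    next
      assume "pre = precond'"
      thus thesis by (intro 2) (simp only: P_def M_def gram_def wm[symmetric] swm[symmetric] precond'_def)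
    qed
  qed
  hence *: "P * transpose_mat P = M \<and> dim_row P = dim_col A \<and> dim_col P \<le> max (dim_row A) (dim_col A)"
  proof cases
    case 1
    have "psd M" unfolding M_def by (rule pinv_psd[OF psdB])
    note R = psd_sqrt[OF this]
    have R': "transpose_mat P = P" "dim_col P = dim_row P" using R(1) unfolding 1 by (simp_all add: psd_def)
    have "dim_row P = dim_col A" using R(2) unfolding 1 by simp
    thus ?thesis using R' R(3) unfolding 1 by simp
  next
    case 2
    have "P * transpose_mat P = M * (gram A W * M)"
      unfolding 2 gram_def by (simp add: mat_normalise symM mat_diag_mult_assoc) (simp only: ww)
    also have "\<dots> = M" using pinv_eqs(2)[of "gram A W"] by (simp add: M_def)
    finally have "P * transpose_mat P = M" .
    moreover have "dim_row P = dim_col A" unfolding 2 by simp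
    moreover have "dim_col P \<le> max (dim_row A) (dim_col A)" unfolding 2 by simp
    ultimately show ?thesis by (intro conjI)
  qed
  from * show "P * transpose_mat P = pinv (gram A W)" unfolding M_def by (elim conjE)
  from * show "dim_row P = dim_col A" by (elim conjE)
  from * show "dim_col P \<le> max (dim_row A) (dim_col A)" by (elim conjE)
qed

text \<open>Gradients of functions of \<open>P *\<^sub>v y\<close> lie here, and so does the
  least-norm start; this is the subspace that AGD explores.\<close>

definition row_space :: "real Matrix.mat \<Rightarrow> real Matrix.vec set" where
  "row_space P = (\<lambda>u. transpose_mat P *\<^sub>v u) ` carrier_vec (dim_row P)"

lemma row_space_carrier:
  assumes "y \<in> row_space P"
  shows "y \<in> carrier_vec (dim_col P)"
proof -
  obtain u where y: "y = transpose_mat P *\<^sub>v u" using assms unfolding row_space_def by (rule imageE)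
  show ?thesis unfolding y by (rule carrier_vecI) simp
qed

lemma row_space_lincomb:
  assumes "y \<in> row_space P" "z \<in> row_space P"
  shows "a \<cdot>\<^sub>v y + b \<cdot>\<^sub>v z \<in> row_space P"
proof -
  obtain u v where uv: "u \<in> carrier_vec (dim_row P)" "v \<in> carrier_vec (dim_row P)"
    "y = transpose_mat P *\<^sub>v u" "z = transpose_mat P *\<^sub>v v"
    using assms unfolding row_space_def by blast
  have T: "transpose_mat P \<in> carrier_mat (dim_col P) (dim_row P)" by simp
  have "transpose_mat P *\<^sub>v (a \<cdot>\<^sub>v u + b \<cdot>\<^sub>v v) = transpose_mat P *\<^sub>v (a \<cdot>\<^sub>v u) + transpose_mat P *\<^sub>v (b \<cdot>\<^sub>v v)"
    using uv(1,2) by (intro mult_add_distrib_mat_vec[OF T]) auto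
  also have "\<dots> = a \<cdot>\<^sub>v y + b \<cdot>\<^sub>v z"
    unfolding uv(3,4) mult_mat_vec[OF T uv(1)] mult_mat_vec[OF T uv(2)] ..
  finally have eq: "a \<cdot>\<^sub>v y + b \<cdot>\<^sub>v z = transpose_mat P *\<^sub>v (a \<cdot>\<^sub>v u + b \<cdot>\<^sub>v v)" ..
  have "a \<cdot>\<^sub>v u + b \<cdot>\<^sub>v v \<in> carrier_vec (dim_row P)" using uv by simp
  thus ?thesis unfolding row_space_def eq by (rule imageI)
qed

lemma pinv_in_row_space:
  assumes "x \<in> carrier_vec (dim_row P)"
  shows "pinv P *\<^sub>v x \<in> row_space P"
proof -
  define N where "N = transpose_mat (pinv P) * pinv P"
  have dx: "dim_vec x = dim_row P" using assms by simp
  have dN: "dim_row N = dim_row P" "dim_col N = dim_row P" by (simp_all add: N_def)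
  have "transpose_mat P * N = transpose_mat (pinv P * P) * pinv P"
    unfolding N_def by (simp only: mat_normalise pinv_dim index_transpose_mat index_mult_mat)
  also have "\<dots> = pinv P" unfolding pinv_eqs(4)
    using pinv_eqs(2)[of P] by (simp only: mat_assoc pinv_dim)
  finally have "pinv P *\<^sub>v x = (transpose_mat P * N) *\<^sub>v x" by (rule arg_cong[OF sym])
  also have "\<dots> = transpose_mat P *\<^sub>v (N *\<^sub>v x)"
    by (rule mat_vec_assoc) (simp_all add: dx dN)
  finally have eq: "pinv P *\<^sub>v x = transpose_mat P *\<^sub>v (N *\<^sub>v x)" .
  have "N *\<^sub>v x \<in> carrier_vec (dim_row P)" by (rule carrier_vecI) (simp add: dN)
  thus ?thesis unfolding row_space_def eq by (rule imageI)
qed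

text \<open>Everything rests on \<open>transpose_mat P * (B * M) = transpose_mat P\<close>: the
  defect \<open>transpose_mat P * E\<close> has the Gram matrix \<open>E\<^sup>T * M * E\<close>,
  and \<open>M * E = 0\<close>. Transposed, the identity puts the range of \<open>P\<close> into
  that of the transpose of \<open>A\<close>; applied to
  \<open>y = transpose_mat P *\<^sub>v u\<close>, it shows that
  \<open>transpose_mat P * B * P\<close> fixes the row space, which is the isometry.\<close>

lemma gram_factor:
  assumes P: "P * transpose_mat P = pinv (gram A W)" "dim_row P = dim_col A"
    and W: "\<And>i. i < dim_row A \<Longrightarrow> 0 < W i"
  shows "y \<in> carrier_vec (dim_col P) \<Longrightarrow> P *\<^sub>v y \<in> ker_perp A"
    and "x \<in> ker_perp A \<Longrightarrow> P *\<^sub>v (pinv P *\<^sub>v x) = x"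
    and "y \<in> row_space P \<Longrightarrow> (\<Sum>i<dim_row A. W i * ((A *\<^sub>v (P *\<^sub>v y)) $ i)\<^sup>2) = y \<bullet> y"
proof -
  define B where "B = gram A W"
  define M where "M = pinv B"
  define d where "d = dim_col A"
  define m where "m = dim_col P"
  have dB[simp]: "dim_row B = d" "dim_col B = d" "dim_row M = d" "dim_col M = d" "dim_row P = d" "dim_col P = m" "dim_col A = d"
    by (auto simp: B_def M_def P d_def m_def)
  have PP: "P * transpose_mat P = M" using P by (simp add: M_def B_def)
  have symB: "transpose_mat B = B" by (simp add: B_def)
  have symM: "transpose_mat M = M" using pinv_transpose[of B] symB by (simp add: M_def)
  have comm: "M * B = B * M"
    using pinv_eqs(3)[of B] by (simp add: mat_transpose_mult symB symM M_def[symmetric])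
  have MBM: "M * (B * M) = M" using pinv_eqs(2)[of B] by (simp add: M_def)
  define E where "E = B * M - 1\<^sub>m d"
  have Ec: "E \<in> carrier_mat d d" by (auto simp: E_def intro: carrier_matI)
  have dE[simp]: "dim_row E = d" "dim_col E = d" using Ec by auto
  have EM: "M * E = 0\<^sub>m d d"
  proof -
    have "M * E = M * (B * M) - M * 1\<^sub>m d"
      unfolding E_def by (rule mult_minus_distrib_mat[of _ d d _ d]) (auto intro: carrier_matI)
    thus ?thesis using MBM by (auto intro!: eq_matI)
  qed
  have "transpose_mat (transpose_mat P * E) * (transpose_mat P * E) = transpose_mat E * (P * transpose_mat P * E)"
    by (simp add: mat_normalise)
  also have "\<dots> = 0\<^sub>m d d" unfolding PP EM using Ec by simp
  finally have "transpose_mat P * E = 0\<^sub>m m d"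
    by (rule gram_eq_0[rotated]) (rule carrier_matI; simp)
  moreover have "transpose_mat P * E = transpose_mat P * (B * M) - transpose_mat P"
    unfolding E_def by (subst mult_minus_distrib_mat[of _ m d _ d]) (auto intro: carrier_matI)
  ultimately have diff0: "transpose_mat P * (B * M) - transpose_mat P = 0\<^sub>m m d" by simp
  have PBM: "transpose_mat P * (B * M) = transpose_mat P"
  proof (rule eq_matI)
    fix i j assume "i < dim_row (transpose_mat P)" "j < dim_col (transpose_mat P)"
    hence "i < m" "j < d" by auto
    thus "(transpose_mat P * (B * M)) $$ (i,j) = transpose_mat P $$ (i,j)"
      using arg_cong[OF diff0, of "\<lambda>N. N $$ (i,j)"] by (simp del: index_mult_mat)
  qed auto
  have BMP: "B * (M * P) = P"
  proof -
    have "transpose_mat (transpose_mat P * (B * M)) = transpose_mat (transpose_mat P)" unfolding PBM ..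
    hence "M * B * P = P" by (simp add: mat_normalise symB symM)
    thus ?thesis unfolding comm by (simp add: mat_assoc)
  qed
  show "P *\<^sub>v y \<in> ker_perp A" if y: "y \<in> carrier_vec (dim_col P)"
  proof -
    have [simp]: "dim_vec y = m" using y by simp
    have "P *\<^sub>v y = (B * (M * P)) *\<^sub>v y" unfolding BMP ..
    also have "\<dots> = transpose_mat A *\<^sub>v ((mat_diag (dim_row A) W * A * M * P) *\<^sub>v y)"
      by (simp add: B_def gram_def mat_vec_assoc mat_assoc)
    also have "\<dots> \<in> ker_perp A" by (rule transpose_mult_in_ker_perp) (auto intro: carrier_vecI)
    finally show ?thesis .
  qed
  show "P *\<^sub>v (pinv P *\<^sub>v x) = x" if x: "x \<in> ker_perp A"
  proof -
    have [simp]: "dim_vec x = d" using ker_perp_carrier[OF x] by simp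
    have "x = M *\<^sub>v (B *\<^sub>v x)" using gram_inverse_on_ker_perp(1)[of A W x] W x by (simp add: M_def B_def)
    also have "\<dots> = P *\<^sub>v (transpose_mat P *\<^sub>v (B *\<^sub>v x))"
      by (simp add: PP[symmetric] mat_vec_assoc)
    finally have x_eq: "x = P *\<^sub>v (transpose_mat P *\<^sub>v (B *\<^sub>v x))" .
    define w where "w = transpose_mat P *\<^sub>v (B *\<^sub>v x)"
    have [simp]: "dim_vec w = m" by (simp add: w_def)
    have "P *\<^sub>v (pinv P *\<^sub>v (P *\<^sub>v w)) = P *\<^sub>v w"
      using arg_cong[OF pinv_eqs(1)[of P], of "\<lambda>N. N *\<^sub>v w"] by (simp add: mat_vec_assoc)
    thus ?thesis using x_eq w_def by simp
  qed
  show "(\<Sum>i<dim_row A. W i * ((A *\<^sub>v (P *\<^sub>v y)) $ i)\<^sup>2) = y \<bullet> y" if y: "y \<in> row_space P"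
  proof -
    obtain u where u: "u \<in> carrier_vec d" "y = transpose_mat P *\<^sub>v u" using y by (auto simp: row_space_def)
    have du[simp]: "dim_vec u = d" using u by simp
    have dy[simp]: "dim_vec y = m" using u by simp
    have Pyc: "P *\<^sub>v y \<in> carrier_vec (dim_col A)" by (intro carrier_vecI) simp
    have PBPy: "transpose_mat P *\<^sub>v (B *\<^sub>v (P *\<^sub>v y)) = y"
    proof -
      have "transpose_mat P *\<^sub>v (B *\<^sub>v (P *\<^sub>v y)) = (transpose_mat P * (B * (P * transpose_mat P))) *\<^sub>v u"
        unfolding u(2) by (simp add: mat_vec_assoc)
      also have "\<dots> = y" unfolding PP PBM u(2) ..
      finally show ?thesis .
    qed
    have "(\<Sum>i<dim_row A. W i * ((A *\<^sub>v (P *\<^sub>v y)) $ i)\<^sup>2) = (P *\<^sub>v y) \<bullet> (B *\<^sub>v (P *\<^sub>v y))"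
      using gram_quadratic[OF Pyc, of W] by (simp add: B_def)
    also have "\<dots> = (B *\<^sub>v (P *\<^sub>v y)) \<bullet> (P *\<^sub>v y)"
      by (rule comm_scalar_prod[of _ d]) (auto intro: carrier_vecI)
    also have "\<dots> = y \<bullet> y"
      by (subst scalar_prod_mult_mat_vec) (auto simp: PBPy)
    finally show ?thesis .
  qed
qed

subsection \<open>The smoothed loss and its quadratic extension\<close>

text \<open>The derivative of the smoothed loss has kinks at \<open>t\<close> and
  \<open>- t\<close>, so monotonicity must follow from a derivative missing at finitely many points;
  the fundamental theorem of calculus tolerates them.\<close>

lemma mono_off_finite:
  fixes F F' :: "real \<Rightarrow> real"
  assumes S: "finite S" and ab: "a \<le> b" and cont: "continuous_on {a..b} F"
    and der: "\<And>x. a < x \<Longrightarrow> x < b \<Longrightarrow> x \<notin> S \<Longrightarrow> (F has_real_derivative F' x) (at x)"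
    and nonneg: "\<And>x. a < x \<Longrightarrow> x < b \<Longrightarrow> x \<notin> S \<Longrightarrow> 0 \<le> F' x"
  shows "F a \<le> F b"
proof -
  define G where "G x = (if a < x \<and> x < b \<and> x \<notin> S then F' x else 0)" for x
  have "(G has_integral (F b - F a)) {a..b}"
  proof (rule fundamental_theorem_of_calculus_interior_strong[OF S ab _ cont])
    fix x assume "x \<in> {a<..<b} - S"
    thus "(F has_vector_derivative G x) (at x)"
      using der[of x] by (simp add: G_def has_real_derivative_iff_has_vector_derivative)
  qed
  hence "0 \<le> F b - F a" by (rule has_integral_nonneg) (auto simp: G_def nonneg)
  thus ?thesis by simp
qed

text \<open>Both branches are differentiable up to and including the seam, so only values and slopes
  at \<open>c\<close> have to match.\<close>

lemma DERIV_if_less: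
  fixes f g :: "real \<Rightarrow> real"
  assumes g: "\<And>x. x \<le> c \<Longrightarrow> (g has_real_derivative g' x) (at x)"
    and f: "\<And>x. c \<le> x \<Longrightarrow> (f has_real_derivative f' x) (at x)"
    and eq: "g c = f c" "g' c = f' c"
  shows "((\<lambda>x. if x < c then g x else f x) has_real_derivative (if x < c then g' x else f' x)) (at x)"
    (is "(?h has_real_derivative _) _")
proof -
  consider "x < c" | "c < x" | "x = c" by linarith
  thus ?thesis
  proof cases
    case 1
    have "(?h has_real_derivative g' x) (at x)"
      by (rule has_field_derivative_transform_within_open[OF g[of x], of "{..<c}"]) (use 1 in auto)
    thus ?thesis using 1 by simp
  next
    case 2
    have "(?h has_real_derivative f' x) (at x)"
      by (rule has_field_derivative_transform_within_open[OF f[of x], of "{c<..}"]) (use 2 in auto)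
    thus ?thesis using 2 by simp
  next
    case 3
    have "(?h has_real_derivative f' c) (at c within {..c})"
      by (rule has_field_derivative_transform_within[OF has_field_derivative_at_within[OF g[of c, unfolded eq(2)]], of 1])
        (auto simp: eq)
    moreover have "(?h has_real_derivative f' c) (at c within {c..})"
      by (rule has_field_derivative_transform_within[OF has_field_derivative_at_within[OF f[of c]], of 1]) auto
    ultimately have "(?h has_real_derivative f' c) (at c within ({..c} \<union> {c..}))"
      unfolding has_field_derivative_iff by (rule Lim_Un)
    moreover have "{..c} \<union> {c..} = UNIV" by auto
    ultimately show ?thesis using 3 by simp
  qed
qed

lemma DERIV_if_greater:
  fixes f g :: "real \<Rightarrow> real"
  assumes g: "\<And>x. c \<le> x \<Longrightarrow> (g has_real_derivative g' x) (at x)"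
    and f: "\<And>x. x \<le> c \<Longrightarrow> (f has_real_derivative f' x) (at x)"
    and eq: "g c = f c" "g' c = f' c"
  shows "((\<lambda>x. if c < x then g x else f x) has_real_derivative (if c < x then g' x else f' x)) (at x)"
proof -
  have "(\<lambda>x. if c < x then g x else f x) = (\<lambda>x. if x < c then f x else g x)"
       "(if c < x then g' x else f' x) = (if x < c then f' x else g' x)"
    using eq by (auto simp: fun_eq_iff not_less_iff_gr_or_eq)
  thus ?thesis using DERIV_if_less[of c f f' g g' x] f g eq by simp
qed

lemma bregman_nonneg:
  fixes H H' :: "real \<Rightarrow> real"
  assumes der: "\<And>x. (H has_real_derivative H' x) (at x)" and mono: "\<And>x y. x \<le> y \<Longrightarrow> H' x \<le> H' y"
  shows "0 \<le> H a - H b - H' b * (a - b)"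
proof (cases a b rule: linorder_cases)
  case less
  obtain z where z: "a < z" "z < b" "H b - H a = (b - a) * H' z"
    using MVT2[OF less, of H H'] der by blast
  have "(b - a) * H' z \<le> (b - a) * H' b" using less z mono[of z b] by (intro mult_left_mono) auto
  thus ?thesis using z(3) by (simp add: algebra_simps)
next
  case greater
  obtain z where z: "b < z" "z < a" "H a - H b = (a - b) * H' z"
    using MVT2[OF greater, of H H'] der by blast
  have "(a - b) * H' b \<le> (a - b) * H' z" using greater z mono[of b z] by (intro mult_left_mono) auto
  thus ?thesis using z(3) by (simp add: algebra_simps)
qed simp

text \<open>Apply \<open>bregman_nonneg\<close> to \<open>H\<close> minus the quadratic of curvature
  \<open>lo\<close>, and to the quadratic of curvature \<open>hi\<close> minus
  \<open>H\<close>.\<close>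

lemma bregman_bounds:
  fixes H H' :: "real \<Rightarrow> real"
  assumes der: "\<And>x. (H has_real_derivative H' x) (at x)"
    and lo: "\<And>x y. x \<le> y \<Longrightarrow> lo * (y - x) \<le> H' y - H' x"
    and hi: "\<And>x y. x \<le> y \<Longrightarrow> H' y - H' x \<le> hi * (y - x)"
  shows "lo / 2 * (a - b)\<^sup>2 \<le> H a - H b - H' b * (a - b)"
    and "H a - H b - H' b * (a - b) \<le> hi / 2 * (a - b)\<^sup>2"
proof -
  have "((\<lambda>x. H x - lo / 2 * x\<^sup>2) has_real_derivative (H' x - lo * x)) (at x)" for x
    by (auto intro!: derivative_eq_intros der)
  from bregman_nonneg[OF this, of a b] lo
  have "0 \<le> (H a - lo / 2 * a\<^sup>2) - (H b - lo / 2 * b\<^sup>2) - (H' b - lo * b) * (a - b)"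
    by (force simp: algebra_simps)
  thus "lo / 2 * (a - b)\<^sup>2 \<le> H a - H b - H' b * (a - b)"
    by (simp add: power2_eq_square field_simps)
  have "((\<lambda>x. hi / 2 * x\<^sup>2 - H x) has_real_derivative (hi * x - H' x)) (at x)" for x
    by (auto intro!: derivative_eq_intros der)
  from bregman_nonneg[OF this, of a b] hi
  have "0 \<le> (hi / 2 * a\<^sup>2 - H a) - (hi / 2 * b\<^sup>2 - H b) - (hi * b - H' b) * (a - b)"
    by (force simp: algebra_simps)
  thus "H a - H b - H' b * (a - b) \<le> hi / 2 * (a - b)\<^sup>2"
    by (simp add: power2_eq_square field_simps)
qed

text \<open>An integral-free form of the Cauchy-Schwarz inequality
  \<open>(\<integral>g)\<^sup>2 \<le> (\<integral>1) (\<integral>g\<^sup>2)\<close>: minimise over \<open>r\<close> the nonnegative integral of \<open>(g - r)\<^sup>2\<close>.\<close>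

lemma square_increment_le:
  fixes F G :: "real \<Rightarrow> real"
  assumes S: "finite S" and contF: "\<And>x. isCont F x" and contG: "\<And>x. isCont G x"
    and derF: "\<And>x. x \<notin> S \<Longrightarrow> (F has_real_derivative F' x) (at x)"
    and derG: "\<And>x. x \<notin> S \<Longrightarrow> (G has_real_derivative G' x) (at x)"
    and le: "\<And>x. x \<notin> S \<Longrightarrow> (G' x)\<^sup>2 \<le> F' x"
  shows "(G a - G b)\<^sup>2 \<le> (F a - F b) * (a - b)"
proof -
  have *: "(G y - G x)\<^sup>2 \<le> (F y - F x) * (y - x)" if xy: "x < y" for x y
  proof -
    define r where "r = (G y - G x) / (y - x)"
    have "F x - 2 * r * G x + r\<^sup>2 * x \<le> F y - 2 * r * G y + r\<^sup>2 * y"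
    proof (rule mono_off_finite[OF S, where F = "\<lambda>x. F x - 2 * r * G x + r\<^sup>2 * x" and F' = "\<lambda>z. F' z - 2 * r * G' z + r\<^sup>2"])
      show "continuous_on {x..y} (\<lambda>x. F x - 2 * r * G x + r\<^sup>2 * x)"
        using contF contG by (intro continuous_intros continuous_at_imp_continuous_on) auto
      fix z assume z: "z \<notin> S"
      show "((\<lambda>x. F x - 2 * r * G x + r\<^sup>2 * x) has_real_derivative (F' z - 2 * r * G' z + r\<^sup>2)) (at z)"
        by (auto intro!: derivative_eq_intros derF derG z)
      have "0 \<le> (G' z - r)\<^sup>2" by simp
      also have "\<dots> \<le> F' z - 2 * r * G' z + r\<^sup>2" using le[OF z] by (simp add: power2_diff)
      finally show "0 \<le> F' z - 2 * r * G' z + r\<^sup>2" .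
    qed (use xy in auto)
    hence "2 * r * (G y - G x) - r\<^sup>2 * (y - x) \<le> F y - F x" by (simp add: algebra_simps)
    hence "(2 * r * (G y - G x) - r\<^sup>2 * (y - x)) * (y - x) \<le> (F y - F x) * (y - x)"
      using xy by (intro mult_right_mono) auto
    moreover have "(2 * r * (G y - G x) - r\<^sup>2 * (y - x)) * (y - x) = (G y - G x)\<^sup>2"
    proof -
      have rd: "r * (y - x) = G y - G x" using xy by (simp add: r_def)
      have "(2 * r * (G y - G x) - r\<^sup>2 * (y - x)) * (y - x) = 2 * (r * (y - x)) * (G y - G x) - (r * (y - x))\<^sup>2"
        by (simp add: power2_eq_square algebra_simps)
      thus ?thesis unfolding rd by (simp add: power2_eq_square)
    qed
    ultimately show ?thesis by simp
  qed
  show ?thesis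
  proof (cases a b rule: linorder_cases)
    case less
    from *[OF less] show ?thesis by (simp add: algebra_simps power2_commute)
  next
    case greater
    from *[OF greater] show ?thesis .
  qed simp
qed

text \<open>The derivative of \<open>smoothed p t\<close>. The \<open>max\<close> merges the two
  branches: oddness and continuity are immediate, and the derivatives for two thresholds differ in
  one factor only.\<close>

definition smoothed_d :: "real \<Rightarrow> real \<Rightarrow> real \<Rightarrow> real" where
  "smoothed_d p t s = p * s * max t \<bar>s\<bar> powr (p - 2)"

lemma smoothed_has_deriv:
  assumes t: "0 < t"
  shows "(smoothed p t has_real_derivative smoothed_d p t s) (at s)"
proof -
  define k where "k = (p / 2 - 1) * t powr p"
  have tp: "t powr p = t powr (p - 2) * t\<^sup>2" using t by (simp add: powr_diff)
  have tp1: "t powr (p - 1) = t powr (p - 2) * t" using t by (simp add: powr_diff power2_eq_square)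
  have mid: "((\<lambda>s. p / 2 * t powr (p - 2) * s\<^sup>2) has_real_derivative p * t powr (p - 2) * s) (at s)" for s
    by (auto intro!: derivative_eq_intros)
  have pos: "((\<lambda>s. s powr p + k) has_real_derivative p * s powr (p - 1)) (at s)" if "t \<le> s" for s
    using that t by (auto intro!: derivative_eq_intros)
  have neg: "((\<lambda>s. (- s) powr p + k) has_real_derivative - p * (- s) powr (p - 1)) (at s)" if "s \<le> - t" for s
    using that t by (auto intro!: derivative_eq_intros)
  have 1: "((\<lambda>s. if t < s then s powr p + k else p / 2 * t powr (p - 2) * s\<^sup>2)
     has_real_derivative (if t < s then p * s powr (p - 1) else p * t powr (p - 2) * s)) (at s)" for s
    by (rule DERIV_if_greater[OF pos mid]) (auto simp: k_def tp tp1 field_simps)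
  have 2: "((\<lambda>s. if s < - t then (- s) powr p + k else if t < s then s powr p + k else p / 2 * t powr (p - 2) * s\<^sup>2)
     has_real_derivative (if s < - t then - p * (- s) powr (p - 1) else if t < s then p * s powr (p - 1) else p * t powr (p - 2) * s)) (at s)"
    by (rule DERIV_if_less[OF neg 1]) (use t in \<open>auto simp: k_def tp tp1 field_simps\<close>)
  have e1: "(\<lambda>s. if s < - t then (- s) powr p + k else if t < s then s powr p + k else p / 2 * t powr (p - 2) * s\<^sup>2) = smoothed p t"
    using t by (auto simp: smoothed_def fun_eq_iff k_def)
  have sp: "x powr (p - 1) = x powr (p - 2) * x" if "x > 0" for x :: real
    using that by (simp add: powr_diff power2_eq_square)
  have e2: "(if s < - t then - p * (- s) powr (p - 1) else if t < s then p * s powr (p - 1) else p * t powr (p - 2) * s) = smoothed_d p t s"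
  proof (cases "\<bar>s\<bar> \<le> t")
    case True
    hence m: "max t \<bar>s\<bar> = t" by simp
    show ?thesis using True unfolding smoothed_d_def m by (auto simp: abs_le_iff)
  qed (use t in \<open>auto simp: smoothed_d_def max_def sp\<close>)
  show ?thesis using 2 unfolding e1 e2 .
qed

lemma deriv_smoothed: "0 < t \<Longrightarrow> deriv (smoothed p t) s = smoothed_d p t s"
  using smoothed_has_deriv by (rule DERIV_imp_deriv)

lemma smoothed_d_cont: "0 < t \<Longrightarrow> isCont (smoothed_d p t) s"
  unfolding smoothed_d_def by (intro continuous_intros) auto

lemma smoothed_d_has_deriv:
  assumes t: "0 < t" and s: "s \<notin> {t, -t}"
  shows "(smoothed_d p t has_real_derivative smoothed_dd p t s) (at s)"
proof -
  consider "\<bar>s\<bar> < t" | "t < s" | "s < - t" using s by (simp add: abs_less_iff) linarith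
  thus ?thesis
  proof cases
    case 1
    have "((\<lambda>s. p * s * t powr (p - 2)) has_real_derivative p * t powr (p - 2)) (at s)"
      by (auto intro!: derivative_eq_intros)
    hence "(smoothed_d p t has_real_derivative p * t powr (p - 2)) (at s)"
      by (rule has_field_derivative_transform_within_open[of _ _ _ "{-t<..<t}"]) (use 1 in \<open>auto simp: smoothed_d_def max_def\<close>)
    thus ?thesis using 1 by (simp add: smoothed_dd_def)
  next
    case 2
    have "((\<lambda>s. p * s powr (p - 1)) has_real_derivative p * (p - 1) * s powr (p - 2)) (at s)"
      using 2 t by (auto intro!: derivative_eq_intros)
    hence "(smoothed_d p t has_real_derivative p * (p - 1) * s powr (p - 2)) (at s)"
      by (rule has_field_derivative_transform_within_open[of _ _ _ "{t<..}"])
        (use 2 t in \<open>auto simp: smoothed_d_def max_def powr_diff power2_eq_square\<close>)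
    thus ?thesis using 2 t by (simp add: smoothed_dd_def)
  next
    case 3
    have "((\<lambda>s. - p * (- s) powr (p - 1)) has_real_derivative p * (p - 1) * (- s) powr (p - 2)) (at s)"
      using 3 t by (auto intro!: derivative_eq_intros)
    hence "(smoothed_d p t has_real_derivative p * (p - 1) * (- s) powr (p - 2)) (at s)"
      by (rule has_field_derivative_transform_within_open[of _ _ _ "{..<-t}"])
        (use 3 t in \<open>auto simp: smoothed_d_def max_def powr_diff power2_eq_square\<close>)
    thus ?thesis using 3 t by (simp add: smoothed_dd_def)
  qed
qed

lemma smoothed_d_increment:
  assumes t: "0 < t" and xy: "x \<le> y"
  shows "(\<And>z. x \<le> z \<Longrightarrow> z \<le> y \<Longrightarrow> lo \<le> smoothed_dd p t z) \<Longrightarrow> lo * (y - x) \<le> smoothed_d p t y - smoothed_d p t x"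
    and "(\<And>z. x \<le> z \<Longrightarrow> z \<le> y \<Longrightarrow> smoothed_dd p t z \<le> hi) \<Longrightarrow> smoothed_d p t y - smoothed_d p t x \<le> hi * (y - x)"
proof -
  assume lo: "\<And>z. x \<le> z \<Longrightarrow> z \<le> y \<Longrightarrow> lo \<le> smoothed_dd p t z"
  have "smoothed_d p t x - lo * x \<le> smoothed_d p t y - lo * y"
  proof (rule mono_off_finite[of "{t, -t}" _ _ "\<lambda>z. smoothed_d p t z - lo * z" "\<lambda>z. smoothed_dd p t z - lo"])
    show "continuous_on {x..y} (\<lambda>z. smoothed_d p t z - lo * z)"
      using smoothed_d_cont[OF t] by (intro continuous_intros continuous_at_imp_continuous_on) auto
  qed (use xy lo in \<open>auto intro!: derivative_eq_intros smoothed_d_has_deriv[OF t]\<close>)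
  thus "lo * (y - x) \<le> smoothed_d p t y - smoothed_d p t x" by (simp add: algebra_simps)
next
  assume hi: "\<And>z. x \<le> z \<Longrightarrow> z \<le> y \<Longrightarrow> smoothed_dd p t z \<le> hi"
  have "hi * x - smoothed_d p t x \<le> hi * y - smoothed_d p t y"
  proof (rule mono_off_finite[of "{t, -t}" _ _ "\<lambda>z. hi * z - smoothed_d p t z" "\<lambda>z. hi - smoothed_dd p t z"])
    show "continuous_on {x..y} (\<lambda>z. hi * z - smoothed_d p t z)"
      using smoothed_d_cont[OF t] by (intro continuous_intros continuous_at_imp_continuous_on) auto
  qed (use xy hi in \<open>auto intro!: derivative_eq_intros smoothed_d_has_deriv[OF t]\<close>)
  thus "smoothed_d p t y - smoothed_d p t x \<le> hi * (y - x)" by (simp add: algebra_simps)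
qed

lemma smoothed_dd_nonneg: "1 < p \<Longrightarrow> 0 \<le> smoothed_dd p t s"
  by (simp add: smoothed_dd_def)

lemma smoothed_d_mono: "0 < t \<Longrightarrow> 1 < p \<Longrightarrow> x \<le> y \<Longrightarrow> smoothed_d p t x \<le> smoothed_d p t y"
  using smoothed_d_increment(1)[of t x y 0 p] by (simp add: smoothed_dd_nonneg)

text \<open>The derivative of the extension, split into a part at the projection of \<open>s\<close>
  onto the box and one linear part for each side. The three arguments are monotone in
  \<open>s\<close>, so increments can be bounded part by part.\<close>

definition smoothed_ext_d :: "real \<Rightarrow> real \<Rightarrow> real \<Rightarrow> real \<Rightarrow> real \<Rightarrow> real" where
  "smoothed_ext_d p t l u s = smoothed_d p t (max l (min u s))
     + smoothed_dd p t u * max 0 (s - u) + smoothed_dd p t l * min 0 (s - l)"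

lemma smoothed_ext_has_deriv:
  assumes t: "0 < t" and lu: "l < u"
  shows "(smoothed_ext p t l u has_real_derivative smoothed_ext_d p t l u s) (at s)"
proof -
  define q where "q x s = smoothed p t x + smoothed_d p t x * (s - x) + smoothed_dd p t x / 2 * (s - x)\<^sup>2" for x s
  have q: "(q x has_real_derivative (smoothed_d p t x + smoothed_dd p t x * (s - x))) (at s)" for x s
    unfolding q_def by (auto intro!: derivative_eq_intros)
  have 1: "((\<lambda>s. if s < l then q l s else smoothed p t s) has_real_derivative
     (if s < l then smoothed_d p t l + smoothed_dd p t l * (s - l) else smoothed_d p t s)) (at s)" for s
    by (rule DERIV_if_less[OF q smoothed_has_deriv[OF t]]) (auto simp: q_def)
  have 2: "((\<lambda>s. if u < s then q u s else if s < l then q l s else smoothed p t s) has_real_derivative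
     (if u < s then smoothed_d p t u + smoothed_dd p t u * (s - u)
      else if s < l then smoothed_d p t l + smoothed_dd p t l * (s - l) else smoothed_d p t s)) (at s)"
    by (rule DERIV_if_greater[OF q 1]) (use lu in \<open>auto simp: q_def\<close>)
  have e1: "(\<lambda>s. if u < s then q u s else if s < l then q l s else smoothed p t s) = smoothed_ext p t l u"
    by (auto simp: fun_eq_iff smoothed_ext_def q_def deriv_smoothed[OF t])
  have e2: "(if u < s then smoothed_d p t u + smoothed_dd p t u * (s - u)
      else if s < l then smoothed_d p t l + smoothed_dd p t l * (s - l) else smoothed_d p t s) = smoothed_ext_d p t l u s"
    using lu by (auto simp: smoothed_ext_d_def max_def min_def)
  show ?thesis using 2 unfolding e1 e2 .
qed

lemma smoothed_ext_d_increment: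
  assumes t: "0 < t" and lu: "l < u" and xy: "x \<le> y"
  shows "(\<And>z. l \<le> z \<Longrightarrow> z \<le> u \<Longrightarrow> lo \<le> smoothed_dd p t z) \<Longrightarrow>
      lo * (y - x) \<le> smoothed_ext_d p t l u y - smoothed_ext_d p t l u x"
    and "(\<And>z. l \<le> z \<Longrightarrow> z \<le> u \<Longrightarrow> smoothed_dd p t z \<le> hi) \<Longrightarrow>
      smoothed_ext_d p t l u y - smoothed_ext_d p t l u x \<le> hi * (y - x)"
proof -
  \<comment> \<open>The step \<open>y - x\<close> splits into the lengths spent inside, above and
    below the box; on the outer two the curvature is that at the box end.\<close>
  define a where "a = max l (min u y) - max l (min u x)"
  define b where "b = max 0 (y - u) - max 0 (x - u)"
  define c where "c = min 0 (y - l) - min 0 (x - l)"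
  have nn: "0 \<le> b" "0 \<le> c" and sum: "y - x = a + b + c"
    using lu xy by (auto simp: a_def b_def c_def max_def min_def)
  have cl: "max l (min u x) \<le> max l (min u y)" "l \<le> max l (min u x)" "max l (min u y) \<le> u"
    using lu xy by auto
  have eq: "smoothed_ext_d p t l u y - smoothed_ext_d p t l u x
     = (smoothed_d p t (max l (min u y)) - smoothed_d p t (max l (min u x))) + smoothed_dd p t u * b + smoothed_dd p t l * c"
    by (simp add: smoothed_ext_d_def b_def c_def algebra_simps)
  {
    assume lo: "\<And>z. l \<le> z \<Longrightarrow> z \<le> u \<Longrightarrow> lo \<le> smoothed_dd p t z"
  have "lo * a \<le> smoothed_d p t (max l (min u y)) - smoothed_d p t (max l (min u x))"
    unfolding a_def using cl lo by (intro smoothed_d_increment[OF t]) auto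
  moreover have "lo * b \<le> smoothed_dd p t u * b" "lo * c \<le> smoothed_dd p t l * c"
    using nn lo lu by (auto intro!: mult_right_mono)
  ultimately show "lo * (y - x) \<le> smoothed_ext_d p t l u y - smoothed_ext_d p t l u x"
    unfolding eq sum by (simp add: algebra_simps)
  }
  {
    assume hi: "\<And>z. l \<le> z \<Longrightarrow> z \<le> u \<Longrightarrow> smoothed_dd p t z \<le> hi"
  have "smoothed_d p t (max l (min u y)) - smoothed_d p t (max l (min u x)) \<le> hi * a"
    unfolding a_def using cl hi by (intro smoothed_d_increment[OF t]) auto
  moreover have "smoothed_dd p t u * b \<le> hi * b" "smoothed_dd p t l * c \<le> hi * c"
    using nn hi lu by (auto intro!: mult_right_mono)
  ultimately show "smoothed_ext_d p t l u y - smoothed_ext_d p t l u x \<le> hi * (y - x)"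
    unfolding eq sum by (simp add: algebra_simps)
  }
qed

subsection \<open>Powers and monotonicity gaps\<close>

text \<open>A concave power lies below its tangent at 1; this is Young's inequality with one factor
  1.\<close>

lemma powr_le_affine:
  fixes x a :: real
  assumes "0 \<le> x" "0 < a" "a \<le> 1"
  shows "x powr a \<le> a * x + (1 - a)"
proof (cases "x = 0")
  case True
  thus ?thesis using assms by simp
next
  case False
  thus ?thesis using Youngs_inequality_0[of a "1 - a" x 1] assms by simp
qed

text \<open>Bernoulli's inequality for real exponents, from \<open>powr_le_affine\<close> with
  exponent \<open>1 / a\<close> at the point \<open>x powr a\<close>.\<close>

lemma powr_ge_affine:
  fixes x a :: real
  assumes "0 \<le> x" "1 \<le> a"
  shows "1 + a * (x - 1) \<le> x powr a"
proof -
  have "(x powr a) powr (1 / a) \<le> 1 / a * x powr a + (1 - 1 / a)"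
    using assms by (intro powr_le_affine) auto
  moreover have "(x powr a) powr (1 / a) = x" using assms by (simp add: powr_powr)
  ultimately have "x \<le> 1 / a * x powr a + (1 - 1 / a)" by simp
  hence "a * x \<le> a * (1 / a * x powr a + (1 - 1 / a))"
    using assms by (intro mult_left_mono) auto
  also have "\<dots> = x powr a + a - 1" using assms by (simp add: ring_distribs)
  finally show ?thesis by (simp add: algebra_simps)
qed

lemma powr_subadditive:
  fixes x y a :: real
  assumes "0 \<le> x" "0 \<le> y" "0 < a" "a \<le> 1"
  shows "(x + y) powr a \<le> x powr a + y powr a"
proof (cases "x + y = 0")
  case False
  have *: "z / (x + y) \<le> (z / (x + y)) powr a" if "0 \<le> z" "z \<le> x + y" for z
    using powr_mono'[of a 1 "z / (x + y)"] that assms False by (simp add: divide_le_eq)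
  have "1 = x / (x + y) + y / (x + y)" using False by (simp flip: add_divide_distrib)
  also have "\<dots> \<le> (x / (x + y)) powr a + (y / (x + y)) powr a"
    using *[of x] *[of y] assms by simp
  also have "\<dots> = (x powr a + y powr a) / (x + y) powr a"
    by (simp add: powr_divide add_divide_distrib)
  finally show ?thesis using False by (simp add: le_divide_eq)
qed (use assms in auto)

lemma powr_as_square: "(x::real) powr a = (x powr (a / 2))\<^sup>2"
  by (simp add: power2_eq_square flip: powr_add)

lemma spow_minus[simp]: "spow (- x) a = - spow x a"
  by (simp add: spow_def)

lemma spow_0[simp]: "spow 0 a = 0"
  by (simp add: spow_def)

lemma spow_pos: "0 \<le> x \<Longrightarrow> spow x a = x powr a"
  by (cases "x = 0") (simp_all add: spow_def)

lemma abs_spow[simp]: "\<bar>spow x a\<bar> = \<bar>x\<bar> powr a"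
  by (cases "x = 0") (simp_all add: spow_def abs_mult sgn_if)

lemma spow_spow: "spow (spow x a) b = spow x (a * b)"
proof (cases x "0::real" rule: linorder_cases)
  case less
  then obtain y where "x = - y" "0 < y" by (metis neg_0_less_iff_less add.inverse_inverse)
  thus ?thesis by (simp add: spow_pos powr_powr)
qed (auto simp: spow_pos powr_powr)

lemma spow_mono:
  assumes a: "0 < a" and xy: "x \<le> y"
  shows "spow x a \<le> spow y a"
proof -
  have *: "0 \<le> spow z a \<longleftrightarrow> 0 \<le> z" "spow z a \<le> 0 \<longleftrightarrow> z \<le> 0" for z
    by (auto simp: spow_def sgn_if zero_le_mult_iff mult_le_0_iff)
  consider "0 \<le> x" | "x \<le> 0" "0 \<le> y" | "y \<le> 0" by linarith
  thus ?thesis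
  proof cases
    case 1
    thus ?thesis using xy a by (simp add: spow_pos powr_mono2)
  next
    case 2
    thus ?thesis using *[of x] *[of y] by linarith
  next
    case 3
    hence "spow (- y) a \<le> spow (- x) a" using xy a by (simp add: spow_pos powr_mono2 del: spow_minus)
    thus ?thesis by simp
  qed
qed

lemma spow_inverse: "0 < a \<Longrightarrow> 0 < b \<Longrightarrow> a * b = 1 \<Longrightarrow> spow (spow x a) b = x"
  by (simp add: spow_spow) (simp add: spow_def sgn_mult_abs)

lemma isCont_spow:
  assumes "0 < a"
  shows "isCont (\<lambda>s. spow s a) x"
proof -
  have eq: "(\<lambda>s. spow s a) = (\<lambda>s. (max 0 s) powr a - (max 0 (- s)) powr a)"
    by (auto simp: fun_eq_iff spow_def max_def sgn_if)
  have "continuous_on UNIV (\<lambda>s::real. (max 0 s) powr a - (max 0 (- s)) powr a)"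
    using assms by (intro continuous_intros continuous_on_powr') auto
  thus ?thesis unfolding eq by (simp add: continuous_on_eq_continuous_at)
qed

lemma spow_has_deriv:
  assumes "x \<noteq> 0"
  shows "((\<lambda>s. spow s a) has_real_derivative a * \<bar>x\<bar> powr (a - 1)) (at x)"
proof (cases "0 < x")
  case True
  have "((\<lambda>s. s powr a) has_real_derivative a * x powr (a - 1)) (at x)"
    using True by (rule has_real_derivative_powr)
  hence "((\<lambda>s. spow s a) has_real_derivative a * x powr (a - 1)) (at x)"
    by (rule has_field_derivative_transform_within_open[of _ _ _ "{0<..}"]) (use True in \<open>auto simp: spow_pos\<close>)
  thus ?thesis using True by simp
next
  case False
  hence x: "x < 0" using assms by simp
  have "((\<lambda>s. - ((- s) powr a)) has_real_derivative a * (- x) powr (a - 1)) (at x)"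
    using x by (auto intro!: derivative_eq_intros)
  hence "((\<lambda>s. spow s a) has_real_derivative a * (- x) powr (a - 1)) (at x)"
    by (rule has_field_derivative_transform_within_open[of _ _ _ "{..<0}"]) (use x in \<open>auto simp: spow_def\<close>)
  thus ?thesis using x by simp
qed

text \<open>Equal signs are subadditivity, with constant 1; opposite signs cost the factor 2. By
  symmetry \<open>x\<close> may be taken nonnegative and of larger modulus.\<close>

lemma spow_diff_le_holder:
  assumes a: "0 < a" "a \<le> 1"
  shows "\<bar>spow x a - spow y a\<bar> \<le> 2 * \<bar>x - y\<bar> powr a"
proof -
  have *: "\<bar>spow x a - spow y a\<bar> \<le> 2 * \<bar>x - y\<bar> powr a" if "\<bar>y\<bar> \<le> x" for x y
  proof (cases "0 \<le> y")
    case True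
    have "x powr a \<le> y powr a + (x - y) powr a"
      using powr_subadditive[of y "x - y" a] that True a by simp
    moreover have "y powr a \<le> x powr a" using True that a by (intro powr_mono2) auto
    ultimately show ?thesis using True that powr_ge_zero[of "x - y" a] by (simp add: spow_pos)
  next
    case False
    have "x powr a \<le> (x - y) powr a" "(- y) powr a \<le> (x - y) powr a"
      using False that a by (auto intro!: powr_mono2)
    moreover have "spow y a = - ((- y) powr a)" using False by (simp add: spow_def)
    ultimately show ?thesis using False that by (simp add: spow_pos)
  qed
  consider "\<bar>y\<bar> \<le> x" | "\<bar>y\<bar> \<le> - x" | "\<bar>x\<bar> \<le> y" | "\<bar>x\<bar> \<le> - y" by linarith
  thus ?thesis
  proof cases
    case 1 thus ?thesis by (rule *)
  next
    case 2 thus ?thesis using *[of "- y" "- x"] by (simp add: abs_minus_commute)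
  next
    case 3 thus ?thesis using *[of x y] by (simp add: abs_minus_commute)
  next
    case 4 thus ?thesis using *[of "- x" "- y"] by (simp add: abs_minus_commute)
  qed
qed

text \<open>Complements the Hoelder bound away from 0: up to the factor 2, the slope is measured at
  the argument of larger modulus.\<close>

lemma spow_diff_le_lipschitz:
  assumes a: "0 < a" "a \<le> 1" and yx: "\<bar>y\<bar> \<le> \<bar>x\<bar>" and x0: "x \<noteq> 0"
  shows "\<bar>spow x a - spow y a\<bar> \<le> 2 * \<bar>x\<bar> powr (a - 1) * \<bar>x - y\<bar>"
proof -
  have *: "\<bar>spow x a - spow y a\<bar> \<le> 2 * x powr (a - 1) * (x - y)" if xy: "\<bar>y\<bar> \<le> x" "0 < x" for x y
  proof (cases "0 < y")
    case True
    have xa: "x powr a = x powr (a - 1) * x" "y powr a = y powr (a - 1) * y"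
      using xy True by (auto simp: powr_diff)
    have "x powr (a - 1) * y \<le> y powr (a - 1) * y"
      using True xy a by (intro mult_right_mono powr_mono2') auto
    hence "x powr a - y powr a \<le> x powr (a - 1) * (x - y)" using xa by (simp add: algebra_simps)
    also have "\<dots> \<le> 2 * x powr (a - 1) * (x - y)" using True xy by (simp add: mult_le_cancel_right)
    moreover have "y powr a \<le> x powr a" using True xy a by (intro powr_mono2) auto
    ultimately show ?thesis using True xy by (simp add: spow_pos)
  next
    case False
    have "(- y) powr a \<le> x powr a" using False xy a by (intro powr_mono2) auto
    moreover have "spow y a = - ((- y) powr a)" using False by (cases "y = 0") (simp_all add: spow_def)
    ultimately have "\<bar>spow x a - spow y a\<bar> \<le> 2 * x powr a" using xy powr_ge_zero[of "-y" a] by (simp add: spow_pos)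
    also have "\<dots> = 2 * x powr (a - 1) * x" using xy by (simp add: powr_diff)
    also have "\<dots> \<le> 2 * x powr (a - 1) * (x - y)" using False xy by (intro mult_left_mono) auto
    finally show ?thesis .
  qed
  show ?thesis
  proof (cases "0 < x")
    case True
    thus ?thesis using *[of y x] yx by simp
  next
    case False
    thus ?thesis using *[of "- y" "- x"] yx x0 by (simp add: abs_minus_commute)
  qed
qed

section \<open>Change of the loss derivative within one phase\<close>

lemma step_h_bounds:
  assumes p: "1 < p"
  shows "0 < step_h p" "step_h p < 1 / 2" "p * step_h p = 1 / 2" "1 / 2 \<le> (1 - step_h p) powr p"
proof -
  show "0 < step_h p" and h: "step_h p < 1 / 2" and ph: "p * step_h p = 1 / 2"
    using p by (auto simp: step_h_def field_simps)
  \<comment> \<open>Bernoulli's inequality; \<open>p * step_h p = 1 / 2\<close> makes the bound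
    independent of \<open>p\<close>.\<close>
  have "1 + p * ((1 - step_h p) - 1) \<le> (1 - step_h p) powr p"
    using p h by (intro powr_ge_affine) auto
  thus "1 / 2 \<le> (1 - step_h p) powr p" using ph by simp
qed

lemma smoothed_d_monotone_lower:
  assumes t: "0 < t" and lo: "\<And>z. min a b \<le> z \<Longrightarrow> z \<le> max a b \<Longrightarrow> lo \<le> smoothed_dd p t z"
  shows "lo * (a - b)\<^sup>2 \<le> (smoothed_d p t a - smoothed_d p t b) * (a - b)"
proof (cases "b \<le> a")
  case True
  have "lo * (a - b) \<le> smoothed_d p t a - smoothed_d p t b"
    using True lo by (intro smoothed_d_increment(1)[OF t]) auto
  from mult_right_mono[OF this, of "a - b"] True show ?thesis by (simp add: power2_eq_square)
next
  case False
  have "lo * (b - a) \<le> smoothed_d p t b - smoothed_d p t a"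
    using False lo by (intro smoothed_d_increment(1)[OF t]) auto
  from mult_right_mono[OF this, of "b - a"] False show ?thesis by (simp add: power2_eq_square algebra_simps)
qed

lemma smoothed_d_minus: "smoothed_d p t (- s) = - smoothed_d p t s"
  by (simp add: smoothed_d_def)

lemma smoothed_d_diff:
  "smoothed_d p t s - smoothed_d p t' s = p * s * (max t \<bar>s\<bar> powr (p - 2) - max t' \<bar>s\<bar> powr (p - 2))"
  by (simp add: smoothed_d_def algebra_simps)

text \<open>The remainder \<open>e\<^sup>2 / (2 * k)\<close> of Young's inequality in units of
  \<open>t powr p\<close>. For \<open>p \<ge> 2\<close> the derivative changes by at most
  \<open>p / 2 * t powr (p - 1)\<close> against curvature \<open>p / 2 * t powr (p - 2)\<close>; for
  \<open>p < 2\<close> by at most \<open>1 / 2 * t powr (p - 1)\<close> against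
  \<open>p * (p - 1) * t powr (p - 2)\<close>.\<close>

definition drift_const :: "real \<Rightarrow> real" where
  "drift_const p = (if 2 \<le> p then p / 4 else 1 / (8 * p * (p - 1)))"

lemma young_absorb:
  fixes e x k :: real
  assumes k: "0 < k"
  shows "e * x \<le> 1 / 2 * (k * x\<^sup>2) + e\<^sup>2 / (2 * k)"
proof -
  have "0 \<le> (k * x - e)\<^sup>2 / (2 * k)" using k by simp
  also have "\<dots> = 1 / 2 * (k * x\<^sup>2) + e\<^sup>2 / (2 * k) - e * x"
    using k by (simp add: power2_eq_square field_simps)
  finally show ?thesis by simp
qed

text \<open>The two derivatives differ only for \<open>\<bar>b\<bar> < t\<close>, and the curvature
  is bounded below on the whole line; so half of the monotonicity gap absorbs the linear term by
  \<open>young_absorb\<close>.\<close>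

lemma drift_le_ge2:
  assumes p: "2 \<le> p" and t: "0 < t" and t': "t' = (1 - step_h p) * t"
  shows "(smoothed_d p t b - smoothed_d p t' b) * (a - b)
    \<le> 1 / 2 * ((smoothed_d p t' a - smoothed_d p t' b) * (a - b)) + p / 4 * t powr p"
proof -
  note h = step_h_bounds[of p]
  have h1: "0 < step_h p" "step_h p < 1/2" "1 / 2 \<le> (1 - step_h p) powr p" using h p by auto
  have t'0: "0 < t'" "t' \<le> t" using t h1 by (auto simp: t' mult_le_cancel_right1)
  have half: "1 / 2 * t powr (p - 2) \<le> t' powr (p - 2)"
  proof -
    have "1 / 2 \<le> (1 - step_h p) powr (p - 2)"
      using h1 powr_mono'[of "p - 2" p "1 - step_h p"] by simp
    from mult_right_mono[OF this, of "t powr (p - 2)"] show ?thesis by (simp add: t' powr_mult)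
  qed
  define e where "e = smoothed_d p t b - smoothed_d p t' b"
  define k where "k = p / 2 * t powr (p - 2)"
  have k: "0 < k" using p t by (simp add: k_def)
  have "\<bar>e\<bar> \<le> p / 2 * t powr (p - 1)"
  proof (cases "t \<le> \<bar>b\<bar>")
    case True
    thus ?thesis using t'0 p by (simp add: e_def smoothed_d_diff max_def)
  next
    case False
    have 1: "t' powr (p - 2) \<le> max t' \<bar>b\<bar> powr (p - 2)" "max t' \<bar>b\<bar> powr (p - 2) \<le> t powr (p - 2)"
      using p t'0 False by (auto intro!: powr_mono2)
    hence 2: "\<bar>t powr (p - 2) - max t' \<bar>b\<bar> powr (p - 2)\<bar> \<le> 1 / 2 * t powr (p - 2)" using half by linarith
    have "\<bar>e\<bar> = p * (\<bar>b\<bar> * \<bar>t powr (p - 2) - max t' \<bar>b\<bar> powr (p - 2)\<bar>)"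
      using False p by (simp add: e_def smoothed_d_diff abs_mult)
    also have "\<dots> \<le> p * (t * (1 / 2 * t powr (p - 2)))"
      using 2 False p by (intro mult_left_mono mult_mono) auto
    also have "\<dots> = p / 2 * t powr (p - 1)" using t by (simp add: powr_diff power2_eq_square)
    finally show ?thesis .
  qed
  hence e2: "e\<^sup>2 \<le> (p / 2 * t powr (p - 1))\<^sup>2" by (metis abs_ge_zero power2_abs power_mono)
  have dd: "k \<le> smoothed_dd p t' z" for z
  proof -
    have "t' powr (p - 2) \<le> \<bar>z\<bar> powr (p - 2)" if "t' < \<bar>z\<bar>"
      using that p t'0 by (intro powr_mono2) auto
    moreover have "p * \<bar>z\<bar> powr (p - 2) \<le> p * (p - 1) * \<bar>z\<bar> powr (p - 2)"
      using p by (intro mult_right_mono) auto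
    moreover have "k \<le> p * t' powr (p - 2)" using half p by (simp add: k_def)
    ultimately show ?thesis using p by (auto simp: smoothed_dd_def intro: order_trans mult_left_mono)
  qed
  have "e * (a - b) \<le> 1 / 2 * (k * (a - b)\<^sup>2) + e\<^sup>2 / (2 * k)" by (rule young_absorb[OF k])
  also have "k * (a - b)\<^sup>2 \<le> (smoothed_d p t' a - smoothed_d p t' b) * (a - b)"
    using dd by (intro smoothed_d_monotone_lower t'0)
  also have "e\<^sup>2 / (2 * k) \<le> (p / 2 * t powr (p - 1))\<^sup>2 / (2 * k)" using e2 k by (intro divide_right_mono) auto
  also have "(p / 2 * t powr (p - 1))\<^sup>2 / (2 * k) = p / 4 * t powr p"
    using p t by (simp add: k_def powr_diff field_simps power2_eq_square)
  finally show ?thesis by (simp add: e_def)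
qed

text \<open>No curvature bound holds on the whole line now, so for \<open>0 < b < t\<close> the
  position of \<open>a\<close> decides: above \<open>b\<close> the signs help, between
  \<open>- t\<close> and \<open>b\<close> the curvature at \<open>t\<close> is available, and below
  \<open>- t\<close> the slope difference alone outweighs the change. Negative \<open>b\<close>
  follow by oddness.\<close>

lemma drift_le_lt2:
  assumes p: "1 < p" "p < 2" and t: "0 < t" and t': "t' = (1 - step_h p) * t"
  shows "(smoothed_d p t b - smoothed_d p t' b) * (a - b)
    \<le> 1 / 2 * ((smoothed_d p t' a - smoothed_d p t' b) * (a - b)) + 1 / (8 * p * (p - 1)) * t powr p"
proof -
  note h = step_h_bounds[OF p(1)]
  have t'0: "0 < t'" "t' \<le> t" using t h by (auto simp: t' mult_le_cancel_right1)
  define K where "K = 1 / (8 * p * (p - 1)) * t powr p"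
  have K: "0 \<le> K" using p by (simp add: K_def)
  have mono: "0 \<le> (smoothed_d p t' a - smoothed_d p t' b) * (a - b)" for a b
    using smoothed_d_monotone_lower[of t' a b 0 p] t'0 p by (simp add: smoothed_dd_nonneg)
  have pos: "(smoothed_d p t b - smoothed_d p t' b) * (a - b)
    \<le> 1 / 2 * ((smoothed_d p t' a - smoothed_d p t' b) * (a - b)) + K" if b: "0 < b" "b < t" for a b
  proof -
    define e where "e = smoothed_d p t b - smoothed_d p t' b"
    define m where "m = max t' b"
    have m: "t' \<le> m" "b \<le> m" "m \<le> t" "0 < m" using b t'0 by (auto simp: m_def)
    have e_eq: "e = - (p * (b * (m powr (p - 2) - t powr (p - 2))))"
      using b by (simp add: e_def smoothed_d_diff m_def algebra_simps)
    have diff: "0 \<le> m powr (p - 2) - t powr (p - 2)" using m p by (simp add: powr_mono2')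
    have e0: "e \<le> 0" unfolding e_eq using diff p b by simp
    \<comment> \<open>Raising \<open>b\<close> to \<open>m\<close> makes both terms comparable at
      the ends of \<open>t' \<le> m \<le> t\<close>; what remains is
      \<open>step_h p * t powr (p - 1)\<close>, and \<open>p * step_h p = 1 / 2\<close>.\<close>
    have "b * (m powr (p - 2) - t powr (p - 2)) \<le> m * (m powr (p - 2) - t powr (p - 2))"
      using diff m by (intro mult_right_mono) auto
    also have "\<dots> = m powr (p - 1) - m * t powr (p - 2)"
      using m by (simp add: powr_diff power2_eq_square field_simps)
    also have "\<dots> \<le> t powr (p - 1) - t' * t powr (p - 2)"
      using m p by (intro diff_mono powr_mono2 mult_right_mono) auto
    also have "\<dots> = step_h p * t powr (p - 1)"
      using t by (simp add: t' powr_diff power2_eq_square field_simps)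
    finally have "p * (b * (m powr (p - 2) - t powr (p - 2))) \<le> p * (step_h p * t powr (p - 1))"
      using p by (intro mult_left_mono) auto
    also have "\<dots> = 1 / 2 * t powr (p - 1)" using h(3) by (simp flip: mult.assoc)
    finally have e1: "- e \<le> 1 / 2 * t powr (p - 1)" unfolding e_eq by simp
    consider "b \<le> a" | "a < b" "- t \<le> a" | "a < - t" by linarith
    hence "e * (a - b) \<le> 1 / 2 * ((smoothed_d p t' a - smoothed_d p t' b) * (a - b)) + K"
    proof cases
      case 1
      hence "e * (a - b) \<le> 0" using e0 by (simp add: mult_le_0_iff)
      thus ?thesis using mono[of a b] K by linarith
    next
      case 2
      define k where "k = p * (p - 1) * t powr (p - 2)"
      have k: "0 < k" using p t by (simp add: k_def)
      have "k \<le> smoothed_dd p t' z" if "min a b \<le> z" "z \<le> max a b" for z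
      proof -
        have z: "\<bar>z\<bar> \<le> t" using that 2 b by auto
        have "t powr (p - 2) \<le> t' powr (p - 2)" using t'0 p by (intro powr_mono2') auto
        hence "p * (p - 1) * t powr (p - 2) \<le> p * 1 * t' powr (p - 2)"
          using p by (intro mult_mono) auto
        moreover have "t powr (p - 2) \<le> \<bar>z\<bar> powr (p - 2)" if "t' < \<bar>z\<bar>"
          using that z t'0 p by (intro powr_mono2') auto
        ultimately show ?thesis using p by (auto simp: smoothed_dd_def k_def)
      qed
      hence M: "k * (a - b)\<^sup>2 \<le> (smoothed_d p t' a - smoothed_d p t' b) * (a - b)"
        by (intro smoothed_d_monotone_lower t'0)
      have "e\<^sup>2 \<le> (1 / 2 * t powr (p - 1))\<^sup>2" using e0 e1 by (simp add: abs_le_square_iff[symmetric])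
      hence "e\<^sup>2 / (2 * k) \<le> (1 / 2 * t powr (p - 1))\<^sup>2 / (2 * k)" using k by (intro divide_right_mono) auto
      also have "\<dots> = K" unfolding K_def k_def
        using p t by (simp add: powr_diff field_simps power2_eq_square)
      finally show ?thesis using young_absorb[OF k, of e "a - b"] M by linarith
    next
      case 3
      \<comment> \<open>Beyond \<open>- t\<close> the slope at \<open>a\<close> has size at least
        \<open>t powr (p - 1)\<close>, twice the bound on the change \<open>e\<close>, so half of
        the slope difference suffices.\<close>
      have "smoothed_d p t' a \<le> smoothed_d p t' (- t)" using 3 t'0 p by (intro smoothed_d_mono) auto
      also have "\<dots> = - (p * t powr (p - 1))"
        using t t'0 by (simp add: smoothed_d_def max_def powr_diff power2_eq_square)
      also have "\<dots> \<le> - (1 * t powr (p - 1))" using p by (intro le_imp_neg_le mult_right_mono) auto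
      finally have "smoothed_d p t' a \<le> - (t powr (p - 1))" by simp
      have "0 \<le> smoothed_d p t' b" using b p by (simp add: smoothed_d_def)
      hence "1 / 2 * (smoothed_d p t' a - smoothed_d p t' b) \<le> e"
      proof -
        have "1 / 2 * (x - y) \<le> e" if h: "x \<le> - T" "0 \<le> y" "- e \<le> 1 / 2 * T" for x y T :: real
        proof -
          have "x - y \<le> - T" using h(1,2) by simp
          hence "1 / 2 * (x - y) \<le> 1 / 2 * (- T)" by (rule mult_left_mono) simp
          also have "\<dots> \<le> e" using h(3) by simp
          finally show ?thesis .
        qed
        thus ?thesis using \<open>smoothed_d p t' a \<le> - (t powr (p - 1))\<close> \<open>0 \<le> smoothed_d p t' b\<close> e1 .
      qed
      moreover have "a - b \<le> 0" using 3 b t by simp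
      ultimately have "e * (a - b) \<le> 1 / 2 * (smoothed_d p t' a - smoothed_d p t' b) * (a - b)"
        by (rule mult_right_mono_neg)
      also have "\<dots> \<le> 1 / 2 * ((smoothed_d p t' a - smoothed_d p t' b) * (a - b)) + K" using K by simp
      finally show ?thesis .
    qed
    thus ?thesis by (simp add: e_def)
  qed
  consider "0 < b" "b < t" | "b < 0" "- t < b" | "b = 0" | "t \<le> \<bar>b\<bar>" by linarith
  thus ?thesis
  proof cases
    case 1
    thus ?thesis using pos[of b a] by (simp add: K_def)
  next
    case 2
    thus ?thesis using pos[of "- b" "- a"] by (simp add: K_def smoothed_d_minus algebra_simps)
  next
    case 3
    thus ?thesis using mono[of a b] K by (simp add: smoothed_d_def K_def)
  next
    case 4
    hence "smoothed_d p t b - smoothed_d p t' b = 0" using t'0 by (simp add: smoothed_d_diff max_def)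
    thus ?thesis using mono[of a b] K by (simp add: K_def)
  qed
qed

lemma drift_le:
  assumes "1 < p" "0 < t" "t' = (1 - step_h p) * t"
  shows "(smoothed_d p t b - smoothed_d p t' b) * (a - b)
    \<le> 1 / 2 * ((smoothed_d p t' a - smoothed_d p t' b) * (a - b)) + drift_const p * t powr p"
  using drift_le_ge2[of p t t' b a] drift_le_lt2[of p t t' b a] assms
  by (simp add: drift_const_def)

section \<open>From monotonicity gaps to the movement of signed powers\<close>

lemma spow_le_of_monotone_gap_ge2:
  assumes p: "2 \<le> p" and t: "0 < t"
  shows "4 / p * (spow a (p / 2) - spow b (p / 2))\<^sup>2 \<le> (smoothed_d p t a - smoothed_d p t b) * (a - b)"
proof -
  \<comment> \<open>Chosen so that the squared slope of \<open>c * spow x (p / 2)\<close> is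
    \<open>p * \<bar>x\<bar> powr (p - 2)\<close>, which the curvature dominates for
    \<open>p \<ge> 2\<close>.\<close>
  define c where "c = 2 / sqrt p"
  have c2: "c\<^sup>2 = 4 / p" using p by (simp add: c_def power_divide)
  have cp: "c * (p / 2) = sqrt p" using p by (simp add: c_def field_simps)
  have "(c * spow a (p / 2) - c * spow b (p / 2))\<^sup>2 \<le> (smoothed_d p t a - smoothed_d p t b) * (a - b)"
  proof (rule square_increment_le[of "{0, t, -t}", where G' = "\<lambda>x. sqrt p * \<bar>x\<bar> powr (p / 2 - 1)" and F' = "smoothed_dd p t"])
    show "isCont (\<lambda>x. c * spow x (p / 2)) x" for x
      using isCont_spow[of "p / 2" x] p by (intro continuous_intros) auto
    fix x assume x: "x \<notin> {0, t, -t}"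
    show "(smoothed_d p t has_real_derivative smoothed_dd p t x) (at x)"
      using x by (intro smoothed_d_has_deriv t) auto
    have "((\<lambda>x. c * spow x (p / 2)) has_real_derivative c * (p / 2 * \<bar>x\<bar> powr (p / 2 - 1))) (at x)"
      using x by (intro DERIV_cmult spow_has_deriv) auto
    thus "((\<lambda>x. c * spow x (p / 2)) has_real_derivative sqrt p * \<bar>x\<bar> powr (p / 2 - 1)) (at x)"
      using cp by (simp add: mult.assoc[symmetric])
    have sq: "(sqrt p * \<bar>x\<bar> powr (p / 2 - 1))\<^sup>2 = p * \<bar>x\<bar> powr (p - 2)"
      using p powr_as_square[of "\<bar>x\<bar>" "p - 2"] by (simp add: power_mult_distrib diff_divide_distrib)
    have "p * \<bar>x\<bar> powr (p - 2) \<le> p * (p - 1) * \<bar>x\<bar> powr (p - 2)"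
      using p by (intro mult_right_mono) auto
    thus "(sqrt p * \<bar>x\<bar> powr (p / 2 - 1))\<^sup>2 \<le> smoothed_dd p t x"
      unfolding sq using p by (auto simp: smoothed_dd_def intro!: powr_mono2)
  qed (auto intro: smoothed_d_cont[OF t])
  thus ?thesis by (simp add: c2 power_mult_distrib flip: right_diff_distrib)
qed

text \<open>A primitive of \<open>\<lambda>s. max t \<bar>s\<bar> powr (p / 2 - 1)\<close>, the change of variable in which the
  curvature of \<open>smoothed p\<close> at scales below \<open>t\<close> is at least \<open>p * (p - 1)\<close> when \<open>p < 2\<close>.\<close>

definition flat_coord :: "real \<Rightarrow> real \<Rightarrow> real \<Rightarrow> real" where
  "flat_coord p t s = (if \<bar>s\<bar> \<le> t then t powr (p / 2 - 1) * s
     else 2 / p * spow s (p / 2) + (1 - 2 / p) * sgn s * t powr (p / 2))"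

lemma flat_coord_has_deriv:
  assumes t: "0 < t" and p: "0 < p"
  shows "(flat_coord p t has_real_derivative max t \<bar>s\<bar> powr (p / 2 - 1)) (at s)"
proof -
  define k where "k = (1 - 2 / p) * t powr (p / 2)"
  have tp: "t powr (p / 2) = t powr (p / 2 - 1) * t" using t by (simp add: powr_diff)
  have pos: "((\<lambda>s. 2 / p * spow s (p / 2) + k) has_real_derivative \<bar>s\<bar> powr (p / 2 - 1)) (at s)" if "t \<le> s" for s
    using that t p by (auto intro!: derivative_eq_intros spow_has_deriv)
  have neg: "((\<lambda>s. 2 / p * spow s (p / 2) - k) has_real_derivative \<bar>s\<bar> powr (p / 2 - 1)) (at s)" if "s \<le> - t" for s
    using that t p by (auto intro!: derivative_eq_intros spow_has_deriv)
  have mid: "((\<lambda>s. t powr (p / 2 - 1) * s) has_real_derivative t powr (p / 2 - 1)) (at s)" for s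
    by (auto intro!: derivative_eq_intros)
  have 1: "((\<lambda>s. if t < s then 2 / p * spow s (p / 2) + k else t powr (p / 2 - 1) * s)
     has_real_derivative (if t < s then \<bar>s\<bar> powr (p / 2 - 1) else t powr (p / 2 - 1))) (at s)" for s
    by (rule DERIV_if_greater[OF pos mid]) (use t in \<open>auto simp: k_def tp spow_pos algebra_simps\<close>)
  have 2: "((\<lambda>s. if s < - t then 2 / p * spow s (p / 2) - k else if t < s then 2 / p * spow s (p / 2) + k else t powr (p / 2 - 1) * s)
     has_real_derivative (if s < - t then \<bar>s\<bar> powr (p / 2 - 1) else if t < s then \<bar>s\<bar> powr (p / 2 - 1) else t powr (p / 2 - 1))) (at s)"
    by (rule DERIV_if_less[OF neg 1]) (use t in \<open>auto simp: k_def tp spow_pos algebra_simps\<close>)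
  have e1: "(\<lambda>s. if s < - t then 2 / p * spow s (p / 2) - k else if t < s then 2 / p * spow s (p / 2) + k else t powr (p / 2 - 1) * s) = flat_coord p t"
    using t by (auto simp: flat_coord_def fun_eq_iff k_def algebra_simps)
  have e2: "(if s < - t then \<bar>s\<bar> powr (p / 2 - 1) else if t < s then \<bar>s\<bar> powr (p / 2 - 1) else t powr (p / 2 - 1)) = max t \<bar>s\<bar> powr (p / 2 - 1)"
  proof (cases "\<bar>s\<bar> \<le> t")
    case True
    hence "max t \<bar>s\<bar> = t" by simp
    thus ?thesis using True by (auto simp: abs_le_iff)
  qed (use t in \<open>auto simp: max_def\<close>)
  show ?thesis using 2 unfolding e1 e2 .
qed

text \<open>The price of exchanging the signed power for the flattened coordinate: a constant offset
  outside \<open>[- t, t]\<close>, Bernoulli's inequality inside. Paid at two points it stays below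
  \<open>t powr (p / 2)\<close>, the summand 1 of the radius.\<close>

lemma flat_coord_spow:
  assumes t: "0 < t" and p: "1 < p" "p < 2"
  shows "\<bar>spow s (p / 2) - p / 2 * flat_coord p t s\<bar> \<le> (1 - p / 2) * t powr (p / 2)"
proof (cases "\<bar>s\<bar> \<le> t")
  case False
  have "spow s (p / 2) - p / 2 * flat_coord p t s = (1 - p / 2) * (sgn s * t powr (p / 2))"
    using False p by (simp add: flat_coord_def field_simps)
  thus ?thesis using p by (simp add: abs_mult abs_sgn_eq)
next
  case True
  have tp: "t powr (p / 2) = t powr (p / 2 - 1) * t" using t by (simp add: powr_diff)
  have *: "\<bar>spow s (p / 2) - p / 2 * (t powr (p / 2 - 1) * s)\<bar> \<le> (1 - p / 2) * t powr (p / 2)"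
    if s: "0 < s" "s \<le> t" for s
  proof -
    have "s powr (p / 2) = s powr (p / 2 - 1) * s" using s by (simp add: powr_diff)
    moreover have "t powr (p / 2 - 1) * s \<le> s powr (p / 2 - 1) * s"
      using s p by (intro mult_right_mono powr_mono2') auto
    moreover have "p / 2 * (t powr (p / 2 - 1) * s) \<le> 1 * (t powr (p / 2 - 1) * s)"
      using s p by (intro mult_right_mono) auto
    ultimately have lo: "0 \<le> s powr (p / 2) - p / 2 * (t powr (p / 2 - 1) * s)" by linarith
    have "(s / t) powr (p / 2) \<le> p / 2 * (s / t) + (1 - p / 2)"
      using s p by (intro powr_le_affine) auto
    hence "(s / t) powr (p / 2) * t powr (p / 2) \<le> (p / 2 * (s / t) + (1 - p / 2)) * t powr (p / 2)"
      by (intro mult_right_mono) auto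
    also have "(s / t) powr (p / 2) * t powr (p / 2) = s powr (p / 2)"
      using t by (simp flip: powr_mult)
    also have "(p / 2 * (s / t) + (1 - p / 2)) * t powr (p / 2) = p / 2 * (t powr (p / 2 - 1) * s) + (1 - p / 2) * t powr (p / 2)"
      using t by (simp add: tp field_simps)
    finally show ?thesis using lo s by (simp add: spow_pos)
  qed
  consider "0 < s" | "s = 0" | "s < 0" by linarith
  thus ?thesis
  proof cases
    case 1
    thus ?thesis using True *[of s] by (simp add: flat_coord_def)
  next
    case 2
    thus ?thesis using t p by (simp add: flat_coord_def)
  next
    case 3
    thus ?thesis using True *[of "- s"] by (simp add: flat_coord_def)
  qed
qed

text \<open>Flattening at the larger threshold \<open>t\<close> only lowers the slope of the
  coordinate when \<open>p < 2\<close>, so the curvature for the smaller threshold \<open>t'\<close>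
  still dominates its square.\<close>

lemma flat_coord_le_of_monotone_gap:
  assumes p: "1 < p" "p < 2" and t: "0 < t'" "t' \<le> t"
  shows "p * (p - 1) * (flat_coord p t a - flat_coord p t b)\<^sup>2 \<le> (smoothed_d p t' a - smoothed_d p t' b) * (a - b)"
proof -
  define c where "c = sqrt (p * (p - 1))"
  have c2: "c\<^sup>2 = p * (p - 1)" using p by (simp add: c_def)
  have der: "((\<lambda>x. c * flat_coord p t x) has_real_derivative c * max t \<bar>x\<bar> powr (p / 2 - 1)) (at x)" for x
    using t p by (intro DERIV_cmult flat_coord_has_deriv) auto
  have "(c * flat_coord p t a - c * flat_coord p t b)\<^sup>2 \<le> (smoothed_d p t' a - smoothed_d p t' b) * (a - b)"
  proof (rule square_increment_le[of "{t', -t'}", where G' = "\<lambda>x. c * max t \<bar>x\<bar> powr (p / 2 - 1)" and F' = "smoothed_dd p t'"])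
    show "isCont (\<lambda>x. c * flat_coord p t x) x" for x using der by (rule DERIV_isCont)
    fix x assume x: "x \<notin> {t', -t'}"
    show "(smoothed_d p t' has_real_derivative smoothed_dd p t' x) (at x)"
      using x by (intro smoothed_d_has_deriv t) auto
    have sq: "(c * max t \<bar>x\<bar> powr (p / 2 - 1))\<^sup>2 = p * (p - 1) * max t \<bar>x\<bar> powr (p - 2)"
      using p powr_as_square[of "max t \<bar>x\<bar>" "p - 2"] by (simp add: power_mult_distrib diff_divide_distrib c2)
    have "max t \<bar>x\<bar> powr (p - 2) \<le> t' powr (p - 2)" using t p by (intro powr_mono2') auto
    hence "p * (p - 1) * max t \<bar>x\<bar> powr (p - 2) \<le> p * 1 * t' powr (p - 2)" using p by (intro mult_mono) auto
    moreover have "max t \<bar>x\<bar> powr (p - 2) \<le> \<bar>x\<bar> powr (p - 2)" if "t' < \<bar>x\<bar>"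
      using that t p by (intro powr_mono2') auto
    ultimately show "(c * max t \<bar>x\<bar> powr (p / 2 - 1))\<^sup>2 \<le> smoothed_dd p t' x"
      unfolding sq using p by (auto simp: smoothed_dd_def)
  qed (auto intro: smoothed_d_cont[OF t(1)] der)
  thus ?thesis by (simp add: c2 power_mult_distrib flip: right_diff_distrib)
qed

lemma radius_eq:
  assumes p: "1 < p"
  shows "radius p n t = (1 + p\<^sup>2 / (2 * (p - 1)) * sqrt (real n)) * t powr (p / 2)"
proof -
  have "p ^ 3 / (p - 1) * (1 / (2 * p)) = p\<^sup>2 / (2 * (p - 1))"
    using p by (simp add: field_simps power2_eq_square power3_eq_cube)
  moreover have "p ^ 3 / (p - 1) * sqrt (real n) * (1 / (2 * p)) = p ^ 3 / (p - 1) * (1 / (2 * p)) * sqrt (real n)"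
    by (simp only: mult_ac)
  ultimately show ?thesis unfolding radius_def step_h_def by simp
qed

text \<open>The origin of the shape of \<open>radius\<close>. For \<open>p \<ge> 2\<close> the move
  fits into the term with \<open>sqrt n\<close>, and the summand 1 provides the slack. For
  \<open>p < 2\<close> the summand 1 pays for both conversions by \<open>flat_coord_spow\<close>,
  and the slack is what the term with \<open>sqrt n\<close> leaves over, because
  \<open>(p\<^sup>2 / 2 - 1 / 4) / (p - 1) \<ge> 1 / 4\<close>.\<close>

lemma path_move_bound:
  assumes p: "1 < p" and t: "0 < t" and t': "t' = (1 - step_h p) * t" and n: "1 \<le> n"
    and M: "(smoothed_d p t' a - smoothed_d p t' b) * (a - b) \<le> 2 * (real n * (drift_const p * t powr p))"
  shows "\<bar>spow a (p / 2) - spow b (p / 2)\<bar> \<le> radius p n t - t powr (p / 2) / 4"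
proof -
  note h = step_h_bounds[OF p]
  have t'0: "0 < t'" "t' \<le> t" using t h by (auto simp: t' mult_le_cancel_right1)
  define T where "T = t powr (p / 2)"
  have T: "0 < T" and T2: "t powr p = T\<^sup>2" using t by (auto simp: T_def powr_as_square[of t p])
  define r where "r = sqrt (real n)"
  have r: "1 \<le> r" "r\<^sup>2 = real n" using n by (auto simp: r_def)
  show ?thesis
  proof (cases "2 \<le> p")
    case True
    have "4 / p * (spow a (p / 2) - spow b (p / 2))\<^sup>2 \<le> 2 * (r\<^sup>2 * (p / 4 * T\<^sup>2))"
      using spow_le_of_monotone_gap_ge2[OF True t'0(1), of a b] M True by (simp add: drift_const_def T2 r)
    hence "(p / 4) * (4 / p * (spow a (p / 2) - spow b (p / 2))\<^sup>2) \<le> (p / 4) * (2 * (r\<^sup>2 * (p / 4 * T\<^sup>2)))"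
      using p by (intro mult_left_mono) auto
    also have "\<dots> \<le> (p / 2 * r * T)\<^sup>2" using p r T by (simp add: power2_eq_square)
    finally have "(spow a (p / 2) - spow b (p / 2))\<^sup>2 \<le> (p / 2 * r * T)\<^sup>2" using p by simp
    hence 1: "\<bar>spow a (p / 2) - spow b (p / 2)\<bar> \<le> p / 2 * r * T"
      using p r T by (simp add: abs_le_square_iff[symmetric] abs_mult)
    have "p / 2 \<le> p\<^sup>2 / (2 * (p - 1))" using p by (simp add: field_simps power2_eq_square)
    hence "p / 2 * r \<le> p\<^sup>2 / (2 * (p - 1)) * r" using r by (intro mult_right_mono) auto
    hence "p / 2 * r * T \<le> (1 + p\<^sup>2 / (2 * (p - 1)) * r - 1 / 4) * T" using T by (intro mult_right_mono) auto
    thus ?thesis using 1 unfolding radius_eq[OF p] r_def[symmetric] T_def[symmetric] by (simp add: algebra_simps)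
  next
    case False
    hence p2: "p < 2" by simp
    define w where "w = flat_coord p t a - flat_coord p t b"
    have "p * (p - 1) * w\<^sup>2 \<le> 2 * (r\<^sup>2 * (1 / (8 * p * (p - 1)) * T\<^sup>2))"
      using flat_coord_le_of_monotone_gap[OF p p2 t'0, of a b] M False by (simp add: drift_const_def T2 r w_def)
    hence "(p * (p - 1) * w\<^sup>2) / (p * (p - 1)) \<le> (2 * (r\<^sup>2 * (1 / (8 * p * (p - 1)) * T\<^sup>2))) / (p * (p - 1))"
      using p by (intro divide_right_mono) auto
    also have "\<dots> = (r * T / (2 * p * (p - 1)))\<^sup>2"
    proof -
      have "(2 * (r\<^sup>2 * (1 / (8 * D) * T\<^sup>2))) / D = (r * T / (2 * D))\<^sup>2" if "D \<noteq> 0" for D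
        using that by (simp add: power2_eq_square field_simps)
      from this[of "p * (p - 1)"] p show ?thesis by (simp add: mult.assoc)
    qed
    finally have "w\<^sup>2 \<le> (r * T / (2 * p * (p - 1)))\<^sup>2" using p by simp
    hence "\<bar>w\<bar> \<le> r * T / (2 * p * (p - 1))"
      using p r T by (simp add: abs_le_square_iff[symmetric] abs_mult)
    hence "p / 2 * \<bar>w\<bar> \<le> p / 2 * (r * T / (2 * p * (p - 1)))" using p by (intro mult_left_mono) auto
    also have "\<dots> = r / (4 * (p - 1)) * T" using p by (simp add: field_simps)
    finally have w: "p / 2 * \<bar>w\<bar> \<le> r / (4 * (p - 1)) * T" .
    have "\<bar>spow a (p / 2) - spow b (p / 2)\<bar> \<le> \<bar>spow a (p / 2) - p / 2 * flat_coord p t a\<bar>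
        + \<bar>spow b (p / 2) - p / 2 * flat_coord p t b\<bar> + \<bar>p / 2 * w\<bar>"
      unfolding w_def right_diff_distrib by linarith
    also have "\<bar>p / 2 * w\<bar> = p / 2 * \<bar>w\<bar>" using p by (simp add: abs_mult)
    finally have 1: "\<bar>spow a (p / 2) - spow b (p / 2)\<bar> \<le> (1 - p / 2) * T + (1 - p / 2) * T + r / (4 * (p - 1)) * T"
      using flat_coord_spow[OF t p p2, of a] flat_coord_spow[OF t p p2, of b] w by (simp only: T_def)
    have "p * 1 \<le> p * p" using p by (intro mult_left_mono) auto
    hence q4: "1 / 4 \<le> (p\<^sup>2 / 2 - 1 / 4) / (p - 1)"
      using p by (simp add: le_divide_eq power2_eq_square)
    also have "(p\<^sup>2 / 2 - 1 / 4) / (p - 1) = (p\<^sup>2 / 2 - 1 / 4) / (p - 1) * 1" by simp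
    also have "\<dots> \<le> (p\<^sup>2 / 2 - 1 / 4) / (p - 1) * r"
      using q4 by (intro mult_left_mono[OF r(1)]) linarith
    also have "\<dots> = p\<^sup>2 / (2 * (p - 1)) * r - r / (4 * (p - 1))"
    proof -
      have "(p\<^sup>2 / 2 - 1 / 4) / D * r = p\<^sup>2 / (2 * D) * r - r / (4 * D)" if "D \<noteq> 0" for D
        using that by (simp add: field_simps)
      from this[of "p - 1"] p show ?thesis by simp
    qed
    finally have fin: "1 / 4 \<le> p\<^sup>2 / (2 * (p - 1)) * r - r / (4 * (p - 1))" .
    have "2 * (1 - p / 2) + y \<le> 1 + x - 1 / 4" if "1 / 4 \<le> x - y" for x y using that p by simp
    from this[OF fin] have "2 * (1 - p / 2) + r / (4 * (p - 1)) \<le> 1 + p\<^sup>2 / (2 * (p - 1)) * r - 1 / 4" .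
    hence "(2 * (1 - p / 2) + r / (4 * (p - 1))) * T \<le> (1 + p\<^sup>2 / (2 * (p - 1)) * r - 1 / 4) * T"
      using T by (intro mult_right_mono) auto
    thus ?thesis using 1 unfolding radius_eq[OF p] r_def[symmetric] T_def[symmetric] by (simp add: algebra_simps)
  qed
qed

text \<open>The quantity whose powers \<open>O_p\<close> hides. It is at least 4 and dominates both
  \<open>p\<close> and \<open>p / (p - 1)\<close>.\<close>

abbreviation cond :: "real \<Rightarrow> real" where "cond p \<equiv> p\<^sup>2 / (p - 1)"

lemma cond_bounds:
  assumes p: "1 < p"
  shows "4 \<le> cond p" "p \<le> cond p" "p / (p - 1) \<le> cond p" "(p - 1) / cond p \<le> 1" "cond p * (p - 1) = p\<^sup>2"
proof -
  have "0 \<le> (p - 2)\<^sup>2" by simp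
  thus "4 \<le> cond p" using p by (simp add: le_divide_eq power2_eq_square algebra_simps)
  show "p \<le> cond p" using p by (auto simp: le_divide_eq power2_eq_square algebra_simps)
  show "cond p * (p - 1) = p\<^sup>2" using p by simp
  show "p / (p - 1) \<le> cond p" using p by (intro divide_right_mono) (auto simp: power2_eq_square)
  have "(p - 1)\<^sup>2 \<le> p\<^sup>2" using p by (intro power_mono) auto
  thus "(p - 1) / cond p \<le> 1" using p by (simp add: divide_le_eq power2_eq_square)
qed

text \<open>The bound on the Bregman distance, relative to \<open>t powr p\<close>, that keeps signed powers \<open>p / 2\<close> within
  \<open>t powr (p / 2) / 8\<close>, half of the slack in the movement of the path.\<close>

definition closeness :: "real \<Rightarrow> real" where
  "closeness p = 1 / (2 ^ 17 * cond p)"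

text \<open>The curvature scales at the two ends of a box differ by a factor of at most
  \<open>2 * cond p * sqrt n\<close>. Its power \<open>\<bar>2 - 4 / p\<bar> \<le> 2\<close>
  contributes \<open>4 * cond p ^ 2\<close> and the power of \<open>n\<close>; the factors between
  curvature and weight contribute \<open>4 * cond p\<close>.\<close>

definition condition_bound :: "real \<Rightarrow> nat \<Rightarrow> real" where
  "condition_bound p n = 16 * cond p ^ 3 * real n powr \<bar>1 - 2 / p\<bar>"

section \<open>Bregman distances control signed powers\<close>

lemma powr_abs_has_deriv:
  assumes p: "1 < p"
  shows "((\<lambda>s. \<bar>s\<bar> powr p) has_real_derivative p * spow s (p - 1)) (at s)"
proof (cases "s = 0")
  case True
  have "isCont (\<lambda>s. spow s (p - 1)) 0" using p by (intro isCont_spow) auto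
  hence "((\<lambda>y. spow y (p - 1)) \<longlongrightarrow> 0) (at 0)" by (simp add: isCont_def)
  moreover have "spow y (p - 1) = (\<bar>y\<bar> powr p - \<bar>0\<bar> powr p) / (y - 0)" for y
    by (simp add: spow_def powr_diff sgn_if)
  ultimately have "((\<lambda>s. \<bar>s\<bar> powr p) has_real_derivative 0) (at 0)"
    unfolding has_field_derivative_iff by simp
  thus ?thesis using True by simp
next
  case False
  consider "0 < s" | "s < 0" using False by linarith
  thus ?thesis
  proof cases
    case 1
    have "((\<lambda>s. s powr p) has_real_derivative p * s powr (p - 1)) (at s)"
      using 1 by (rule has_real_derivative_powr)
    hence "((\<lambda>s. \<bar>s\<bar> powr p) has_real_derivative p * s powr (p - 1)) (at s)"
      by (rule has_field_derivative_transform_within_open[of _ _ _ "{0<..}"]) (use 1 in auto)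
    thus ?thesis using 1 by (simp add: spow_pos)
  next
    case 2
    have "((\<lambda>s. (- s) powr p) has_real_derivative - (p * (- s) powr (p - 1))) (at s)"
      using 2 by (auto intro!: derivative_eq_intros)
    hence "((\<lambda>s. \<bar>s\<bar> powr p) has_real_derivative - (p * (- s) powr (p - 1))) (at s)"
      by (rule has_field_derivative_transform_within_open[of _ _ _ "{..<0}"]) (use 2 in auto)
    thus ?thesis using 2 by (simp add: spow_def)
  qed
qed

text \<open>In terms of \<open>X = \<bar>a\<bar> powr (p / 2)\<close> and
  \<open>Y = \<bar>b\<bar> powr (p / 2)\<close> the cross term is bounded by
  \<open>powr_le_affine\<close> at \<open>X / Y\<close>. Equal signs then leave
  \<open>(X - Y)\<^sup>2\<close>; opposite signs leave \<open>X\<^sup>2 + Y\<^sup>2\<close>, which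
  costs the factor \<open>1 / 2\<close>.\<close>

lemma lp_bregman_ge2:
  assumes p: "2 \<le> p"
  shows "1 / 2 * (spow a (p / 2) - spow b (p / 2))\<^sup>2 \<le> \<bar>a\<bar> powr p - \<bar>b\<bar> powr p - p * spow b (p - 1) * (a - b)"
proof -
  define X where "X = \<bar>a\<bar> powr (p / 2)"
  define Y where "Y = \<bar>b\<bar> powr (p / 2)"
  define c where "c = \<bar>b\<bar> powr (p - 1) * \<bar>a\<bar>"
  have XY: "0 \<le> X" "0 \<le> Y" "0 \<le> c" "\<bar>a\<bar> powr p = X\<^sup>2" "\<bar>b\<bar> powr p = Y\<^sup>2"
    by (auto simp: X_def Y_def c_def powr_as_square[of _ p])
  have bb: "spow b (p - 1) * b = Y\<^sup>2"
    unfolding XY(5)[symmetric] by (cases "b = 0") (auto simp: spow_def powr_diff sgn_if)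
  have c: "p * c \<le> 2 * X * Y + (p - 2) * Y\<^sup>2"
  proof (cases "b = 0")
    case True
    thus ?thesis by (simp add: c_def Y_def)
  next
    case False
    hence Y0: "0 < Y" by (simp add: Y_def)
    have "(X / Y) powr (2 / p) \<le> 2 / p * (X / Y) + (1 - 2 / p)"
      using XY p Y0 by (intro powr_le_affine) auto
    moreover have "(X / Y) powr (2 / p) = \<bar>a\<bar> / \<bar>b\<bar>"
      using p by (simp add: X_def Y_def powr_divide powr_powr)
    ultimately have "(p * Y\<^sup>2) * (\<bar>a\<bar> / \<bar>b\<bar>) \<le> (p * Y\<^sup>2) * (2 / p * (X / Y) + (1 - 2 / p))"
      using p by (intro mult_left_mono) auto
    also have "\<dots> = 2 * X * Y + (p - 2) * Y\<^sup>2" using p Y0 by (simp add: field_simps power2_eq_square)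
    also have "(p * Y\<^sup>2) * (\<bar>a\<bar> / \<bar>b\<bar>) = p * c"
      using False by (simp add: c_def XY(5)[symmetric] powr_diff)
    finally show ?thesis .
  qed
  have cross: "spow b (p - 1) * a = (if 0 \<le> a * b then c else - c)"
    by (auto simp: spow_def c_def sgn_if zero_le_mult_iff abs_if)
  have uv: "spow a (p / 2) * spow b (p / 2) = (if 0 \<le> a * b then X * Y else - (X * Y))"
    by (auto simp: spow_def X_def Y_def sgn_if zero_le_mult_iff)
  have sq: "(spow a (p / 2))\<^sup>2 = X\<^sup>2" "(spow b (p / 2))\<^sup>2 = Y\<^sup>2"
    using abs_spow[of a "p / 2"] abs_spow[of b "p / 2"] unfolding X_def Y_def by (metis power2_abs)+
  have lhs: "(spow a (p / 2) - spow b (p / 2))\<^sup>2 = X\<^sup>2 + Y\<^sup>2 - 2 * (spow a (p / 2) * spow b (p / 2))"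
    by (simp add: power2_diff sq)
  have rhs: "\<bar>a\<bar> powr p - \<bar>b\<bar> powr p - p * spow b (p - 1) * (a - b) = X\<^sup>2 + (p - 1) * Y\<^sup>2 - p * (spow b (p - 1) * a)"
    using bb by (simp add: XY algebra_simps)
  show ?thesis
  proof (cases "0 \<le> a * b")
    case True
    have "0 \<le> (X - Y)\<^sup>2" by simp
    hence "1 / 2 * (X\<^sup>2 + Y\<^sup>2 - 2 * (X * Y)) \<le> X\<^sup>2 + Y\<^sup>2 - 2 * (X * Y)" by (simp add: power2_diff)
    also have "\<dots> \<le> X\<^sup>2 + (p - 1) * Y\<^sup>2 - p * c" using c by (simp add: algebra_simps)
    finally show ?thesis unfolding lhs rhs cross uv using True by simp
  next
    case False
    have "0 \<le> (X - Y)\<^sup>2" by simp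
    hence "1 / 2 * (X\<^sup>2 + Y\<^sup>2 + 2 * (X * Y)) \<le> X\<^sup>2 + 1 * Y\<^sup>2" by (simp add: power2_diff)
    also have "\<dots> \<le> X\<^sup>2 + (p - 1) * Y\<^sup>2" using p by (intro add_left_mono mult_right_mono) auto
    also have "\<dots> \<le> X\<^sup>2 + (p - 1) * Y\<^sup>2 + p * c" using p XY by simp
    finally show ?thesis unfolding lhs rhs cross uv using False by simp
  qed
qed

text \<open>Subtracting \<open>\<bar>s\<bar> powr p / (p - 1)\<close> from the smoothed loss leaves
  a convex function when \<open>p \<ge> 2\<close>, so the Bregman distance of the smoothed loss
  dominates that of the pure power divided by \<open>p - 1\<close>.\<close>

lemma smoothed_bregman_ge2:
  assumes p: "2 \<le> p" and t: "0 < t"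
  shows "(spow a (p / 2) - spow b (p / 2))\<^sup>2
    \<le> 2 * (p - 1) * (smoothed p t a - smoothed p t b - smoothed_d p t b * (a - b))"
proof -
  define H where "H s = smoothed p t s - \<bar>s\<bar> powr p / (p - 1)" for s
  define H' where "H' s = smoothed_d p t s - p / (p - 1) * spow s (p - 1)" for s
  have der: "(H has_real_derivative H' x) (at x)" for x
    using DERIV_diff[OF smoothed_has_deriv[OF t, of p] DERIV_cdivide[OF powr_abs_has_deriv[of p x], of "p - 1"]] p
    by (simp add: H_def[abs_def] H'_def)
  have "0 \<le> H a - H b - H' b * (a - b)"
  proof (rule bregman_nonneg[OF der])
    fix x y :: real assume xy: "x \<le> y"
    show "H' x \<le> H' y"
    proof (rule mono_off_finite[of "{0, t, -t}" x y H' "\<lambda>z. smoothed_dd p t z - p * \<bar>z\<bar> powr (p - 2)"])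
      show "continuous_on {x..y} H'" unfolding H'_def
        using smoothed_d_cont[OF t] isCont_spow[of "p - 1"] p
        by (intro continuous_intros continuous_at_imp_continuous_on) auto
      fix z assume z: "z \<notin> {0, t, -t}"
      have sm: "(smoothed_d p t has_real_derivative smoothed_dd p t z) (at z)"
        using z by (intro smoothed_d_has_deriv t) auto
      have "((\<lambda>s. spow s (p - 1)) has_real_derivative (p - 1) * \<bar>z\<bar> powr (p - 1 - 1)) (at z)"
        using z by (intro spow_has_deriv) auto
      from DERIV_diff[OF sm DERIV_cmult[OF this, of "p / (p - 1)"]]
      show "(H' has_real_derivative (smoothed_dd p t z - p * \<bar>z\<bar> powr (p - 2))) (at z)"
        unfolding H'_def using p by simp
      have "\<bar>z\<bar> powr (p - 2) \<le> t powr (p - 2)" if "\<bar>z\<bar> \<le> t" using that p by (intro powr_mono2) auto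
      moreover have "p * \<bar>z\<bar> powr (p - 2) \<le> p * (p - 1) * \<bar>z\<bar> powr (p - 2)"
        using p by (intro mult_right_mono) auto
      ultimately show "0 \<le> smoothed_dd p t z - p * \<bar>z\<bar> powr (p - 2)"
        using p by (auto simp: smoothed_dd_def)
    qed (use xy in auto)
  qed
  hence "(\<bar>a\<bar> powr p - \<bar>b\<bar> powr p - p * spow b (p - 1) * (a - b)) / (p - 1)
    \<le> smoothed p t a - smoothed p t b - smoothed_d p t b * (a - b)"
    by (simp add: H_def H'_def algebra_simps diff_divide_distrib add_divide_distrib)
  hence "\<bar>a\<bar> powr p - \<bar>b\<bar> powr p - p * spow b (p - 1) * (a - b)
    \<le> (p - 1) * (smoothed p t a - smoothed p t b - smoothed_d p t b * (a - b))"
    using p by (simp add: divide_le_eq mult.commute)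
  thus ?thesis using lp_bregman_ge2[OF p, of a b] unfolding mult.assoc by linarith
qed

text \<open>A curvature bound valid on \<open>[- m, m]\<close> becomes global by passing to the
  quadratic extension, which agrees with the loss at \<open>a\<close> and \<open>b\<close>.\<close>

lemma smoothed_bregman_local:
  assumes t: "0 < t" and lo: "\<And>z. \<bar>z\<bar> \<le> m \<Longrightarrow> lo \<le> smoothed_dd p t z" and m: "0 < m" "\<bar>a\<bar> \<le> m" "\<bar>b\<bar> \<le> m"
  shows "lo / 2 * (a - b)\<^sup>2 \<le> smoothed p t a - smoothed p t b - smoothed_d p t b * (a - b)"
proof -
  have eq: "smoothed_ext p t (- m) m z = smoothed p t z" "smoothed_ext_d p t (- m) m z = smoothed_d p t z"
    if "\<bar>z\<bar> \<le> m" for z using that by (auto simp: smoothed_ext_def smoothed_ext_d_def abs_le_iff max_def min_def)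
  have "((\<lambda>x. smoothed_ext p t (- m) m x - lo / 2 * x\<^sup>2) has_real_derivative (smoothed_ext_d p t (- m) m x - lo * x)) (at x)" for x
    using m by (auto intro!: derivative_eq_intros smoothed_ext_has_deriv t)
  moreover have "smoothed_ext_d p t (- m) m x - lo * x \<le> smoothed_ext_d p t (- m) m y - lo * y" if "x \<le> y" for x y
  proof -
    have "lo * (y - x) \<le> smoothed_ext_d p t (- m) m y - smoothed_ext_d p t (- m) m x"
      using that lo m by (intro smoothed_ext_d_increment(1)[OF t]) auto
    thus ?thesis by (simp add: algebra_simps)
  qed
  ultimately have "0 \<le> (smoothed_ext p t (- m) m a - lo / 2 * a\<^sup>2) - (smoothed_ext p t (- m) m b - lo / 2 * b\<^sup>2)
     - (smoothed_ext_d p t (- m) m b - lo * b) * (a - b)"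
    by (rule bregman_nonneg)
  thus ?thesis using eq[OF m(2)] eq[OF m(3)] by (simp add: power2_eq_square field_simps)
qed

subsection \<open>Curvature inside the box\<close>

lemma smoothed_dd_bounds:
  assumes p: "1 < p" and t: "0 < t"
  shows "2 \<le> p \<Longrightarrow> p * max t \<bar>z\<bar> powr (p - 2) \<le> smoothed_dd p t z"
    and "2 \<le> p \<Longrightarrow> smoothed_dd p t z \<le> p * (p - 1) * max t \<bar>z\<bar> powr (p - 2)"
    and "p \<le> 2 \<Longrightarrow> p * (p - 1) * max t \<bar>z\<bar> powr (p - 2) \<le> smoothed_dd p t z"
    and "p \<le> 2 \<Longrightarrow> smoothed_dd p t z \<le> p * max t \<bar>z\<bar> powr (p - 2)"
proof -
  define x where "x = max t \<bar>z\<bar> powr (p - 2)"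
  have x: "0 \<le> x" by (simp add: x_def)
  have dd: "smoothed_dd p t z = (if \<bar>z\<bar> \<le> t then p * x else p * (p - 1) * x)"
    by (auto simp: smoothed_dd_def x_def max_def)
  have "p * 1 * x \<le> p * (p - 1) * x" if "2 \<le> p" using that x by (intro mult_right_mono mult_left_mono) auto
  moreover have "p * (p - 1) * x \<le> p * 1 * x" if "p \<le> 2" using that p x by (intro mult_right_mono mult_left_mono) auto
  ultimately show "2 \<le> p \<Longrightarrow> p * max t \<bar>z\<bar> powr (p - 2) \<le> smoothed_dd p t z"
    "2 \<le> p \<Longrightarrow> smoothed_dd p t z \<le> p * (p - 1) * max t \<bar>z\<bar> powr (p - 2)"
    "p \<le> 2 \<Longrightarrow> p * (p - 1) * max t \<bar>z\<bar> powr (p - 2) \<le> smoothed_dd p t z"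
    "p \<le> 2 \<Longrightarrow> smoothed_dd p t z \<le> p * max t \<bar>z\<bar> powr (p - 2)"
    unfolding dd x_def[symmetric] by auto
qed

text \<open>For \<open>p < 2\<close> the curvature is taken at the largest modulus \<open>mx\<close>
  among \<open>t\<close>, \<open>a\<close> and \<open>b\<close>. If \<open>a\<close> or
  \<open>b\<close> attains it, the Lipschitz bound applies; if both stay below \<open>t\<close>, the
  Hoelder bound.\<close>

lemma small_bregman_imp_close:
  assumes p: "1 < p" and t: "0 < t"
    and B: "smoothed p t a - smoothed p t b - smoothed_d p t b * (a - b) \<le> closeness p * t powr p"
  shows "\<bar>spow a (p / 2) - spow b (p / 2)\<bar> \<le> t powr (p / 2) / 8"
proof -
  define T where "T = t powr (p / 2)"
  have T: "0 < T" and T2: "t powr p = T\<^sup>2" using t by (auto simp: T_def powr_as_square[of t p])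
  note c = cond_bounds[OF p]
  show ?thesis
  proof (cases "2 \<le> p")
    case True
    have "(spow a (p / 2) - spow b (p / 2))\<^sup>2 \<le> 2 * (p - 1) * (closeness p * T\<^sup>2)"
      using p unfolding T2[symmetric]
      by (intro order_trans[OF smoothed_bregman_ge2[OF True t, of a b] mult_left_mono[OF B]]) simp
    also have "\<dots> = (p - 1) / cond p * (T\<^sup>2 / 2 ^ 16)"
    proof -
      have "2 * x * (1 / (2 ^ 17 * c) * y) = x / c * (y / 2 ^ 16)" for x c y :: real
        by (cases "c = 0") (simp_all add: field_simps)
      thus ?thesis unfolding closeness_def .
    qed
    also have "\<dots> \<le> 1 * (T\<^sup>2 / 2 ^ 16)" using c(4) by (intro mult_right_mono) auto
    also have "\<dots> \<le> (T / 8)\<^sup>2" by (simp add: power2_eq_square)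
    finally show ?thesis using T by (simp add: abs_le_square_iff[symmetric] T_def)
  next
    case False
    hence p2: "p < 2" by simp
    define m where "m = max \<bar>a\<bar> \<bar>b\<bar>"
    define mx where "mx = max t m"
    have mx: "0 < mx" "\<bar>a\<bar> \<le> mx" "\<bar>b\<bar> \<le> mx" using t by (auto simp: mx_def m_def)
    have "p * (p - 1) * mx powr (p - 2) \<le> smoothed_dd p t z" if "\<bar>z\<bar> \<le> mx" for z
    proof -
      have "mx powr (p - 2) \<le> max t \<bar>z\<bar> powr (p - 2)"
        using that t p2 by (intro powr_mono2') (auto simp: mx_def)
      hence "p * (p - 1) * mx powr (p - 2) \<le> p * (p - 1) * max t \<bar>z\<bar> powr (p - 2)"
        using p by (intro mult_left_mono) auto
      thus ?thesis using smoothed_dd_bounds(3)[OF p t, of z] p2 by linarith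
    qed
    from smoothed_bregman_local[OF t this mx]
    have "p * (p - 1) * mx powr (p - 2) / 2 * (a - b)\<^sup>2 \<le> closeness p * T\<^sup>2" using B by (simp add: T2)
    hence "2 / (p * (p - 1)) * (p * (p - 1) * mx powr (p - 2) / 2 * (a - b)\<^sup>2) \<le> 2 / (p * (p - 1)) * (closeness p * T\<^sup>2)"
      using p by (intro mult_left_mono) auto
    hence "mx powr (p - 2) * (a - b)\<^sup>2 \<le> 2 / (p * (p - 1)) * (closeness p * T\<^sup>2)" using p by simp
    also have "\<dots> = T\<^sup>2 / 2 ^ 16 * (1 / p ^ 3)" using p by (simp add: closeness_def power2_eq_square power3_eq_cube)
    also have "\<dots> \<le> T\<^sup>2 / 2 ^ 16 * 1" using p by (intro mult_left_mono) auto
    finally have gap: "mx powr (p - 2) * (a - b)\<^sup>2 \<le> (T / 256)\<^sup>2" by (simp add: power2_eq_square)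
    have "mx powr (p - 2) = (mx powr (p / 2 - 1))\<^sup>2" by (simp add: powr_as_square[of mx "p - 2"] diff_divide_distrib)
    with gap have "(mx powr (p / 2 - 1) * \<bar>a - b\<bar>)\<^sup>2 \<le> (T / 256)\<^sup>2" by (simp add: power_mult_distrib)
    hence gap: "mx powr (p / 2 - 1) * \<bar>a - b\<bar> \<le> T / 256"
      by (rule power2_le_imp_le) (use T in simp)
    show ?thesis
    proof (cases "t \<le> m")
      case True
      hence mm: "mx = m" by (simp add: mx_def)
      have "\<bar>spow a (p / 2) - spow b (p / 2)\<bar> \<le> 2 * (m powr (p / 2 - 1) * \<bar>a - b\<bar>)"
      proof (cases "\<bar>b\<bar> \<le> \<bar>a\<bar>")
        case True
        hence "m = \<bar>a\<bar>" "a \<noteq> 0" using mx mm by (auto simp: m_def)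
        thus ?thesis using spow_diff_le_lipschitz[of "p / 2" b a] True p p2 by (simp add: mult.assoc)
      next
        case False
        hence "m = \<bar>b\<bar>" "b \<noteq> 0" using mx mm by (auto simp: m_def)
        thus ?thesis using spow_diff_le_lipschitz[of "p / 2" a b] False p p2
          by (simp add: mult.assoc abs_minus_commute)
      qed
      thus ?thesis using gap T unfolding mm T_def by linarith
    next
      case False
      hence mm: "mx = t" by (simp add: mx_def)
      have tp: "t powr (p / 2) = t powr (p / 2 - 1) * t" using t by (simp add: powr_diff)
      have "t powr (p / 2 - 1) * \<bar>a - b\<bar> \<le> t powr (p / 2 - 1) * (t / 256)"
        using gap unfolding mm T_def tp by simp
      hence "\<bar>a - b\<bar> \<le> t / 256" using t by (simp add: mult_le_cancel_left)
      \<comment> \<open>For \<open>p\<close> near 1 the Hoelder bound takes a square root, turning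
        \<open>1 / 256\<close> into \<open>1 / 16\<close>, and doubles it; this dictates the
        \<open>2 ^ 17\<close> in \<open>closeness\<close>.\<close>
      hence "\<bar>a - b\<bar> powr (p / 2) \<le> (t / 256) powr (p / 2)" using p by (intro powr_mono2) auto
      also have "\<dots> = T * (1 / 256) powr (p / 2)" by (simp add: T_def powr_divide)
      also have "\<dots> \<le> T * (1 / 256) powr (1 / 2)" using T p by (intro mult_left_mono powr_mono') auto
      also have "(1 / 256 :: real) powr (1 / 2) = 1 / 16"
        using powr_half_sqrt[of "1 / 256"] real_sqrt_divide[of 1 256] by (simp add: real_sqrt_unique[of 16 256])
      finally have "\<bar>a - b\<bar> powr (p / 2) \<le> T / 16" by simp
      thus ?thesis using spow_diff_le_holder[of "p / 2" a b] p p2 unfolding T_def[symmetric] by linarith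
    qed
  qed
qed

section \<open>Deviation of the smoothed loss from the power\<close>

lemma smoothed_error:
  assumes p: "1 < p" and t: "0 < t"
  shows "smoothed p t s \<le> \<bar>s\<bar> powr p + max 0 (p / 2 - 1) * t powr p"
    and "\<bar>s\<bar> powr p + min 0 (p / 2 - 1) * t powr p \<le> smoothed p t s"
proof -
  have *: "smoothed p t s \<le> \<bar>s\<bar> powr p + max 0 (p / 2 - 1) * t powr p \<and>
    \<bar>s\<bar> powr p + min 0 (p / 2 - 1) * t powr p \<le> smoothed p t s"
  proof (cases "\<bar>s\<bar> \<le> t")
    case False
    have "min 0 (p / 2 - 1) * t powr p \<le> (p / 2 - 1) * t powr p" "(p / 2 - 1) * t powr p \<le> max 0 (p / 2 - 1) * t powr p"
      by (intro mult_right_mono; simp)+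
    thus ?thesis using False by (simp add: smoothed_def)
  next
    case True
    \<comment> \<open>Scaling out \<open>t\<close> leaves the comparison of
      \<open>p / 2 * x\<^sup>2\<close> with \<open>x powr p\<close> on \<open>[0, 1]\<close>. One
      side is Bernoulli's inequality in \<open>x\<^sup>2\<close>, whose power \<open>p / 2\<close>
      is \<open>x powr p\<close>.\<close>
    define x where "x = \<bar>s\<bar> / t"
    have x: "0 \<le> x" "x \<le> 1" "\<bar>s\<bar> = x * t" using True t by (auto simp: x_def)
    have sm: "smoothed p t s = p / 2 * x\<^sup>2 * t powr p"
    proof -
      have "s\<^sup>2 = (x * t)\<^sup>2" using x(3) by (metis power2_abs)
      thus ?thesis using True t by (simp add: smoothed_def powr_diff power_mult_distrib)
    qed
    have sp: "\<bar>s\<bar> powr p = x powr p * t powr p" by (simp add: x(3) powr_mult)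
    have x2: "(x\<^sup>2) powr (p / 2) = x powr p"
    proof (cases "x = 0")
      case False
      hence "x\<^sup>2 = x powr 2" using x by simp
      thus ?thesis by (simp add: powr_powr)
    qed simp
    have x2': "x\<^sup>2 = x powr 2" using x by (cases "x = 0") auto
    have "p / 2 * x\<^sup>2 \<le> x powr p + max 0 (p / 2 - 1) \<and> x powr p + min 0 (p / 2 - 1) \<le> p / 2 * x\<^sup>2"
    proof (cases "2 \<le> p")
      case True
      have "1 + p / 2 * (x\<^sup>2 - 1) \<le> x powr p" using powr_ge_affine[of "x\<^sup>2" "p / 2"] True by (simp add: x2)
      moreover have "x powr p \<le> x\<^sup>2" unfolding x2' using True x by (intro powr_mono') auto
      moreover have "1 * x\<^sup>2 \<le> p / 2 * x\<^sup>2" using True by (intro mult_right_mono) auto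
      ultimately show ?thesis using True by (simp add: algebra_simps)
    next
      case False
      have "x powr p \<le> p / 2 * x\<^sup>2 + (1 - p / 2)" using powr_le_affine[of "x\<^sup>2" "p / 2"] False p by (simp add: x2)
      moreover have "x\<^sup>2 \<le> x powr p" unfolding x2' using False x by (intro powr_mono') auto
      moreover have "p / 2 * x\<^sup>2 \<le> 1 * x\<^sup>2" using False by (intro mult_right_mono) auto
      ultimately show ?thesis using False by (simp add: algebra_simps)
    qed
    hence "p / 2 * x\<^sup>2 * t powr p \<le> (x powr p + max 0 (p / 2 - 1)) * t powr p"
      "(x powr p + min 0 (p / 2 - 1)) * t powr p \<le> p / 2 * x\<^sup>2 * t powr p"
      by (auto intro!: mult_right_mono simp del: times_divide_eq_left)
    thus ?thesis unfolding sm sp by (simp add: distrib_right)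
  qed
  thus "smoothed p t s \<le> \<bar>s\<bar> powr p + max 0 (p / 2 - 1) * t powr p"
    "\<bar>s\<bar> powr p + min 0 (p / 2 - 1) * t powr p \<le> smoothed p t s" by auto
qed

text \<open>Both smoothings lie in the same band around \<open>\<bar>s\<bar> powr p\<close>, of
  width \<open>\<bar>p / 2 - 1\<bar> * t powr p\<close>.\<close>

lemma smoothed_change:
  assumes p: "1 < p" and t: "0 < t'" "t' \<le> t"
  shows "\<bar>smoothed p t s - smoothed p t' s\<bar> \<le> p / 2 * t powr p"
proof -
  have t0: "0 < t" using t by simp
  have le: "t' powr p \<le> t powr p" using t p by (intro powr_mono2) auto
  have 1: "max 0 (p / 2 - 1) * t' powr p \<le> max 0 (p / 2 - 1) * t powr p"
    using le by (intro mult_left_mono) auto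
  have 2: "min 0 (p / 2 - 1) * t powr p \<le> min 0 (p / 2 - 1) * t' powr p"
    using le by (intro mult_left_mono_neg) auto
  have "(max 0 (p / 2 - 1) - min 0 (p / 2 - 1)) * t powr p \<le> p / 2 * t powr p"
    using p by (intro mult_right_mono) (auto simp: max_def min_def)
  hence 3: "max 0 (p / 2 - 1) * t powr p - min 0 (p / 2 - 1) * t powr p \<le> p / 2 * t powr p"
    by (simp only: left_diff_distrib)
  have gen: "\<bar>f - f'\<bar> \<le> P"
    if "f \<le> x + A" "x + B \<le> f" "f' \<le> x + A'" "x + B' \<le> f'" "A' \<le> A" "B \<le> B'" "A - B \<le> P"
    for f f' x A B A' B' P :: real
    using that by linarith
  show ?thesis
    by (rule gen[OF smoothed_error[OF p t0, of s] smoothed_error[OF p t(1), of s] 1 2 3])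
qed

lemma box_lo_less_hi:
  assumes p: "1 < p" and t: "0 < t"
  shows "box_lo p n t s < box_hi p n t s" "0 < radius p n t"
proof -
  show r: "0 < radius p n t" unfolding radius_eq[OF p] using p t by (intro mult_pos_pos add_pos_nonneg) auto
  have "spow (box_lo p n t s) (p / 2) = spow s (p / 2) - radius p n t"
    "spow (box_hi p n t s) (p / 2) = spow s (p / 2) + radius p n t"
    using p by (auto simp: box_lo_def box_hi_def spow_inverse)
  hence "spow (box_lo p n t s) (p / 2) < spow (box_hi p n t s) (p / 2)" using r by simp
  hence "\<not> spow (box_hi p n t s) (p / 2) \<le> spow (box_lo p n t s) (p / 2)" by simp
  thus "box_lo p n t s < box_hi p n t s"
    using spow_mono[of "p / 2" "box_hi p n t s" "box_lo p n t s"] p by linarith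
qed

text \<open>Signed powers with exponents \<open>p / 2\<close> and \<open>2 / p\<close> are
  increasing and inverse to each other, so in the coordinate \<open>u\<close> a box is a symmetric
  interval.\<close>

lemma box_iff:
  assumes p: "1 < p"
  shows "box_lo p n t s \<le> z \<and> z \<le> box_hi p n t s \<longleftrightarrow> \<bar>spow z (p / 2) - spow s (p / 2)\<bar> \<le> radius p n t"
proof -
  have lo: "spow (box_lo p n t s) (p / 2) = spow s (p / 2) - radius p n t"
    and hi: "spow (box_hi p n t s) (p / 2) = spow s (p / 2) + radius p n t"
    using p by (auto simp: box_lo_def box_hi_def spow_inverse)
  have iff: "spow x (p / 2) \<le> spow y (p / 2) \<longleftrightarrow> x \<le> y" for x y
    using spow_mono[of "p / 2" x y] spow_mono[of "2 / p" "spow x (p / 2)" "spow y (p / 2)"] p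
      spow_inverse[of "p / 2" "2 / p"] by auto
  show ?thesis using iff[of "box_lo p n t s" z] iff[of z "box_hi p n t s"] unfolding lo hi by (auto simp: abs_le_iff)
qed

lemma condition_bound_aux:
  assumes p: "1 < p" and n: "1 \<le> n"
  shows "(1 + 2 * (1 + p\<^sup>2 / (2 * (p - 1)) * sqrt (real n))) powr \<bar>2 - 4 / p\<bar> * (4 * cond p) \<le> condition_bound p n"
proof -
  define r where "r = sqrt (real n)"
  define e where "e = \<bar>1 - 2 / p\<bar>"
  have e: "0 \<le> e" "e \<le> 1" using p by (auto simp: e_def divide_le_eq abs_le_iff field_simps)
  have e2: "\<bar>2 - 4 / p\<bar> = 2 * e" by (auto simp: e_def abs_if field_simps)
  have r: "1 \<le> r" "r\<^sup>2 = real n" using n by (auto simp: r_def)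
  have q: "4 \<le> cond p" using cond_bounds[OF p] by simp
  have "3 * 1 \<le> cond p * r" using q r by (intro mult_mono) auto
  hence le: "1 + 2 * (1 + p\<^sup>2 / (2 * (p - 1)) * r) \<le> 2 * cond p * r"
  proof -
    have "2 * (p\<^sup>2 / (2 * (p - 1)) * r) = cond p * r" using p by (simp add: field_simps)
    hence "1 + 2 * (1 + p\<^sup>2 / (2 * (p - 1)) * r) = 3 + cond p * r" by simp
    also have "\<dots> \<le> cond p * r + cond p * r"
      using \<open>3 * 1 \<le> cond p * r\<close> by (intro add_mono) simp_all
    also have "cond p * r + cond p * r = 2 * cond p * r" by (simp only: mult_2[symmetric] mult.assoc)
    finally show ?thesis .
  qed
  have "0 \<le> p\<^sup>2 / (2 * (p - 1)) * r" using p r by simp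
  hence pos: "0 \<le> 1 + 2 * (1 + p\<^sup>2 / (2 * (p - 1)) * r)" by simp
  have "(1 + 2 * (1 + p\<^sup>2 / (2 * (p - 1)) * r)) powr (2 * e) \<le> (2 * cond p * r) powr (2 * e)"
    using le pos e by (intro powr_mono2) auto
  also have "\<dots> = (2 * cond p) powr (2 * e) * (r powr 2) powr e"
    unfolding powr_powr by (rule powr_mult)
  also have "r powr 2 = real n" using r by simp
  also have "(2 * cond p) powr (2 * e) \<le> (2 * cond p) powr 2" using q e by (intro powr_mono) auto
  also have "(2 * cond p) powr 2 = (2 * cond p)\<^sup>2" using q by simp
  finally have "(1 + 2 * (1 + p\<^sup>2 / (2 * (p - 1)) * r)) powr (2 * e) \<le> (2 * cond p)\<^sup>2 * real n powr e"
    by (simp add: mult_right_mono)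
  hence "(1 + 2 * (1 + p\<^sup>2 / (2 * (p - 1)) * r)) powr (2 * e) * (4 * cond p) \<le> (2 * cond p)\<^sup>2 * real n powr e * (4 * cond p)"
    by (rule mult_right_mono) (use q in simp)
  also have "\<dots> = condition_bound p n" by (simp add: condition_bound_def e_def power2_eq_square power3_eq_cube)
  finally show ?thesis unfolding e2 r_def .
qed

lemma condition_bound_ge_1:
  assumes p: "1 < p" and n: "1 \<le> n"
  shows "1 \<le> condition_bound p n"
proof -
  have "1 * 1 \<le> cond p ^ 3 * real n powr \<bar>1 - 2 / p\<bar>"
    using cond_bounds[OF p] n by (intro mult_mono one_le_power ge_one_powr_ge_zero) auto
  thus ?thesis by (simp add: condition_bound_def)
qed

text \<open>With \<open>X = max t' \<bar>z\<bar> powr (p / 2)\<close> and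
  \<open>e = 2 - 4 / p\<close> the curvature is \<open>X powr e\<close> times \<open>p\<close> or
  \<open>p * (p - 1)\<close>. In the box \<open>X\<close> lies between \<open>c * m\<close> and
  \<open>M\<close>, and \<open>M \<le> (1 + 2 * G) * m\<close>. The sign \<open>sgn (p - 2)\<close>
  in \<open>weight\<close> selects the end of smaller curvature: \<open>m\<close> for
  \<open>e \<ge> 0\<close>, \<open>M\<close> for \<open>e \<le> 0\<close>.\<close>

lemma weight_bounds:
  assumes p: "1 < p" and t: "0 < t" and n: "1 \<le> n"
    and z: "box_lo p n t s \<le> z" "z \<le> box_hi p n t s"
  shows "0 < weight p n t s"
    and "weight p n t s \<le> smoothed_dd p ((1 - step_h p) * t) z"
    and "smoothed_dd p ((1 - step_h p) * t) z \<le> condition_bound p n * weight p n t s"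
proof -
  note h = step_h_bounds[OF p]
  define t' where "t' = (1 - step_h p) * t"
  have t'0: "0 < t'" "t' \<le> t" using t h by (auto simp: t'_def mult_le_cancel_right1)
  define T where "T = t powr (p / 2)"
  define S where "S = \<bar>s\<bar> powr (p / 2)"
  define G where "G = 1 + p\<^sup>2 / (2 * (p - 1)) * sqrt (real n)"
  define e where "e = 2 - 4 / p"
  define X where "X = max t' \<bar>z\<bar> powr (p / 2)"
  \<comment> \<open>The loss has threshold \<open>t'\<close> but the weight uses \<open>t\<close>;
    \<open>c\<close> is the discrepancy, and \<open>c\<^sup>2 \<ge> 1 / 2\<close> limits its effect
    to a factor 2.\<close>
  define c where "c = (1 - step_h p) powr (p / 2)"
  have T: "0 < T" and S: "0 \<le> S" using t by (auto simp: T_def S_def)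
  have G: "1 \<le> G" using p by (simp add: G_def)
  have rad: "radius p n t = G * T" by (simp add: radius_eq[OF p] G_def T_def)
  have GT: "T \<le> G * T" using G T by simp
  have c: "0 < c" "c \<le> 1" "1 / 2 \<le> c\<^sup>2"
    using h p unfolding c_def by (auto intro!: powr_le1 simp flip: powr_as_square)
  have Xeq: "max t' \<bar>z\<bar> powr (p - 2) = X powr e"
    using p by (simp add: X_def e_def powr_powr right_diff_distrib)
  have zS: "S - G * T \<le> \<bar>z\<bar> powr (p / 2)" "\<bar>z\<bar> powr (p / 2) \<le> S + G * T"
    using box_iff[OF p, of n t s z] z abs_spow[of z "p / 2"] abs_spow[of s "p / 2"] unfolding rad S_def by linarith+
  have Xmax: "X = max (c * T) (\<bar>z\<bar> powr (p / 2))"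
  proof -
    have "c * T = t' powr (p / 2)" by (simp add: c_def T_def t'_def powr_mult)
    thus ?thesis using t'0 p unfolding X_def by (cases "t' \<le> \<bar>z\<bar>") (auto simp: max_def powr_mono2 intro: antisym powr_mono2)
  qed
  define m where "m = max T (S - G * T)"
  define M where "M = S + G * T"
  have m: "0 < m" using T by (simp add: m_def)
  have M: "0 < M" "T \<le> M" unfolding M_def using S GT T by linarith+
  have cT: "c * T \<le> T" using c T by simp
  have X1: "c * m \<le> X"
  proof (cases "T \<le> S - G * T")
    case True
    hence "c * m \<le> 1 * m" "m = S - G * T" using c m by (auto simp: m_def intro!: mult_right_mono)
    thus ?thesis using zS by (simp add: Xmax)
  next
    case False
    thus ?thesis by (simp add: m_def Xmax)
  qed
  have X2: "X \<le> M" using cT M zS by (simp add: Xmax M_def)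
  have X0: "0 < X" using X1 c m by (meson less_le_trans mult_pos_pos)
  have Mm: "M \<le> (1 + 2 * G) * m"
  proof -
    have "2 * (G * T) \<le> 2 * (G * m)" using G T by (intro mult_left_mono) (auto simp: m_def)
    moreover have "S - G * T \<le> m" by (simp add: m_def)
    ultimately show ?thesis by (simp add: M_def algebra_simps)
  qed
  have q: "0 < cond p" "p \<le> cond p" "p / (p - 1) \<le> cond p" using cond_bounds[OF p] by auto
  have kap: "(1 + 2 * G) powr \<bar>e\<bar> * (4 * cond p) \<le> condition_bound p n"
    unfolding G_def e_def by (rule condition_bound_aux[OF p n])
  have "0 < weight p n t s \<and> weight p n t s \<le> smoothed_dd p t' z
    \<and> smoothed_dd p t' z \<le> (1 + 2 * G) powr \<bar>e\<bar> * (4 * cond p) * weight p n t s"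
  proof (cases "2 \<le> p")
    case True
    have e: "0 \<le> e" "e \<le> 2" using True by (auto simp: e_def field_simps)
    have W: "weight p n t s = (p - 1) / 2 * m powr e"
    \<comment> \<open>At \<open>p = 2\<close> the sign is 0 and the weight contains
      \<open>max T S\<close> instead of \<open>m\<close>, but the exponent \<open>e\<close> is 0 as
      well.\<close>
    proof (cases "p = 2")
      case True
      hence "e = 0" by (simp add: e_def)
      moreover have "max T S \<noteq> 0" using T by simp
      ultimately show ?thesis using True m by (simp add: weight_def e_def[symmetric] T_def S_def)
    next
      case False
      thus ?thesis using True by (simp add: weight_def m_def rad T_def[symmetric] S_def[symmetric] e_def[symmetric])
    qed
    have "1 / 2 \<le> c powr 2" using c by simp
    also have "\<dots> \<le> c powr e" using c e by (intro powr_mono') auto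
    finally have ce: "1 / 2 \<le> c powr e" .
    have "1 / 2 * m powr e \<le> c powr e * m powr e" using ce by (intro mult_right_mono) auto
    also have "\<dots> \<le> X powr e" using X1 c m e by (simp flip: powr_mult) (intro powr_mono2, auto)
    finally have lo: "1 / 2 * m powr e \<le> X powr e" .
    have "(p - 1) / 2 * m powr e \<le> p / 2 * m powr e" by (intro mult_right_mono) auto
    also have "\<dots> \<le> p * X powr e" using mult_left_mono[OF lo, of p] p by simp
    also have "\<dots> \<le> smoothed_dd p t' z" using smoothed_dd_bounds(1)[OF p t'0(1) True, of z] by (simp add: Xeq)
    finally have 1: "weight p n t s \<le> smoothed_dd p t' z" unfolding W .
    have "X powr e \<le> ((1 + 2 * G) * m) powr e" using X0 X2 Mm e by (intro powr_mono2) auto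
    hence X3: "X powr e \<le> (1 + 2 * G) powr e * m powr e" by (simp add: powr_mult)
    have "smoothed_dd p t' z \<le> p * (p - 1) * X powr e" using smoothed_dd_bounds(2)[OF p t'0(1) True, of z] by (simp add: Xeq)
    also have "\<dots> \<le> p * (p - 1) * ((1 + 2 * G) powr e * m powr e)" using X3 p by (intro mult_left_mono) auto
    also have "\<dots> = (1 + 2 * G) powr e * (2 * p) * weight p n t s" unfolding W by (simp add: field_simps)
    also have "\<dots> \<le> (1 + 2 * G) powr e * (4 * cond p) * weight p n t s"
      using q p m unfolding W by (intro mult_right_mono mult_left_mono) auto
    finally have 2: "smoothed_dd p t' z \<le> (1 + 2 * G) powr e * (4 * cond p) * weight p n t s" .
    have ae: "\<bar>e\<bar> = e" using e by simp
    have "0 < weight p n t s" unfolding W using m p by (intro mult_pos_pos) auto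
    thus ?thesis using 1 2 unfolding ae by blast
  next
    case False
    hence p2: "p < 2" by simp
    have e: "e \<le> 0" "- 2 \<le> e" "\<bar>e\<bar> = - e" using p p2 by (auto simp: e_def field_simps)
    have W: "weight p n t s = (p - 1) / 2 * M powr e"
    proof -
      have "max T (S + G * T) = M" using M by (simp add: M_def max_def)
      thus ?thesis using p2 by (simp add: weight_def rad T_def[symmetric] S_def[symmetric] e_def[symmetric])
    qed
    have "(p - 1) / 2 \<le> p * (p - 1)" using mult_right_mono[of "1 / 2" p "p - 1"] p by simp
    hence "(p - 1) / 2 * M powr e \<le> p * (p - 1) * M powr e" by (intro mult_right_mono) auto
    also have "\<dots> \<le> p * (p - 1) * X powr e" using X0 X2 e p by (intro mult_left_mono powr_mono2') auto
    also have "\<dots> \<le> smoothed_dd p t' z" using smoothed_dd_bounds(3)[OF p t'0(1), of z] p2 by (simp add: Xeq)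
    finally have 1: "weight p n t s \<le> smoothed_dd p t' z" unfolding W .
    have ce: "c powr e \<le> 2"
    proof -
      have "c powr e \<le> c powr (- 2)" using c e by (intro powr_mono') auto
      also have "\<dots> = 1 / c\<^sup>2" using c by (simp add: powr_minus_divide)
      also have "\<dots> \<le> 2" using c by (simp add: divide_le_eq)
      finally show ?thesis .
    qed
    have "M / (1 + 2 * G) \<le> m" using Mm G by (simp add: divide_le_eq mult.commute)
    hence "m powr e \<le> (M / (1 + 2 * G)) powr e" using M G e by (intro powr_mono2') auto
    also have "\<dots> = (1 + 2 * G) powr (- e) * M powr e" using G by (simp add: powr_divide powr_minus_divide)
    finally have mM: "m powr e \<le> (1 + 2 * G) powr (- e) * M powr e" .
    have "X powr e \<le> (c * m) powr e" using X1 c m e by (intro powr_mono2') auto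
    also have "\<dots> = c powr e * m powr e" by (simp add: powr_mult)
    also have "\<dots> \<le> 2 * ((1 + 2 * G) powr (- e) * M powr e)" using ce mM by (intro mult_mono) auto
    finally have X3: "X powr e \<le> 2 * ((1 + 2 * G) powr (- e) * M powr e)" .
    have "smoothed_dd p t' z \<le> p * X powr e" using smoothed_dd_bounds(4)[OF p t'0(1), of z] p2 by (simp add: Xeq)
    also have "\<dots> \<le> p * (2 * ((1 + 2 * G) powr (- e) * M powr e))" using X3 p by (intro mult_left_mono) auto
    also have "\<dots> = (1 + 2 * G) powr (- e) * (4 * (p / (p - 1))) * weight p n t s" unfolding W using p by (simp add: field_simps)
    also have "\<dots> \<le> (1 + 2 * G) powr (- e) * (4 * cond p) * weight p n t s"
      using q p M unfolding W by (intro mult_right_mono mult_left_mono) auto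
    finally have 2: "smoothed_dd p t' z \<le> (1 + 2 * G) powr (- e) * (4 * cond p) * weight p n t s" .
    have "0 < weight p n t s" unfolding W using M p by (intro mult_pos_pos) auto
    thus ?thesis using 1 2 unfolding e(3) by blast
  qed
  moreover from this have "(1 + 2 * G) powr \<bar>e\<bar> * (4 * cond p) * weight p n t s \<le> condition_bound p n * weight p n t s"
    using kap by (intro mult_right_mono) auto
  ultimately show "0 < weight p n t s" "weight p n t s \<le> smoothed_dd p ((1 - step_h p) * t) z"
    "smoothed_dd p ((1 - step_h p) * t) z \<le> condition_bound p n * weight p n t s"
    unfolding t'_def by auto
qed

subsection \<open>Accelerated gradient descent\<close>

text \<open>One step of accelerated gradient descent, coordinatewise: with \<open>v = z + s (z - y)\<close> the two
  sides differ by \<open>(s - 1) / 2 * (z - y)\<^sup>2\<close>.\<close>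

lemma agd_coordinate:
  fixes s x y z g :: real
  assumes s: "1 \<le> s"
  defines "y' \<equiv> z - g / s\<^sup>2"
  defines "z' \<equiv> y' + (s - 1) / (s + 1) * (y' - y)"
  shows "1 / 2 * (z' + s * (z' - y') - x)\<^sup>2
    \<le> (1 - 1 / s) / 2 * (z + s * (z - y) - x)\<^sup>2 + 1 / (2 * s) * (z - x)\<^sup>2
      + 1 / s * (g * (x - z)) + (1 - 1 / s) * (g * (y - z)) + g\<^sup>2 / (2 * s\<^sup>2)"
proof -
  have v: "z' + s * (z' - y') = s * z - (s - 1) * y - g / s"
  proof -
    have "z' + s * (z' - y') = y' + (s + 1) * ((s - 1) / (s + 1)) * (y' - y)"
    proof -
      have "(y' + b * D) + s * ((y' + b * D) - y') = y' + (s + 1) * b * D" for b D by (simp add: algebra_simps)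
      thus ?thesis unfolding z'_def .
    qed
    also have "(s + 1) * ((s - 1) / (s + 1)) = s - 1" using s by simp
    also have "y' + (s - 1) * (y' - y) = s * y' - (s - 1) * y" by (simp add: algebra_simps)
    also have "s * y' = s * z - g / s" using s by (simp add: y'_def power2_eq_square right_diff_distrib)
    finally show ?thesis by simp
  qed
  define A where "A = s * z - (s - 1) * y - x"
  \<comment> \<open>Keeping \<open>k * s\<close> as a product reduces the claim to polynomial
    identities into which \<open>k * s = 1\<close> is substituted.\<close>
  define k where "k = 1 / s"
  have ks: "k * s = 1" using s by (simp add: k_def)
  have "(1 - 1 / s) / 2 * (z + s * (z - y) - x)\<^sup>2 + 1 / (2 * s) * (z - x)\<^sup>2
      + 1 / s * (g * (x - z)) + (1 - 1 / s) * (g * (y - z)) + g\<^sup>2 / (2 * s\<^sup>2)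
      - 1 / 2 * (s * z - (s - 1) * y - g / s - x)\<^sup>2
    = (1 - k) / 2 * (z + s * (z - y) - x)\<^sup>2 + k / 2 * (z - x)\<^sup>2 - 1 / 2 * A\<^sup>2
      + (k * g * (x - z) + (1 - k) * g * (y - z) + k * g * A)"
    by (simp add: A_def k_def power2_eq_square field_simps)
  also have "k * g * (x - z) + (1 - k) * g * (y - z) + k * g * A = (k * s - 1) * g * (z - y)"
    by (simp add: A_def algebra_simps)
  also have "\<dots> = 0" using ks by simp
  also have "(1 - k) / 2 * (z + s * (z - y) - x)\<^sup>2 + k / 2 * (z - x)\<^sup>2 - 1 / 2 * A\<^sup>2
     = (s - 1) / 2 * (z - y)\<^sup>2 * (1 + (1 - k * s)) - (1 - k * s) * (z - x) * (z - y) + 0 * k" (is "?L = _")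
  proof -
    have "?L = 1 / 2 * ((z + s * (z - y) - x)\<^sup>2 - A\<^sup>2) - k / 2 * ((z + s * (z - y) - x)\<^sup>2 - (z - x)\<^sup>2)"
      by (simp add: algebra_simps diff_divide_distrib)
    also have "(z + s * (z - y) - x)\<^sup>2 - A\<^sup>2 = (z - y) * (2 * (z - x) + (2 * s - 1) * (z - y))"
      by (simp add: A_def power2_eq_square algebra_simps)
    also have "(z + s * (z - y) - x)\<^sup>2 - (z - x)\<^sup>2 = s * (z - y) * (2 * (z - x) + s * (z - y))"
      by (simp add: power2_eq_square algebra_simps)
    also have "1 / 2 * ((z - y) * (2 * (z - x) + (2 * s - 1) * (z - y))) - k / 2 * (s * (z - y) * (2 * (z - x) + s * (z - y)))
       = 1 / 2 * ((z - y) * (2 * (z - x) + (2 * s - 1) * (z - y))) - (k * s) / 2 * ((z - y) * (2 * (z - x) + s * (z - y)))"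
      by (simp add: algebra_simps)
    finally show ?thesis unfolding ks by (simp add: power2_eq_square field_simps)
  qed
  also have "\<dots> = (s - 1) / 2 * (z - y)\<^sup>2" unfolding ks by simp
  finally have "(1 - 1 / s) / 2 * (z + s * (z - y) - x)\<^sup>2 + 1 / (2 * s) * (z - x)\<^sup>2
      + 1 / s * (g * (x - z)) + (1 - 1 / s) * (g * (y - z)) + g\<^sup>2 / (2 * s\<^sup>2)
      - 1 / 2 * (s * z - (s - 1) * y - g / s - x)\<^sup>2 = (s - 1) / 2 * (z - y)\<^sup>2" by simp
  moreover have "0 \<le> (s - 1) / 2 * (z - y)\<^sup>2" using s by simp
  ultimately show ?thesis unfolding v by linarith
qed

text \<open>Stated on a subspace \<open>V\<close> because in the application strong convexity is
  available only there. The potential \<open>Phi\<close> adds to the gap half the squared distance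
  of \<open>z + s * (z - y)\<close> to the minimiser; every step shrinks it by
  \<open>1 - 1 / s\<close>, with \<open>s = sqrt \<kappa>\<close>.\<close>

lemma agd_converges:
  fixes f :: "real Matrix.vec \<Rightarrow> real"
  assumes kappa: "1 \<le> \<kappa>" and delta: "0 < \<delta>" "\<delta> < 1 / 2"
    and V: "V \<subseteq> carrier_vec m"
    and lin: "\<And>y z a b. y \<in> V \<Longrightarrow> z \<in> V \<Longrightarrow> a \<cdot>\<^sub>v y + b \<cdot>\<^sub>v z \<in> V"
    and grad: "\<And>z. z \<in> V \<Longrightarrow> gradient f z \<in> V"
    and convex: "\<And>z w. z \<in> V \<Longrightarrow> w \<in> V \<Longrightarrow>
      f z + (\<Sum>j<m. gradient f z $ j * (w $ j - z $ j)) + 1 / 2 * (\<Sum>j<m. (w $ j - z $ j)\<^sup>2) \<le> f w"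
    and smooth: "\<And>z w. z \<in> V \<Longrightarrow> w \<in> V \<Longrightarrow>
      f w \<le> f z + (\<Sum>j<m. gradient f z $ j * (w $ j - z $ j)) + \<kappa> / 2 * (\<Sum>j<m. (w $ j - z $ j)\<^sup>2)"
    and x: "x \<in> V" "\<And>y. y \<in> V \<Longrightarrow> f x \<le> f y" and y0: "y0 \<in> V"
  shows "agd \<kappa> \<delta> f y0 \<in> V" "f (agd \<kappa> \<delta> f y0) - f x \<le> \<delta> * (f y0 - f x)"
proof -
  define s where "s = sqrt \<kappa>"
  have s: "1 \<le> s" "s\<^sup>2 = \<kappa>" using kappa by (auto simp: s_def)
  have dim: "dim_vec y = m" if "y \<in> V" for y using that V by auto
  have sub: "z - c \<cdot>\<^sub>v w \<in> V" if "z \<in> V" "w \<in> V" for z w c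
  proof -
    have "z - c \<cdot>\<^sub>v w = 1 \<cdot>\<^sub>v z + (- c) \<cdot>\<^sub>v w" using dim that by (intro eq_vecI) auto
    thus ?thesis using lin[OF that, of 1 "- c"] by simp
  qed
  have descent: "f (z - (1 / \<kappa>) \<cdot>\<^sub>v gradient f z) \<le> f z - (\<Sum>j<m. (gradient f z $ j)\<^sup>2) / (2 * \<kappa>)"
    if z: "z \<in> V" for z
  proof -
    define w where "w = z - (1 / \<kappa>) \<cdot>\<^sub>v gradient f z"
    have w: "w \<in> V" unfolding w_def using z grad by (intro sub) auto
    have wj: "w $ j - z $ j = - (gradient f z $ j / \<kappa>)" if "j < m" for j
      using that dim[OF z] dim[OF grad[OF z]] by (simp add: w_def)
    have "f w \<le> f z + (\<Sum>j<m. gradient f z $ j * (w $ j - z $ j)) + \<kappa> / 2 * (\<Sum>j<m. (w $ j - z $ j)\<^sup>2)"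
      by (rule smooth[OF z w])
    also have "\<dots> = f z + (\<Sum>j<m. gradient f z $ j * (w $ j - z $ j) + \<kappa> / 2 * (w $ j - z $ j)\<^sup>2)"
      by (simp add: sum.distrib sum_distrib_left)
    also have "(\<Sum>j<m. gradient f z $ j * (w $ j - z $ j) + \<kappa> / 2 * (w $ j - z $ j)\<^sup>2)
       = (\<Sum>j<m. - ((gradient f z $ j)\<^sup>2 / (2 * \<kappa>)))"
      using kappa by (intro sum.cong) (auto simp: wj power2_eq_square field_simps)
    also have "\<dots> = - ((\<Sum>j<m. (gradient f z $ j)\<^sup>2) / (2 * \<kappa>))"
      by (simp add: sum_negf sum_divide_distrib)
    finally show ?thesis by (simp add: w_def)
  qed
  define Phi where "Phi y z = f y - f x + 1 / 2 * (\<Sum>j<m. (z $ j + s * (z $ j - y $ j) - x $ j)\<^sup>2)" for y z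
  have step: "fst (agd_step \<kappa> f (y, z)) \<in> V \<and> snd (agd_step \<kappa> f (y, z)) \<in> V \<and>
     Phi (fst (agd_step \<kappa> f (y, z))) (snd (agd_step \<kappa> f (y, z))) \<le> (1 - 1 / s) * Phi y z"
    if yz: "y \<in> V" "z \<in> V" for y z
  proof -
    define g where "g = gradient f z"
    define y' where "y' = z - (1 / \<kappa>) \<cdot>\<^sub>v g"
    define z' where "z' = y' + ((s - 1) / (s + 1)) \<cdot>\<^sub>v (y' - y)"
    have st: "agd_step \<kappa> f (y, z) = (y', z')"
      by (simp add: agd_step_def Let_def y'_def z'_def g_def s_def)
    have g: "g \<in> V" unfolding g_def using yz grad by simp
    have y': "y' \<in> V" unfolding y'_def using yz g by (intro sub) auto
    have z': "z' \<in> V"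
    proof -
      have "y' - y = 1 \<cdot>\<^sub>v y' + (- 1) \<cdot>\<^sub>v y" using dim yz y' by (intro eq_vecI) auto
      hence yy: "y' - y \<in> V" using lin[OF y' yz(1), of 1 "- 1"] by simp
      have "z' = 1 \<cdot>\<^sub>v y' + ((s - 1) / (s + 1)) \<cdot>\<^sub>v (y' - y)" unfolding z'_def by simp
      thus ?thesis using lin[OF y' yy, of 1 "(s - 1) / (s + 1)"] by simp
    qed
    have yj: "y' $ j = z $ j - g $ j / s\<^sup>2" if "j < m" for j
      using that dim yz g s by (simp add: y'_def)
    have zj: "z' $ j = y' $ j + (s - 1) / (s + 1) * (y' $ j - y $ j)" if "j < m" for j
      using that dim yz y' by (simp add: z'_def)
    have "(\<Sum>j<m. 1 / 2 * (z' $ j + s * (z' $ j - y' $ j) - x $ j)\<^sup>2)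
      \<le> (\<Sum>j<m. (1 - 1 / s) / 2 * (z $ j + s * (z $ j - y $ j) - x $ j)\<^sup>2 + 1 / (2 * s) * (z $ j - x $ j)\<^sup>2
        + 1 / s * (g $ j * (x $ j - z $ j)) + (1 - 1 / s) * (g $ j * (y $ j - z $ j)) + (g $ j)\<^sup>2 / (2 * s\<^sup>2))"
    proof (rule sum_mono)
      fix j assume "j \<in> {..<m}"
      hence j: "j < m" by simp
      show "1 / 2 * (z' $ j + s * (z' $ j - y' $ j) - x $ j)\<^sup>2
        \<le> (1 - 1 / s) / 2 * (z $ j + s * (z $ j - y $ j) - x $ j)\<^sup>2 + 1 / (2 * s) * (z $ j - x $ j)\<^sup>2
        + 1 / s * (g $ j * (x $ j - z $ j)) + (1 - 1 / s) * (g $ j * (y $ j - z $ j)) + (g $ j)\<^sup>2 / (2 * s\<^sup>2)"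
        unfolding zj[OF j] yj[OF j] by (rule agd_coordinate[OF s(1)])
    qed
    hence sum: "1 / 2 * (\<Sum>j<m. (z' $ j + s * (z' $ j - y' $ j) - x $ j)\<^sup>2)
      \<le> (1 - 1 / s) * (1 / 2 * (\<Sum>j<m. (z $ j + s * (z $ j - y $ j) - x $ j)\<^sup>2)) + 1 / s * (1 / 2 * (\<Sum>j<m. (x $ j - z $ j)\<^sup>2))
        + 1 / s * (\<Sum>j<m. g $ j * (x $ j - z $ j)) + (1 - 1 / s) * (\<Sum>j<m. g $ j * (y $ j - z $ j))
        + (\<Sum>j<m. (g $ j)\<^sup>2) / (2 * \<kappa>)"
      by (simp add: sum.distrib sum_distrib_left sum_divide_distrib s power2_commute mult_ac)
    have s01: "0 \<le> 1 / s" "0 \<le> 1 - 1 / s" using s by auto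
    have "f z + (\<Sum>j<m. g $ j * (x $ j - z $ j)) + 1 / 2 * (\<Sum>j<m. (x $ j - z $ j)\<^sup>2) \<le> f x"
      unfolding g_def by (rule convex[OF yz(2) x(1)])
    hence c1: "1 / s * (f z + (\<Sum>j<m. g $ j * (x $ j - z $ j)) + 1 / 2 * (\<Sum>j<m. (x $ j - z $ j)\<^sup>2)) \<le> 1 / s * f x"
      using s01 by (intro mult_left_mono)
    have "f z + (\<Sum>j<m. g $ j * (y $ j - z $ j)) + 1 / 2 * (\<Sum>j<m. (y $ j - z $ j)\<^sup>2) \<le> f y"
      unfolding g_def by (rule convex[OF yz(2) yz(1)])
    moreover have "0 \<le> 1 / 2 * (\<Sum>j<m. (y $ j - z $ j)\<^sup>2)" by (simp add: sum_nonneg)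
    ultimately have "f z + (\<Sum>j<m. g $ j * (y $ j - z $ j)) \<le> f y" by linarith
    hence c2: "(1 - 1 / s) * (f z + (\<Sum>j<m. g $ j * (y $ j - z $ j))) \<le> (1 - 1 / s) * f y"
      using s01 by (intro mult_left_mono)
    have d: "f y' \<le> f z - (\<Sum>j<m. (g $ j)\<^sup>2) / (2 * \<kappa>)"
      unfolding y'_def g_def by (rule descent[OF yz(2)])
    \<comment> \<open>Convexity towards the minimiser, with weight \<open>1 / s\<close>, and towards
      \<open>y\<close>, with weight \<open>1 - 1 / s\<close>, are added; the descent of the gradient
      step cancels the squared gradient left by \<open>agd_coordinate\<close>.\<close>
    have comb: "F' - X + B' \<le> (1 - k) * (F - X + B)"
      if "B' \<le> (1 - k) * B + k * Q + k * S + (1 - k) * R + G" "k * (Z + S + Q) \<le> k * X"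
        "(1 - k) * (Z + R) \<le> (1 - k) * F" "F' \<le> Z - G"
      for F' X B' k F B Q S R G Z :: real
      using that by (simp add: algebra_simps)
    have "Phi y' z' \<le> (1 - 1 / s) * Phi y z"
      unfolding Phi_def by (rule comb[OF sum c1 c2 d])
    thus ?thesis using y' z' by (simp add: st)
  qed
  have iter: "fst ((agd_step \<kappa> f ^^ k) (y0, y0)) \<in> V \<and> snd ((agd_step \<kappa> f ^^ k) (y0, y0)) \<in> V \<and>
     Phi (fst ((agd_step \<kappa> f ^^ k) (y0, y0))) (snd ((agd_step \<kappa> f ^^ k) (y0, y0))) \<le> (1 - 1 / s) ^ k * Phi y0 y0" for k
  proof (induction k)
    case 0
    thus ?case using y0 by simp
  next
    case (Suc k)
    obtain y z where yz: "(agd_step \<kappa> f ^^ k) (y0, y0) = (y, z)" by (metis surj_pair)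
    have IH: "y \<in> V" "z \<in> V" "Phi y z \<le> (1 - 1 / s) ^ k * Phi y0 y0" using Suc yz by auto
    have "(1 - 1 / s) * Phi y z \<le> (1 - 1 / s) * ((1 - 1 / s) ^ k * Phi y0 y0)"
      using IH(3) s by (intro mult_left_mono) auto
    thus ?case using step[OF IH(1,2)] by (simp add: yz mult.assoc)
  qed
  define n where "n = agd_iterations \<kappa> \<delta>"
  have out: "agd \<kappa> \<delta> f y0 = fst ((agd_step \<kappa> f ^^ n) (y0, y0))" by (simp add: agd_def n_def)
  show "agd \<kappa> \<delta> f y0 \<in> V" unfolding out using iter by simp
  \<comment> \<open>A gradient step from the minimiser stays in \<open>V\<close> and cannot decrease
    \<open>f\<close>, so by \<open>descent\<close> the gradient vanishes.\<close>
  have gx: "gradient f x $ j = 0" if "j < m" for j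
  proof -
    have "f x \<le> f x - (\<Sum>j<m. (gradient f x $ j)\<^sup>2) / (2 * \<kappa>)"
      using x(2)[OF sub[OF x(1) grad[OF x(1)], of "1 / \<kappa>"]] descent[OF x(1)] by linarith
    hence "(\<Sum>j<m. (gradient f x $ j)\<^sup>2) \<le> 0" using kappa by (simp add: divide_le_0_iff)
    moreover have "0 \<le> (\<Sum>j<m. (gradient f x $ j)\<^sup>2)" by (simp add: sum_nonneg)
    ultimately have "(\<Sum>j<m. (gradient f x $ j)\<^sup>2) = 0" by linarith
    hence "\<forall>j\<in>{..<m}. (gradient f x $ j)\<^sup>2 = 0" by (subst (asm) sum_nonneg_eq_0_iff) auto
    thus ?thesis using that by simp
  qed
  have "f x + 1 / 2 * (\<Sum>j<m. (y0 $ j - x $ j)\<^sup>2) \<le> f y0"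
    using convex[OF x(1) y0] by (simp add: gx)
  hence Phi0: "Phi y0 y0 \<le> 2 * (f y0 - f x)" by (simp add: Phi_def)
  have gap0: "0 \<le> f y0 - f x" using x(2)[OF y0] by simp
  have ratio: "2 \<le> \<kappa> / \<delta>"
  proof -
    have "1 / (1 / 2) \<le> \<kappa> / \<delta>" using kappa delta by (intro frac_le) auto
    thus ?thesis by simp
  qed
  \<comment> \<open>The factor 2 in \<open>agd_iterations\<close> gives
    \<open>\<delta>\<^sup>2\<close>, and \<open>\<delta> < 1 / 2\<close> turns it into
    \<open>\<delta> / 2\<close>, which compensates
    \<open>Phi y0 y0 \<le> 2 * (f y0 - f x)\<close>.\<close>
  have "(1 - 1 / s) ^ n \<le> exp (- (1 / s)) ^ n"
    using s exp_ge_add_one_self[of "- (1 / s)"] by (intro power_mono) auto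
  also have "\<dots> = exp (- (real n / s))" by (simp add: exp_of_nat_mult[symmetric])
  also have "\<dots> \<le> exp (- (2 * ln (\<kappa> / \<delta>)))"
  proof -
    have "2 * s * ln (\<kappa> / \<delta>) \<le> real n" unfolding n_def agd_iterations_def s_def by linarith
    hence "2 * ln (\<kappa> / \<delta>) \<le> real n / s" using s by (simp add: le_divide_eq mult_ac)
    thus ?thesis by simp
  qed
  also have "\<dots> = (\<delta> / \<kappa>)\<^sup>2"
  proof -
    have "exp (- (2 * ln (\<kappa> / \<delta>))) = inverse (exp (ln (\<kappa> / \<delta>)) * exp (ln (\<kappa> / \<delta>)))"
      by (simp add: exp_minus exp_add[symmetric])
    also have "exp (ln (\<kappa> / \<delta>)) = \<kappa> / \<delta>" using ratio by simp
    finally show ?thesis by (simp add: power2_eq_square)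
  qed
  also have "\<dots> \<le> \<delta>\<^sup>2" using kappa delta by (intro power_mono) (auto simp: divide_le_eq)
  also have "\<dots> \<le> \<delta> / 2" using delta by (simp add: power2_eq_square)
  finally have rate: "(1 - 1 / s) ^ n \<le> \<delta> / 2" .
  have "0 \<le> Phi y0 y0" unfolding Phi_def using gap0 by (intro add_nonneg_nonneg mult_nonneg_nonneg sum_nonneg) auto
  hence "(1 - 1 / s) ^ n * Phi y0 y0 \<le> \<delta> / 2 * (2 * (f y0 - f x))"
    using rate Phi0 delta by (intro mult_mono) auto
  also have "\<dots> = \<delta> * (f y0 - f x)" by simp
  finally have "(1 - 1 / s) ^ n * Phi y0 y0 \<le> \<delta> * (f y0 - f x)" .
  moreover have "f (agd \<kappa> \<delta> f y0) - f x \<le> Phi (fst ((agd_step \<kappa> f ^^ n) (y0, y0))) (snd ((agd_step \<kappa> f ^^ n) (y0, y0)))"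
    unfolding Phi_def out by (simp add: sum_nonneg)
  ultimately show "f (agd \<kappa> \<delta> f y0) - f x \<le> \<delta> * (f y0 - f x)" using iter[of n] by linarith
qed

subsection \<open>Composite objectives\<close>

text \<open>The common form of the target, of the smoothed objectives and, after
  \<open>x = P *\<^sub>v y\<close>, of the phase objectives, so that gradients, minimisers and
  Bregman distances are treated once.\<close>

definition composite ::
  "real Matrix.mat \<Rightarrow> real Matrix.vec \<Rightarrow> real Matrix.vec \<Rightarrow> (nat \<Rightarrow> real \<Rightarrow> real) \<Rightarrow> real Matrix.vec \<Rightarrow> real"
where
  "composite A b c L x = c \<bullet> x + (\<Sum>i<dim_row A. L i (residual A b x $ i))"

text \<open>The gradient in \<open>x\<close> if \<open>L' i\<close> is the derivative of
  \<open>L i\<close>. Being explicit, it lets stationarity pass between losses whose derivatives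
  agree at the residual.\<close>

definition loss_gradient ::
  "real Matrix.mat \<Rightarrow> real Matrix.vec \<Rightarrow> real Matrix.vec \<Rightarrow> (nat \<Rightarrow> real \<Rightarrow> real) \<Rightarrow> real Matrix.vec \<Rightarrow> real Matrix.vec"
where
  "loss_gradient A b c L' x =
     transpose_mat A *\<^sub>v Matrix.vec (dim_row A) (\<lambda>i. L' i (residual A b x $ i)) + c"

lemma residual_carrier:
  assumes "A \<in> carrier_mat n d" "b \<in> carrier_vec n"
  shows "residual A b x \<in> carrier_vec n"
  using assms by (auto simp: residual_def intro: carrier_vecI)

lemma residual_index:
  assumes "A \<in> carrier_mat n d" "b \<in> carrier_vec n" "i < n"
  shows "residual A b x $ i = (A *\<^sub>v x) $ i - b $ i"
  using assms by (simp add: residual_def)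

lemma residual_add:
  assumes A: "A \<in> carrier_mat n d" and b: "b \<in> carrier_vec n" and i: "i < n"
    and x: "x \<in> carrier_vec d" and v: "v \<in> carrier_vec d"
  shows "residual A b (x + r \<cdot>\<^sub>v v) $ i = residual A b x $ i + r * (A *\<^sub>v v) $ i"
proof -
  have rv: "r \<cdot>\<^sub>v v \<in> carrier_vec d" using v by simp
  have "A *\<^sub>v (x + r \<cdot>\<^sub>v v) = A *\<^sub>v x + r \<cdot>\<^sub>v (A *\<^sub>v v)"
    unfolding mult_add_distrib_mat_vec[OF A x rv] mult_mat_vec[OF A v] ..
  thus ?thesis unfolding residual_index[OF A b i] using A i by simp
qed

lemma loss_gradient_carrier:
  assumes "A \<in> carrier_mat n d" "c \<in> carrier_vec d"
  shows "loss_gradient A b c L' x \<in> carrier_vec d"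
  using assms by (auto simp: loss_gradient_def intro: carrier_vecI)

lemma loss_gradient_scalar_prod:
  assumes A: "A \<in> carrier_mat n d" and c: "c \<in> carrier_vec d" and v: "v \<in> carrier_vec d"
  shows "loss_gradient A b c L' x \<bullet> v = c \<bullet> v + (\<Sum>i<n. L' i (residual A b x $ i) * (A *\<^sub>v v) $ i)"
proof -
  define w where "w = Matrix.vec n (\<lambda>i. L' i (residual A b x $ i))"
  have w: "w \<in> carrier_vec n" by (simp add: w_def)
  have dA: "dim_row A = n" "dim_col A = d" using A by auto
  have Tw: "transpose_mat A *\<^sub>v w \<in> carrier_vec d" using A by (auto intro: carrier_vecI)
  have "(transpose_mat A *\<^sub>v w) \<bullet> v = w \<bullet> (A *\<^sub>v v)"
    by (rule scalar_prod_mult_mat_vec[symmetric]) (use w v dA in auto)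
  also have "\<dots> = (\<Sum>i<n. L' i (residual A b x $ i) * (A *\<^sub>v v) $ i)"
    using dA by (simp add: scalar_prod_def w_def atLeast0LessThan)
  finally show ?thesis
    unfolding loss_gradient_def dA w_def[symmetric] using add_scalar_prod_distrib[OF Tw c v] by simp
qed

text \<open>A linear term has no Bregman distance, so only the residual coordinates contribute. At a
  stationary point the left side is the gap in value, which then bounds every coordinate if the
  summands are nonnegative.\<close>

lemma composite_bregman:
  assumes A: "A \<in> carrier_mat n d" and b: "b \<in> carrier_vec n" and c: "c \<in> carrier_vec d"
    and x: "x \<in> carrier_vec d" and y: "y \<in> carrier_vec d"
  shows "composite A b c L y - composite A b c L x - loss_gradient A b c L' x \<bullet> (y - x)
    = (\<Sum>i<n. L i (residual A b y $ i) - L i (residual A b x $ i)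
        - L' i (residual A b x $ i) * (residual A b y $ i - residual A b x $ i))"
proof -
  have dA: "dim_row A = n" using A by auto
  have yx: "y - x \<in> carrier_vec d" using x y by simp
  have r: "(A *\<^sub>v (y - x)) $ i = residual A b y $ i - residual A b x $ i" if i: "i < n" for i
    using i A by (simp only: mult_minus_distrib_mat_vec[OF A y x] residual_index[OF A b i]) simp
  have "loss_gradient A b c L' x \<bullet> (y - x) = c \<bullet> (y - x)
     + (\<Sum>i<n. L' i (residual A b x $ i) * (residual A b y $ i - residual A b x $ i))"
    unfolding loss_gradient_scalar_prod[OF A c yx] using r by simp
  moreover have "c \<bullet> (y - x) = c \<bullet> y - c \<bullet> x" by (rule scalar_prod_minus_distrib[OF c y x])
  ultimately show ?thesis by (simp add: composite_def dA sum_subtractf)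
qed

lemma composite_line_deriv:
  assumes A: "A \<in> carrier_mat n d" and b: "b \<in> carrier_vec n" and c: "c \<in> carrier_vec d"
    and x: "x \<in> carrier_vec d" and v: "v \<in> carrier_vec d"
    and der: "\<And>i s. i < n \<Longrightarrow> (L i has_real_derivative L' i s) (at s)"
  shows "((\<lambda>r. composite A b c L (x + r \<cdot>\<^sub>v v)) has_real_derivative (loss_gradient A b c L' x \<bullet> v)) (at 0)"
proof -
  have dA: "dim_row A = n" using A by auto
  have rv: "r \<cdot>\<^sub>v v \<in> carrier_vec d" for r using v by simp
  have "composite A b c L (x + r \<cdot>\<^sub>v v)
    = c \<bullet> x + r * (c \<bullet> v) + (\<Sum>i<n. L i (residual A b x $ i + r * (A *\<^sub>v v) $ i))" for r
    unfolding composite_def dA scalar_prod_add_distrib[OF c x rv] scalar_prod_smult_distrib[OF c v]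
    using residual_add[OF A b _ x v] by simp
  moreover have "((\<lambda>r. c \<bullet> x + r * (c \<bullet> v) + (\<Sum>i<n. L i (residual A b x $ i + r * (A *\<^sub>v v) $ i)))
    has_real_derivative (0 + 1 * (c \<bullet> v) + (\<Sum>i<n. L' i (residual A b x $ i) * (A *\<^sub>v v) $ i))) (at 0)"
  proof (intro DERIV_add DERIV_sum DERIV_const DERIV_cmult_right DERIV_ident)
    fix i assume "i \<in> {..<n}"
    hence i: "i < n" by simp
    have 1: "(L i has_real_derivative L' i (residual A b x $ i)) (at (residual A b x $ i + 0 * (A *\<^sub>v v) $ i))"
      using der[OF i, of "residual A b x $ i"] by simp
    have 2: "((\<lambda>r. residual A b x $ i + r * (A *\<^sub>v v) $ i) has_real_derivative (A *\<^sub>v v) $ i) (at 0)"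
      by (auto intro!: derivative_eq_intros)
    show "((\<lambda>r. L i (residual A b x $ i + r * (A *\<^sub>v v) $ i)) has_real_derivative
        L' i (residual A b x $ i) * (A *\<^sub>v v) $ i) (at 0)"
      using DERIV_chain2[OF 1 2] .
  qed
  ultimately show ?thesis unfolding loss_gradient_scalar_prod[OF A c v] by simp
qed

lemma composite_minimiser_stationary:
  assumes A: "A \<in> carrier_mat n d" and b: "b \<in> carrier_vec n" and c: "c \<in> carrier_vec d"
    and x: "x \<in> carrier_vec d" and der: "\<And>i s. i < n \<Longrightarrow> (L i has_real_derivative L' i s) (at s)"
    and min: "\<And>y. y \<in> carrier_vec d \<Longrightarrow> composite A b c L x \<le> composite A b c L y"
  shows "loss_gradient A b c L' x = 0\<^sub>v d"
proof (rule eq_vecI)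
  note lc = loss_gradient_carrier[OF A c, of b L' x]
  show "dim_vec (loss_gradient A b c L' x) = dim_vec (0\<^sub>v d)" using lc by simp
  fix j assume "j < dim_vec (0\<^sub>v d)"
  hence j: "j < d" by simp
  have x0: "x + 0 \<cdot>\<^sub>v unit_vec d j = x" using x by (intro eq_vecI) auto
  have "loss_gradient A b c L' x \<bullet> unit_vec d j = 0"
  proof (rule DERIV_local_min[OF composite_line_deriv[OF A b c x _ der]])
    show "\<forall>y. \<bar>0 - y\<bar> < 1 \<longrightarrow> composite A b c L (x + 0 \<cdot>\<^sub>v unit_vec d j) \<le> composite A b c L (x + y \<cdot>\<^sub>v unit_vec d j)"
      unfolding x0 using min x by simp
  qed auto
  thus "loss_gradient A b c L' x $ j = 0\<^sub>v d $ j" using lc j by simp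
qed

lemma composite_precond_gradient:
  assumes A: "A \<in> carrier_mat n d" and b: "b \<in> carrier_vec n" and c: "c \<in> carrier_vec d"
    and P: "P \<in> carrier_mat d m" and y: "y \<in> carrier_vec m"
    and der: "\<And>i s. i < n \<Longrightarrow> (L i has_real_derivative L' i s) (at s)"
  shows "gradient (\<lambda>y. composite A b c L (P *\<^sub>v y)) y = transpose_mat P *\<^sub>v loss_gradient A b c L' (P *\<^sub>v y)"
proof (rule eq_vecI)
  show "dim_vec (gradient (\<lambda>y. composite A b c L (P *\<^sub>v y)) y) = dim_vec (transpose_mat P *\<^sub>v loss_gradient A b c L' (P *\<^sub>v y))"
    using P y by (simp add: gradient_def)
  fix j assume "j < dim_vec (transpose_mat P *\<^sub>v loss_gradient A b c L' (P *\<^sub>v y))"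
  hence j: "j < m" using P by simp
  have Py: "P *\<^sub>v y \<in> carrier_vec d" and pj: "col P j \<in> carrier_vec d" using P y j by (auto intro: carrier_vecI)
  note lc = loss_gradient_carrier[OF A c, of b L' "P *\<^sub>v y"]
  have "P *\<^sub>v (y + r \<cdot>\<^sub>v unit_vec m j) = P *\<^sub>v y + r \<cdot>\<^sub>v col P j" for r
  proof -
    have u: "unit_vec m j \<in> carrier_vec m" by simp
    hence ru: "r \<cdot>\<^sub>v unit_vec m j \<in> carrier_vec m" by simp
    show ?thesis
      unfolding mult_add_distrib_mat_vec[OF P y ru] mult_mat_vec[OF P u] mult_mat_unit_vec[OF P j] ..
  qed
  moreover have "deriv (\<lambda>r. composite A b c L (P *\<^sub>v y + r \<cdot>\<^sub>v col P j)) 0 = loss_gradient A b c L' (P *\<^sub>v y) \<bullet> col P j"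
    by (rule DERIV_imp_deriv[OF composite_line_deriv[OF A b c Py pj der]])
  moreover have "loss_gradient A b c L' (P *\<^sub>v y) \<bullet> col P j = (transpose_mat P *\<^sub>v loss_gradient A b c L' (P *\<^sub>v y)) $ j"
    using P j lc pj comm_scalar_prod[OF lc pj] by simp
  ultimately show "gradient (\<lambda>y. composite A b c L (P *\<^sub>v y)) y $ j
      = (transpose_mat P *\<^sub>v loss_gradient A b c L' (P *\<^sub>v y)) $ j"
    using y j by (simp add: gradient_def)
qed

section \<open>Existence of minimisers\<close>

lemma ker_perp_projection:
  assumes A: "A \<in> carrier_mat n d"
  shows "x \<in> carrier_vec d \<Longrightarrow> pinv A *\<^sub>v (A *\<^sub>v x) \<in> ker_perp A"
    and "x \<in> carrier_vec d \<Longrightarrow> A *\<^sub>v (pinv A *\<^sub>v (A *\<^sub>v x)) = A *\<^sub>v x"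
    and "c \<in> ker_perp A \<Longrightarrow> c = transpose_mat A *\<^sub>v (transpose_mat (pinv A) *\<^sub>v c)"
proof -
  have dA[simp]: "dim_row A = n" "dim_col A = d" using A by auto
  have sym: "pinv A * A = transpose_mat A * transpose_mat (pinv A)"
    using pinv_eqs(4)[of A] by (simp add: mat_transpose_mult)
  have AXA: "A *\<^sub>v (pinv A *\<^sub>v (A *\<^sub>v x)) = A *\<^sub>v x" if "x \<in> carrier_vec d" for x
    using arg_cong[OF pinv_eqs(1)[of A], of "\<lambda>M. M *\<^sub>v x"] that by (simp add: mat_vec_assoc)
  have eq: "pinv A *\<^sub>v (A *\<^sub>v x) = transpose_mat A *\<^sub>v (transpose_mat (pinv A) *\<^sub>v x)" if "x \<in> carrier_vec d" for x
    using arg_cong[OF sym, of "\<lambda>M. M *\<^sub>v x"] that by (simp add: mat_vec_assoc)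
  have rng: "pinv A *\<^sub>v (A *\<^sub>v x) \<in> ker_perp A" if "x \<in> carrier_vec d" for x
    unfolding eq[OF that] by (rule transpose_mult_in_ker_perp) (auto intro: carrier_vecI)
  show "x \<in> carrier_vec d \<Longrightarrow> pinv A *\<^sub>v (A *\<^sub>v x) \<in> ker_perp A" by (rule rng)
  show "x \<in> carrier_vec d \<Longrightarrow> A *\<^sub>v (pinv A *\<^sub>v (A *\<^sub>v x)) = A *\<^sub>v x" by (rule AXA)
  assume c: "c \<in> ker_perp A"
  hence cd: "c \<in> carrier_vec d" using ker_perp_carrier[OF c] by simp
  have Xc: "pinv A *\<^sub>v (A *\<^sub>v c) \<in> carrier_vec d" by (intro carrier_vecI) simp
  have k: "c - pinv A *\<^sub>v (A *\<^sub>v c) \<in> ker_perp A" by (rule ker_perp_diff[OF c rng[OF cd]])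
  have "A *\<^sub>v (c - pinv A *\<^sub>v (A *\<^sub>v c)) = A *\<^sub>v c - A *\<^sub>v c"
    unfolding mult_minus_distrib_mat_vec[OF A cd Xc] AXA[OF cd] ..
  also have "\<dots> = 0\<^sub>v (dim_row A)" by (intro eq_vecI) auto
  finally have "c - pinv A *\<^sub>v (A *\<^sub>v c) = 0\<^sub>v d" using ker_perp_kernel_0[OF k] by simp
  hence "c = pinv A *\<^sub>v (A *\<^sub>v c)" by (rule vec_diff_eq_0[OF cd Xc])
  thus "c = transpose_mat A *\<^sub>v (transpose_mat (pinv A) *\<^sub>v c)" unfolding eq[OF cd] .
qed

text \<open>As \<open>c\<close> lies in the range of the transpose of \<open>A\<close>, the linear
  term too is a function of the residual; the objective is therefore constant along the kernel of
  \<open>A\<close> and separates over residual coordinates.\<close>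

lemma composite_via_residual:
  assumes A: "A \<in> carrier_mat n d" and b: "b \<in> carrier_vec n" and c: "c \<in> ker_perp A"
    and x: "x \<in> carrier_vec d"
  defines "w \<equiv> transpose_mat (pinv A) *\<^sub>v c"
  shows "composite A b c L x = w \<bullet> b + (\<Sum>i<n. w $ i * residual A b x $ i + L i (residual A b x $ i))"
proof -
  have dA: "dim_row A = n" "dim_col A = d" using A by auto
  have w: "w \<in> carrier_vec n" unfolding w_def by (intro carrier_vecI) (simp add: dA)
  have "c \<bullet> x = (transpose_mat A *\<^sub>v w) \<bullet> x" using ker_perp_projection(3)[OF A c] by (simp add: w_def)
  also have "\<dots> = w \<bullet> (A *\<^sub>v x)" by (rule scalar_prod_mult_mat_vec[symmetric]) (use w x dA in auto)
  also have "\<dots> = (\<Sum>i<n. w $ i * (A *\<^sub>v x) $ i)" using dA by (simp add: scalar_prod_def atLeast0LessThan)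
  also have "\<dots> = (\<Sum>i<n. w $ i * b $ i + w $ i * residual A b x $ i)"
    by (intro sum.cong) (auto simp: residual_index[OF A b] algebra_simps)
  also have "\<dots> = w \<bullet> b + (\<Sum>i<n. w $ i * residual A b x $ i)"
    using b by (simp add: sum.distrib scalar_prod_def atLeast0LessThan)
  finally show ?thesis by (simp add: composite_def dA sum.distrib)
qed

text \<open>Superlinear growth bounds the residual on a sublevel set, but not the kernel component
  of \<open>x\<close>; projecting by \<open>pinv A * A\<close> keeps the value and bounds the
  coordinates. Minimising over a box of coordinates and projecting the result yields a global
  minimiser in \<open>ker_perp A\<close>.\<close>

lemma composite_minimiser_exists:
  assumes A: "A \<in> carrier_mat n d" and b: "b \<in> carrier_vec n" and c: "c \<in> ker_perp A"
    and cont: "\<And>i. i < n \<Longrightarrow> continuous_on UNIV (L i)"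
    and coercive: "\<And>i M. i < n \<Longrightarrow> \<exists>K. \<forall>s. M * \<bar>s\<bar> - K \<le> L i s"
  shows "\<exists>x\<in>ker_perp A. \<forall>y\<in>carrier_vec d. composite A b c L x \<le> composite A b c L y"
proof -
  have dA: "dim_row A = n" "dim_col A = d" using A by auto
  define w where "w = transpose_mat (pinv A) *\<^sub>v c"
  note comp = composite_via_residual[OF A b c, folded w_def]
  \<comment> \<open>Growth with slope \<open>\<bar>w $ i\<bar> + 1\<close> beats the linear term and
    leaves \<open>\<bar>s\<bar>\<close> over.\<close>
  have "\<forall>i\<in>{..<n}. \<exists>K. \<forall>s. (\<bar>w $ i\<bar> + 1) * \<bar>s\<bar> - K \<le> L i s" using coercive by auto
  then obtain K where K: "\<And>i s. i < n \<Longrightarrow> (\<bar>w $ i\<bar> + 1) * \<bar>s\<bar> - K i \<le> L i s" by (auto simp: bchoice_iff)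
  have low: "\<bar>s\<bar> - K i \<le> w $ i * s + L i s" if "i < n" for i s
  proof -
    have "- (\<bar>w $ i\<bar> * \<bar>s\<bar>) \<le> w $ i * s" by (simp flip: abs_mult)
    thus ?thesis using K[OF that, of s] by (simp add: algebra_simps)
  qed
  have z: "0\<^sub>v d \<in> carrier_vec d" by simp
  define R where "R = composite A b c L (0\<^sub>v d) - w \<bullet> b + (\<Sum>i<n. K i)"
  have resid: "\<bar>residual A b x $ i\<bar> \<le> R"
    if x: "x \<in> carrier_vec d" "composite A b c L x \<le> composite A b c L (0\<^sub>v d)" and i: "i < n" for x i
  proof -
    have "\<bar>residual A b x $ i\<bar> \<le> (\<Sum>i<n. \<bar>residual A b x $ i\<bar>)" using i by (intro member_le_sum) auto
    also have "\<dots> \<le> (\<Sum>i<n. (w $ i * residual A b x $ i + L i (residual A b x $ i)) + K i)"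
    proof (rule sum_mono)
      fix i assume "i \<in> {..<n}"
      thus "\<bar>residual A b x $ i\<bar> \<le> (w $ i * residual A b x $ i + L i (residual A b x $ i)) + K i"
        using low[of i "residual A b x $ i"] by simp
    qed
    also have "\<dots> = composite A b c L x - w \<bullet> b + (\<Sum>i<n. K i)" using comp[OF x(1)] by (simp add: sum.distrib)
    finally show ?thesis using x(2) by (simp add: R_def)
  qed
  define Q where "Q j = (\<Sum>i<n. \<bar>pinv A $$ (j, i)\<bar> * (R + \<bar>b $ i\<bar>))" for j
  have bound: "\<bar>(pinv A *\<^sub>v (A *\<^sub>v x)) $ j\<bar> \<le> Q j"
    if x: "x \<in> carrier_vec d" "composite A b c L x \<le> composite A b c L (0\<^sub>v d)" and j: "j < d" for x j
  proof -
    have "(pinv A *\<^sub>v (A *\<^sub>v x)) $ j = (\<Sum>i<n. pinv A $$ (j, i) * (A *\<^sub>v x) $ i)"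
      using j dA by (simp add: scalar_prod_def atLeast0LessThan)
    also have "\<bar>\<dots>\<bar> \<le> (\<Sum>i<n. \<bar>pinv A $$ (j, i) * (A *\<^sub>v x) $ i\<bar>)" by (rule sum_abs)
    also have "\<dots> \<le> Q j" unfolding Q_def
    proof (rule sum_mono)
      fix i assume "i \<in> {..<n}"
      hence i: "i < n" by simp
      have "\<bar>(A *\<^sub>v x) $ i\<bar> \<le> R + \<bar>b $ i\<bar>" using resid[OF x i] unfolding residual_index[OF A b i] by linarith
      thus "\<bar>pinv A $$ (j, i) * (A *\<^sub>v x) $ i\<bar> \<le> \<bar>pinv A $$ (j, i)\<bar> * (R + \<bar>b $ i\<bar>)"
        unfolding abs_mult by (intro mult_left_mono) auto
    qed
    finally show ?thesis .
  qed
  \<comment> \<open>The box lives in a function space with the product topology, coordinates from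
    \<open>d\<close> on being fixed to 0, so that compactness is Tychonoff's theorem.\<close>
  define S where "S = PiE UNIV (\<lambda>j. if j < d then {- (\<bar>Q j\<bar>) .. \<bar>Q j\<bar>} else {0 :: real})"
  define F where "F f = composite A b c L (Matrix.vec d f)" for f
  have "compactin (product_topology (\<lambda>j. euclidean) UNIV) S"
    unfolding S_def compactin_PiE by (auto simp: compactin_euclidean_iff)
  hence comp_S: "compact S" by (simp add: euclidean_product_topology compactin_euclidean_iff)
  have F_eq: "F f = (\<Sum>j<d. c $ j * f j) + (\<Sum>i<n. L i ((\<Sum>j<d. A $$ (i, j) * f j) - b $ i))" for f
    using A b by (simp add: F_def composite_def residual_def scalar_prod_def atLeast0LessThan)
  have contF: "continuous_on S F"
    unfolding F_eq[abs_def]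
  proof (intro continuous_intros)
    fix i assume "i \<in> {..<n}"
    hence i: "i < n" by simp
    show "continuous_on S (\<lambda>f. L i ((\<Sum>j<d. A $$ (i, j) * f j) - b $ i))"
      by (rule continuous_on_compose2[OF cont[OF i]])
        (auto intro!: continuous_intros continuous_on_subset[OF continuous_on_product_coordinates])
  qed (auto intro!: continuous_on_subset[OF continuous_on_product_coordinates])
  have "(\<lambda>j. 0) \<in> S" by (auto simp: S_def PiE_def)
  then obtain f where f: "f \<in> S" "\<And>g. g \<in> S \<Longrightarrow> F f \<le> F g"
    using continuous_attains_inf[OF comp_S _ contF] by blast
  define x where "x = Matrix.vec d f"
  have x: "x \<in> carrier_vec d" by (simp add: x_def)
  have x0: "composite A b c L x \<le> composite A b c L (0\<^sub>v d)"
  proof -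
    have "0\<^sub>v d = Matrix.vec d (\<lambda>j. 0 :: real)" by (intro eq_vecI) auto
    thus ?thesis using f(2)[OF \<open>(\<lambda>j. 0) \<in> S\<close>] by (simp add: F_def x_def)
  qed
  have proj: "composite A b c L (pinv A *\<^sub>v (A *\<^sub>v y)) = composite A b c L y" if y: "y \<in> carrier_vec d" for y
  proof -
    have Xy: "pinv A *\<^sub>v (A *\<^sub>v y) \<in> carrier_vec d" by (intro carrier_vecI) (simp add: dA)
    have "residual A b (pinv A *\<^sub>v (A *\<^sub>v y)) = residual A b y"
      unfolding residual_def ker_perp_projection(2)[OF A y] ..
    thus ?thesis unfolding comp[OF Xy] comp[OF y] by simp
  qed
  have min: "composite A b c L x \<le> composite A b c L y" if y: "y \<in> carrier_vec d" for y
  proof (cases "composite A b c L y \<le> composite A b c L (0\<^sub>v d)")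
    case False
    thus ?thesis using x0 by simp
  next
    case True
    define y' where "y' = pinv A *\<^sub>v (A *\<^sub>v y)"
    have y': "y' \<in> carrier_vec d" unfolding y'_def by (intro carrier_vecI) (simp add: dA)
    define g where "g j = (if j < d then y' $ j else 0)" for j
    have "g \<in> S" using bound[OF y True] by (force simp: S_def PiE_def g_def y'_def abs_le_iff)
    hence "F f \<le> F g" by (rule f(2))
    moreover have "Matrix.vec d g = y'" using y' by (intro eq_vecI) (auto simp: g_def)
    ultimately show ?thesis using proj[OF y] by (simp add: F_def x_def y'_def)
  qed
  show ?thesis
    using ker_perp_projection(1)[OF A x] min proj[OF x] by (intro bexI[of _ "pinv A *\<^sub>v (A *\<^sub>v x)"]) auto
qed

lemma powr_coercive:
  fixes p M :: real
  assumes p: "1 < p"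
  shows "\<exists>K. \<forall>s. M * \<bar>s\<bar> - K \<le> \<bar>s\<bar> powr p"
proof -
  define N where "N = max M 0"
  define r where "r = N powr (1 / (p - 1))"
  have "M * \<bar>s\<bar> - N * r \<le> \<bar>s\<bar> powr p" for s
  proof (cases "\<bar>s\<bar> \<le> r")
    case True
    have "M * \<bar>s\<bar> \<le> N * r" using True by (intro mult_mono) (auto simp: N_def)
    thus ?thesis using powr_ge_zero[of "\<bar>s\<bar>" p] by linarith
  next
    case False
    have "N = r powr (p - 1)" using p by (auto simp: r_def powr_powr N_def)
    also have "\<dots> \<le> \<bar>s\<bar> powr (p - 1)" using False p by (intro powr_mono2) (auto simp: r_def)
    finally have "M * \<bar>s\<bar> \<le> \<bar>s\<bar> powr (p - 1) * \<bar>s\<bar>" by (intro mult_right_mono) (auto simp: N_def)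
    also have "\<dots> = \<bar>s\<bar> powr p" using False by (cases "s = 0") (auto simp: powr_diff)
    finally show ?thesis by (smt (verit) N_def mult_nonneg_nonneg powr_ge_zero r_def)
  qed
  thus ?thesis by blast
qed

subsection \<open>The homotopy path\<close>

lemma lp_objective_composite: "lp_objective p A b c = composite A b c (\<lambda>i s. \<bar>s\<bar> powr p)"
  by (simp add: fun_eq_iff lp_objective_def composite_def)

lemma smoothed_objective_composite: "smoothed_objective p A b c t = composite A b c (\<lambda>i. smoothed p t)"
  by (simp add: fun_eq_iff smoothed_objective_def composite_def)

lemma phase_objective_composite:
  "phase_objective p A b c t s P = (\<lambda>y. composite A b c (phase_loss p t s) (P *\<^sub>v y))"
  by (simp add: fun_eq_iff phase_objective_def composite_def)

lemma smoothed_coercive: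
  assumes p: "1 < p" and t: "0 < t"
  shows "\<exists>K. \<forall>s. M * \<bar>s\<bar> - K \<le> smoothed p t s"
proof -
  obtain K where K: "\<And>s. M * \<bar>s\<bar> - K \<le> \<bar>s\<bar> powr p" using powr_coercive[OF p, of M] by blast
  have "M * \<bar>s\<bar> - (K - min 0 (p / 2 - 1) * t powr p) \<le> smoothed p t s" for s
    using K[of s] smoothed_error(2)[OF p t, of s] by linarith
  thus ?thesis by blast
qed

text \<open>\<open>path_point\<close> is a chosen minimiser within \<open>ker_perp A\<close>; since
  some global minimiser lies there, the choice is optimal among all vectors, and hence the full
  gradient vanishes.\<close>

lemma path_point:
  assumes p: "1 < p" and t: "0 < t" and A: "A \<in> carrier_mat n d" and b: "b \<in> carrier_vec n" and c: "c \<in> ker_perp A"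
  shows "path_point p A b c t \<in> ker_perp A"
    and "\<And>y. y \<in> carrier_vec d \<Longrightarrow> smoothed_objective p A b c t (path_point p A b c t) \<le> smoothed_objective p A b c t y"
    and "loss_gradient A b c (\<lambda>i. smoothed_d p t) (path_point p A b c t) = 0\<^sub>v d"
proof -
  have cd: "c \<in> carrier_vec d" using ker_perp_carrier[OF c] A by simp
  have "continuous_on UNIV (smoothed p t)"
    using DERIV_isCont[OF smoothed_has_deriv[OF t]] by (intro continuous_at_imp_continuous_on) auto
  then obtain x where x: "x \<in> ker_perp A"
    "\<And>y. y \<in> carrier_vec d \<Longrightarrow> smoothed_objective p A b c t x \<le> smoothed_objective p A b c t y"
    using composite_minimiser_exists[OF A b c, of "\<lambda>i. smoothed p t"] smoothed_coercive[OF p t]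
    unfolding smoothed_objective_composite by blast
  have sub: "y \<in> carrier_vec d" if "y \<in> ker_perp A" for y using ker_perp_carrier[OF that] A by simp
  have "is_arg_min (smoothed_objective p A b c t) (\<lambda>x. x \<in> ker_perp A) x"
    using x sub by (auto simp: is_arg_min_def not_less)
  hence "is_arg_min (smoothed_objective p A b c t) (\<lambda>x. x \<in> ker_perp A) (path_point p A b c t)"
    unfolding path_point_def arg_min_def by (rule someI)
  hence pp: "path_point p A b c t \<in> ker_perp A"
    "smoothed_objective p A b c t (path_point p A b c t) \<le> smoothed_objective p A b c t x"
    using x(1) by (auto simp: is_arg_min_def not_less)
  show "path_point p A b c t \<in> ker_perp A" by (rule pp(1))
  show min: "smoothed_objective p A b c t (path_point p A b c t) \<le> smoothed_objective p A b c t y"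
    if "y \<in> carrier_vec d" for y
    using pp(2) x(2)[OF that] by linarith
  show "loss_gradient A b c (\<lambda>i. smoothed_d p t) (path_point p A b c t) = 0\<^sub>v d"
    by (rule composite_minimiser_stationary[OF A b cd sub[OF pp(1)], of "\<lambda>i. smoothed p t"])
      (use smoothed_has_deriv[OF t] min in \<open>auto simp: smoothed_objective_composite\<close>)
qed

text \<open>Both stationarity conditions are tested in the direction \<open>x' - x\<close>. The
  linear terms cancel, the sum of the gaps becomes a sum of drifts, and \<open>drift_le\<close>
  bounds this by half of the same gaps plus a constant for each coordinate. A single gap is bounded
  only by the whole sum, whence the \<open>sqrt n\<close> in the radius.\<close>

lemma path_move:
  assumes p: "1 < p" and t: "0 < t" and A: "A \<in> carrier_mat n d" and b: "b \<in> carrier_vec n" and c: "c \<in> ker_perp A"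
    and t': "t' = (1 - step_h p) * t" and i: "i < n"
  shows "\<bar>spow (residual A b (path_point p A b c t') $ i) (p / 2) - spow (residual A b (path_point p A b c t) $ i) (p / 2)\<bar>
    \<le> radius p n t - t powr (p / 2) / 4"
proof -
  have t'0: "0 < t'" using step_h_bounds[OF p] t by (simp add: t')
  have cd: "c \<in> carrier_vec d" using ker_perp_carrier[OF c] A by simp
  define x where "x = path_point p A b c t"
  define x' where "x' = path_point p A b c t'"
  define s where "s i = residual A b x $ i" for i
  define s' where "s' i = residual A b x' $ i" for i
  have xd: "x \<in> carrier_vec d" "x' \<in> carrier_vec d"
    using path_point(1)[OF p t A b c] path_point(1)[OF p t'0 A b c] A unfolding x_def x'_def
    by (metis carrier_matD(2) ker_perp_carrier)+
  have v: "x' - x \<in> carrier_vec d" using xd by simp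
  have Av: "(A *\<^sub>v (x' - x)) $ i = s' i - s i" if "i < n" for i
    unfolding s_def s'_def residual_index[OF A b that] mult_minus_distrib_mat_vec[OF A xd(2,1)] using that A by simp
  have "0\<^sub>v d \<bullet> (x' - x) = c \<bullet> (x' - x) + (\<Sum>i<n. smoothed_d p t (s i) * (s' i - s i))"
    using loss_gradient_scalar_prod[OF A cd v, of b "\<lambda>i. smoothed_d p t" x] Av
    unfolding path_point(3)[OF p t A b c, folded x_def] by (simp add: s_def)
  moreover have "0\<^sub>v d \<bullet> (x' - x) = c \<bullet> (x' - x) + (\<Sum>i<n. smoothed_d p t' (s' i) * (s' i - s i))"
    using loss_gradient_scalar_prod[OF A cd v, of b "\<lambda>i. smoothed_d p t'" x'] Av
    unfolding path_point(3)[OF p t'0 A b c, folded x'_def] by (simp add: s'_def)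
  ultimately have eq: "(\<Sum>i<n. smoothed_d p t' (s' i) * (s' i - s i)) = (\<Sum>i<n. smoothed_d p t (s i) * (s' i - s i))" by simp
  define M where "M i = (smoothed_d p t' (s' i) - smoothed_d p t' (s i)) * (s' i - s i)" for i
  have M0: "0 \<le> M i" for i
    using smoothed_d_monotone_lower[OF t'0, of "s' i" "s i" 0 p] p by (simp add: M_def smoothed_dd_nonneg)
  have "(\<Sum>i<n. M i) = (\<Sum>i<n. (smoothed_d p t (s i) - smoothed_d p t' (s i)) * (s' i - s i))"
    using eq by (simp add: M_def left_diff_distrib sum_subtractf)
  also have "\<dots> \<le> (\<Sum>i<n. 1 / 2 * M i + drift_const p * t powr p)"
    unfolding M_def by (intro sum_mono drift_le[OF p t t'])
  also have "\<dots> = 1 / 2 * (\<Sum>i<n. M i) + real n * (drift_const p * t powr p)"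
    by (simp add: sum.distrib sum_distrib_left)
  finally have "(\<Sum>i<n. M i) \<le> 2 * (real n * (drift_const p * t powr p))" by simp
  moreover have "M i \<le> (\<Sum>i<n. M i)" using i M0 by (intro member_le_sum) auto
  ultimately have "M i \<le> 2 * (real n * (drift_const p * t powr p))" by linarith
  from path_move_bound[OF p t t' _ this[unfolded M_def]] i
  show ?thesis unfolding s_def s'_def x_def x'_def by simp
qed

text \<open>The loop invariant: a gap in value, because that is what AGD delivers, in units of
  \<open>t powr p\<close>, because the problem's scale shrinks with \<open>t\<close>.\<close>

definition near_path ::
  "real \<Rightarrow> real Matrix.mat \<Rightarrow> real Matrix.vec \<Rightarrow> real Matrix.vec \<Rightarrow> real \<Rightarrow> real Matrix.vec \<Rightarrow> bool" where
  "near_path p A b c t x \<longleftrightarrow> x \<in> ker_perp A \<and>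
     smoothed_objective p A b c t x - smoothed_objective p A b c t (path_point p A b c t) \<le> closeness p * t powr p"

lemma near_path_close:
  assumes p: "1 < p" and t: "0 < t" and A: "A \<in> carrier_mat n d" and b: "b \<in> carrier_vec n" and c: "c \<in> ker_perp A"
    and near: "near_path p A b c t x" and i: "i < n"
  shows "\<bar>spow (residual A b x $ i) (p / 2) - spow (residual A b (path_point p A b c t) $ i) (p / 2)\<bar> \<le> t powr (p / 2) / 8"
proof (rule small_bregman_imp_close[OF p t])
  have cd: "c \<in> carrier_vec d" using ker_perp_carrier[OF c] A by simp
  have xd: "x \<in> carrier_vec d" using near ker_perp_carrier[of x A] A by (simp add: near_path_def)
  define z where "z = path_point p A b c t"
  have zd: "z \<in> carrier_vec d" using path_point(1)[OF p t A b c] ker_perp_carrier[of z A] A by (simp add: z_def)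
  have xz: "x - z \<in> carrier_vec d" using xd zd by simp
  define B where "B i = smoothed p t (residual A b x $ i) - smoothed p t (residual A b z $ i)
    - smoothed_d p t (residual A b z $ i) * (residual A b x $ i - residual A b z $ i)" for i
  have B0: "0 \<le> B i" for i
    unfolding B_def by (intro bregman_nonneg smoothed_has_deriv t smoothed_d_mono p)
  have "(\<Sum>i<n. B i) \<le> closeness p * t powr p"
    using composite_bregman[OF A b cd zd xd, of "\<lambda>i. smoothed p t" "\<lambda>i. smoothed_d p t"] near xz
    unfolding path_point(3)[OF p t A b c, folded z_def] B_def near_path_def smoothed_objective_composite z_def[symmetric]
    by simp
  moreover have "B i \<le> (\<Sum>i<n. B i)" using i B0 by (intro member_le_sum) auto
  ultimately show "smoothed p t (residual A b x $ i) - smoothed p t (residual A b (path_point p A b c t) $ i)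
    - smoothed_d p t (residual A b (path_point p A b c t) $ i) * (residual A b x $ i - residual A b (path_point p A b c t) $ i)
    \<le> closeness p * t powr p"
    unfolding B_def z_def by linarith
qed

lemma smoothed_ext_inside:
  "l \<le> z \<Longrightarrow> z \<le> u \<Longrightarrow> smoothed_ext p t l u z = smoothed p t z"
  "l \<le> z \<Longrightarrow> z \<le> u \<Longrightarrow> smoothed_ext_d p t l u z = smoothed_d p t z"
  by (auto simp: smoothed_ext_def smoothed_ext_d_def max_def min_def)

text \<open>Outside the box the extension says nothing about the smoothed loss, so closeness cannot
  be read off at \<open>s\<close>. But the Bregman distance from \<open>z\<close> grows away from
  \<open>z\<close>: if \<open>s\<close> were outside, it would be small already at the box end
  \<open>e\<close> on the way, where both losses agree, and \<open>e\<close> would be too close to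
  \<open>z\<close>.\<close>

lemma small_bregman_inside_box:
  assumes p: "1 < p" and t: "0 < t" and lu: "l < u" and z: "l \<le> z" "z \<le> u"
    and B: "smoothed_ext p t l u s - smoothed_ext p t l u z - smoothed_ext_d p t l u z * (s - z) \<le> closeness p * t powr p"
    and far: "\<And>e. e \<in> {l, u} \<Longrightarrow> t powr (p / 2) / 8 < \<bar>spow e (p / 2) - spow z (p / 2)\<bar>"
  shows "l \<le> s \<and> s \<le> u"
proof (rule ccontr)
  assume out: "\<not> ?thesis"
  define L where "L = smoothed_ext p t l u"
  define L' where "L' = smoothed_ext_d p t l u"
  have der: "(L has_real_derivative L' x) (at x)" for x
    unfolding L_def L'_def by (rule smoothed_ext_has_deriv[OF t lu])
  have mono: "L' x \<le> L' y" if "x \<le> y" for x y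
    using smoothed_ext_d_increment(1)[OF t lu that, of 0 p] p unfolding L'_def by (simp add: smoothed_dd_nonneg)
  have "\<exists>e\<in>{l, u}. 0 \<le> (L' e - L' z) * (s - e)"
  proof (cases "u < s")
    case True
    hence "0 \<le> (L' u - L' z) * (s - u)" using mono[OF z(2)] by simp
    thus ?thesis by blast
  next
    case False
    hence "s < l" using out by auto
    hence "0 \<le> (L' l - L' z) * (s - l)" using mono[OF z(1)] by (intro mult_nonpos_nonpos) auto
    thus ?thesis by blast
  qed
  then obtain e where e: "e \<in> {l, u}" "0 \<le> (L' e - L' z) * (s - e)" by blast
  have "0 \<le> L s - L e - L' e * (s - e)" by (rule bregman_nonneg[OF der mono])
  hence "L e - L z - L' z * (e - z) \<le> L s - L z - L' z * (s - z)"
    using e(2) by (simp add: algebra_simps)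
  hence "smoothed p t e - smoothed p t z - smoothed_d p t z * (e - z) \<le> closeness p * t powr p"
    using B e(1) z lu unfolding L_def L'_def by (auto simp: smoothed_ext_inside)
  hence "\<bar>spow e (p / 2) - spow z (p / 2)\<bar> \<le> t powr (p / 2) / 8"
    by (rule small_bregman_imp_close[OF p t])
  thus False using far[OF e(1)] by linarith
qed

lemma box_centre:
  assumes "1 < p" "0 < t"
  shows "box_lo p n t s \<le> s" "s \<le> box_hi p n t s"
  using box_iff[of p n t s s] box_lo_less_hi(2)[of p t n] assms by auto

subsection \<open>One phase\<close>

text \<open>Convexity, smoothness and the isometry concern the box around an arbitrary point of
  \<open>ker_perp A\<close>. Nearness to the path enters with the minimiser, in
  \<open>lp_phase_near\<close>.\<close>

locale lp_phase =
  fixes p t :: real and A :: "real Matrix.mat" and b c x :: "real Matrix.vec" and n d :: nat and pre :: precond_fun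
  assumes p: "1 < p" and t: "0 < t" and n: "1 \<le> n"
    and A: "A \<in> carrier_mat n d" and b: "b \<in> carrier_vec n" and c: "c \<in> ker_perp A"
    and pre: "pre \<in> {precond, precond'}" and x: "x \<in> ker_perp A"
begin

definition "s = residual A b x"
definition "P = phase_precond pre p A b t x"
definition "m = dim_col P"
definition "t' = (1 - step_h p) * t"
definition "W i = weight p n t (s $ i)"
definition "L = phase_loss p t s"
definition "L' i = smoothed_ext_d p t' (box_lo p n t (s $ i)) (box_hi p n t (s $ i))"
definition "g = phase_g pre p A b c t x"
definition "V = row_space P"

lemma t': "0 < t'" "t' \<le> t"
  using step_h_bounds[OF p] t by (auto simp: t'_def mult_le_cancel_right1)

lemma dA: "dim_row A = n" "dim_col A = d" using A by auto

lemma ker_perp_d: "v \<in> ker_perp A \<Longrightarrow> v \<in> carrier_vec d"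
  using ker_perp_carrier[of v A] dA by simp

lemma s_carrier: "s \<in> carrier_vec n"
  unfolding s_def by (rule residual_carrier[OF A b])

lemma L_eq: "L i = smoothed_ext p t' (box_lo p n t (s $ i)) (box_hi p n t (s $ i))"
  using s_carrier by (simp add: fun_eq_iff L_def phase_loss_def t'_def)

lemma L_has_deriv: "(L i has_real_derivative L' i z) (at z)"
  unfolding L_eq L'_def by (intro smoothed_ext_has_deriv t' box_lo_less_hi[OF p t])

lemma W_pos: "0 < W i"
  unfolding W_def by (rule weight_bounds(1)[OF p t n box_centre[OF p t]])

lemma L'_increment:
  assumes "y \<le> z"
  shows "W i * (z - y) \<le> L' i z - L' i y" "L' i z - L' i y \<le> condition_bound p n * W i * (z - y)"
  unfolding L'_def W_def t'_def using weight_bounds(2,3)[OF p t n]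
  by (auto intro!: smoothed_ext_d_increment t'[unfolded t'_def] box_lo_less_hi[OF p t] assms)

lemma L_bregman:
  "W i / 2 * (y - z)\<^sup>2 \<le> L i y - L i z - L' i z * (y - z)"
  "L i y - L i z - L' i z * (y - z) \<le> condition_bound p n * W i / 2 * (y - z)\<^sup>2"
  by (rule bregman_bounds[OF L_has_deriv L'_increment(1) L'_increment(2)]; assumption)+

lemma g_eq: "g = (\<lambda>y. composite A b c L (P *\<^sub>v y))"
  by (simp add: g_def phase_g_def phase_objective_composite P_def L_def s_def)

lemma P_gram: "P * transpose_mat P = pinv (gram A W)" "dim_row P = d" "m \<le> max n d"
  using precond_gram[OF pre _ p, of s A t] s_carrier
  by (simp_all add: P_def phase_precond_def s_def[symmetric] W_def[abs_def] dA m_def)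

lemma P_carrier: "P \<in> carrier_mat d m"
  using P_gram by (intro carrier_matI) (auto simp: m_def)

lemma P_facts:
  "y \<in> carrier_vec m \<Longrightarrow> P *\<^sub>v y \<in> ker_perp A"
  "v \<in> ker_perp A \<Longrightarrow> P *\<^sub>v (pinv P *\<^sub>v v) = v"
  "y \<in> V \<Longrightarrow> (\<Sum>i<n. W i * ((A *\<^sub>v (P *\<^sub>v y)) $ i)\<^sup>2) = y \<bullet> y"
  using gram_factor[of P A W] P_gram W_pos dA by (auto simp: m_def V_def)

lemma V_carrier: "V \<subseteq> carrier_vec m"
  using row_space_carrier by (auto simp: V_def m_def)

lemma pinv_in_V: "v \<in> ker_perp A \<Longrightarrow> pinv P *\<^sub>v v \<in> V"
  unfolding V_def using ker_perp_d P_gram by (intro pinv_in_row_space) auto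

lemma gradient_g:
  assumes y: "y \<in> carrier_vec m"
  shows "gradient g y = transpose_mat P *\<^sub>v loss_gradient A b c L' (P *\<^sub>v y)"
  unfolding g_eq
  by (rule composite_precond_gradient[OF A b ker_perp_d[OF c] P_carrier y L_has_deriv])

lemma gradient_in_V:
  assumes "y \<in> carrier_vec m"
  shows "gradient g y \<in> V"
  unfolding gradient_g[OF assms] V_def row_space_def
  using loss_gradient_carrier[OF A ker_perp_d[OF c]] P_gram by (intro imageI) auto

text \<open>The transpose of \<open>P\<close> in the gradient moves to the other factor, so Bregman
  distances in \<open>y\<close> and in \<open>P *\<^sub>v y\<close> coincide.\<close>

lemma g_increment:
  assumes y: "y \<in> carrier_vec m" and z: "z \<in> carrier_vec m"
  shows "g z - g y - (\<Sum>j<m. gradient g y $ j * (z $ j - y $ j))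
    = (\<Sum>i<n. L i (residual A b (P *\<^sub>v z) $ i) - L i (residual A b (P *\<^sub>v y) $ i)
        - L' i (residual A b (P *\<^sub>v y) $ i) * (residual A b (P *\<^sub>v z) $ i - residual A b (P *\<^sub>v y) $ i))"
proof -
  have Py: "P *\<^sub>v y \<in> carrier_vec d" and Pz: "P *\<^sub>v z \<in> carrier_vec d"
    using P_facts(1) y z ker_perp_d by auto
  define l where "l = loss_gradient A b c L' (P *\<^sub>v y)"
  have l: "l \<in> carrier_vec d" unfolding l_def by (rule loss_gradient_carrier[OF A ker_perp_d[OF c]])
  have zy: "z - y \<in> carrier_vec m" using z y by simp
  have "(\<Sum>j<m. gradient g y $ j * (z $ j - y $ j)) = (transpose_mat P *\<^sub>v l) \<bullet> (z - y)"
    unfolding gradient_g[OF y] l_def[symmetric] scalar_prod_def using y z by (simp add: atLeast0LessThan)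
  also have "\<dots> = l \<bullet> (P *\<^sub>v (z - y))"
    by (rule scalar_prod_mult_mat_vec[symmetric]) (use l zy y P_carrier in auto)
  also have "P *\<^sub>v (z - y) = P *\<^sub>v z - P *\<^sub>v y" by (rule mult_minus_distrib_mat_vec[OF P_carrier z y])
  finally show ?thesis
    using composite_bregman[OF A b ker_perp_d[OF c] Py Pz, of L L'] by (simp add: g_eq l_def)
qed

text \<open>Translates the weighted residual norm, in which the curvature is controlled, into the
  Euclidean norm in which AGD runs.\<close>

lemma row_space_isometry:
  assumes y: "y \<in> V" and z: "z \<in> V"
  shows "(\<Sum>i<n. W i * (residual A b (P *\<^sub>v z) $ i - residual A b (P *\<^sub>v y) $ i)\<^sup>2) = (\<Sum>j<m. (z $ j - y $ j)\<^sup>2)"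
proof -
  have yz: "y \<in> carrier_vec m" "z \<in> carrier_vec m" using y z V_carrier by auto
  have eq: "z - y = 1 \<cdot>\<^sub>v z + (- 1) \<cdot>\<^sub>v y" using yz by (intro eq_vecI) auto
  have zyV: "z - y \<in> V" unfolding eq using y z unfolding V_def by (intro row_space_lincomb)
  have Py: "P *\<^sub>v y \<in> carrier_vec d" and Pz: "P *\<^sub>v z \<in> carrier_vec d"
    using P_facts(1) yz ker_perp_d by auto
  have "(A *\<^sub>v (P *\<^sub>v (z - y))) $ i = residual A b (P *\<^sub>v z) $ i - residual A b (P *\<^sub>v y) $ i" if "i < n" for i
    unfolding mult_minus_distrib_mat_vec[OF P_carrier yz(2,1)] mult_minus_distrib_mat_vec[OF A Pz Py]
      residual_index[OF A b that] using that dA by simp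
  hence "(\<Sum>i<n. W i * (residual A b (P *\<^sub>v z) $ i - residual A b (P *\<^sub>v y) $ i)\<^sup>2) = (z - y) \<bullet> (z - y)"
    using P_facts(3)[OF zyV] by simp
  also have "\<dots> = (\<Sum>j<m. (z $ j - y $ j)\<^sup>2)"
    using yz by (simp add: scalar_prod_def atLeast0LessThan power2_eq_square)
  finally show ?thesis .
qed

lemma g_strongly_convex:
  assumes "y \<in> V" "z \<in> V"
  shows "g y + (\<Sum>j<m. gradient g y $ j * (z $ j - y $ j)) + 1 / 2 * (\<Sum>j<m. (z $ j - y $ j)\<^sup>2) \<le> g z"
proof -
  have yz: "y \<in> carrier_vec m" "z \<in> carrier_vec m" using assms V_carrier by auto
  have "1 / 2 * (\<Sum>j<m. (z $ j - y $ j)\<^sup>2) = (\<Sum>i<n. W i / 2 * (residual A b (P *\<^sub>v z) $ i - residual A b (P *\<^sub>v y) $ i)\<^sup>2)"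
    unfolding row_space_isometry[OF assms, symmetric] by (simp add: sum_distrib_left)
  also have "\<dots> \<le> g z - g y - (\<Sum>j<m. gradient g y $ j * (z $ j - y $ j))"
    unfolding g_increment[OF yz] by (intro sum_mono L_bregman)
  finally show ?thesis by simp
qed

lemma g_smooth:
  assumes "y \<in> V" "z \<in> V"
  shows "g z \<le> g y + (\<Sum>j<m. gradient g y $ j * (z $ j - y $ j)) + condition_bound p n / 2 * (\<Sum>j<m. (z $ j - y $ j)\<^sup>2)"
proof -
  have yz: "y \<in> carrier_vec m" "z \<in> carrier_vec m" using assms V_carrier by auto
  have "g z - g y - (\<Sum>j<m. gradient g y $ j * (z $ j - y $ j))
    \<le> (\<Sum>i<n. condition_bound p n * W i / 2 * (residual A b (P *\<^sub>v z) $ i - residual A b (P *\<^sub>v y) $ i)\<^sup>2)"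
    unfolding g_increment[OF yz] by (intro sum_mono L_bregman)
  also have "\<dots> = condition_bound p n / 2 * (\<Sum>j<m. (z $ j - y $ j)\<^sup>2)"
    unfolding row_space_isometry[OF assms, symmetric] by (simp add: sum_distrib_left mult.assoc)
  finally show ?thesis by simp
qed

end

locale lp_phase_near = lp_phase +
  assumes near: "near_path p A b c t x"
begin

definition "x' = path_point p A b c t'"
definition "y_opt = pinv P *\<^sub>v x'"

lemma x'_ker_perp: "x' \<in> ker_perp A"
  unfolding x'_def by (rule path_point(1)[OF p t'(1) A b c])

text \<open>The slack \<open>1 / 4\<close> of the path movement minus the error \<open>1 / 8\<close>
  of the computed point.\<close>

lemma x'_margin:
  assumes i: "i < n"
  shows "\<bar>spow (residual A b x' $ i) (p / 2) - spow (s $ i) (p / 2)\<bar> \<le> radius p n t - t powr (p / 2) / 8"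
  using path_move[OF p t A b c t'_def i] near_path_close[OF p t A b c near i]
  unfolding x'_def s_def by linarith

lemma x'_in_box:
  assumes i: "i < n"
  shows "box_lo p n t (s $ i) \<le> residual A b x' $ i" "residual A b x' $ i \<le> box_hi p n t (s $ i)"
proof -
  have "\<bar>spow (residual A b x' $ i) (p / 2) - spow (s $ i) (p / 2)\<bar> \<le> radius p n t"
    using x'_margin[OF i] powr_ge_zero[of t "p / 2"] by linarith
  thus "box_lo p n t (s $ i) \<le> residual A b x' $ i" "residual A b x' $ i \<le> box_hi p n t (s $ i)"
    using box_iff[OF p, of n t "s $ i" "residual A b x' $ i"] by auto
qed

lemma P_y_opt: "P *\<^sub>v y_opt = x'"
  unfolding y_opt_def by (rule P_facts(2)[OF x'_ker_perp])

lemma y_opt_V: "y_opt \<in> V"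
  unfolding y_opt_def by (rule pinv_in_V[OF x'_ker_perp])

text \<open>Inside the box the extended and the smoothed loss have equal derivatives, so
  stationarity of the next path point carries over.\<close>

lemma stationary: "loss_gradient A b c L' x' = 0\<^sub>v d"
proof -
  have "L' i (residual A b x' $ i) = smoothed_d p t' (residual A b x' $ i)" if "i < n" for i
    unfolding L'_def by (rule smoothed_ext_inside(2)[OF x'_in_box[OF that]])
  hence "loss_gradient A b c L' x' = loss_gradient A b c (\<lambda>i. smoothed_d p t') x'"
    unfolding loss_gradient_def dA by (intro arg_cong2[where f = "(+)"] arg_cong2[where f = "(*\<^sub>v)"] eq_vecI) auto
  thus ?thesis using path_point(3)[OF p t'(1) A b c] by (simp add: x'_def)
qed

lemma g_gap:
  assumes y: "y \<in> carrier_vec m"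
  shows "g y - g y_opt = (\<Sum>i<n. L i (residual A b (P *\<^sub>v y) $ i) - L i (residual A b x' $ i)
        - L' i (residual A b x' $ i) * (residual A b (P *\<^sub>v y) $ i - residual A b x' $ i))"
proof -
  have Py: "P *\<^sub>v y \<in> carrier_vec d" by (rule ker_perp_d[OF P_facts(1)[OF y]])
  have xd: "x' \<in> carrier_vec d" by (rule ker_perp_d[OF x'_ker_perp])
  have "P *\<^sub>v y - x' \<in> carrier_vec d" using Py xd by simp
  thus ?thesis
    using composite_bregman[OF A b ker_perp_d[OF c] xd Py, of L L'] unfolding stationary g_eq P_y_opt by simp
qed

lemma L_bregman_nonneg: "0 \<le> L i y - L i z - L' i z * (y - z)"
  using L_bregman(1)[of i y z] W_pos[of i] by (smt (verit) mult_nonneg_nonneg zero_le_power2 half_gt_zero)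

lemma y_opt_minimal: "y \<in> carrier_vec m \<Longrightarrow> g y_opt \<le> g y"
  using g_gap[of y] sum_nonneg[of "{..<n}"] L_bregman_nonneg by (smt (verit))

lemma g_inside_box:
  assumes y: "y \<in> carrier_vec m"
    and box: "\<And>i. i < n \<Longrightarrow> box_lo p n t (s $ i) \<le> residual A b (P *\<^sub>v y) $ i \<and> residual A b (P *\<^sub>v y) $ i \<le> box_hi p n t (s $ i)"
  shows "g y = smoothed_objective p A b c t' (P *\<^sub>v y)"
  unfolding g_eq smoothed_objective_composite composite_def dA L_eq using box by (simp add: smoothed_ext_inside)

text \<open>The starting gap is at most \<open>(closeness p + real n * p) * t powr p\<close>: the
  invariant gives the first term, the change of threshold at two points the second. AGD leaves half
  of \<open>closeness p * t powr p\<close>, and \<open>t' powr p \<ge> t powr p / 2\<close> makes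
  this the invariant for \<open>t'\<close>.\<close>

lemma phase_output:
  assumes delta: "0 < \<delta>" "\<delta> < 1 / 2" "\<delta> * (closeness p + real n * p) \<le> closeness p / 2"
  defines "y_start \<equiv> phase_start pre p A b t x"
    and "y_out \<equiv> phase_output pre (condition_bound p n) \<delta> p A b c t x"
  shows "P *\<^sub>v y_start = x" "y_out \<in> carrier_vec m"
    "g y_out - g y_opt \<le> \<delta> * (g y_start - g y_opt)" "near_path p A b c t' (P *\<^sub>v y_out)"
proof -
  have ys: "y_start = pinv P *\<^sub>v x" by (simp add: y_start_def phase_start_def P_def)
  show Pys: "P *\<^sub>v y_start = x" unfolding ys by (rule P_facts(2)[OF x])
  have ysV: "y_start \<in> V" unfolding ys by (rule pinv_in_V[OF x])
  have yo: "y_out = agd (condition_bound p n) \<delta> g y_start"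
    by (simp add: y_out_def phase_output_def g_def y_start_def)
  note kap = condition_bound_ge_1[OF p n]
  have agd: "y_out \<in> V" "g y_out - g y_opt \<le> \<delta> * (g y_start - g y_opt)"
  proof -
    have lin: "a \<cdot>\<^sub>v y + b \<cdot>\<^sub>v z \<in> V" if "y \<in> V" "z \<in> V" for y z a b
      using that unfolding V_def by (rule row_space_lincomb)
    have grad: "gradient g z \<in> V" if "z \<in> V" for z using that V_carrier by (intro gradient_in_V) auto
    have min: "g y_opt \<le> g y" if "y \<in> V" for y using that V_carrier by (intro y_opt_minimal) auto
    note agd = agd_converges[OF kap delta(1,2) V_carrier lin grad g_strongly_convex g_smooth y_opt_V min ysV]
    show "y_out \<in> V" unfolding yo by (rule agd(1))
    show "g y_out - g y_opt \<le> \<delta> * (g y_start - g y_opt)" unfolding yo by (rule agd(2))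
  qed
  show yoc: "y_out \<in> carrier_vec m" using agd(1) V_carrier by auto
  show "g y_out - g y_opt \<le> \<delta> * (g y_start - g y_opt)" by (rule agd(2))
  have ysc: "y_start \<in> carrier_vec m" using ysV V_carrier by auto
  have yoptc: "y_opt \<in> carrier_vec m" using y_opt_V V_carrier by auto
  have tp: "0 \<le> t powr p" by simp
  have xd: "x \<in> carrier_vec d" "x' \<in> carrier_vec d" using x x'_ker_perp ker_perp_d by auto
  have g_start: "g y_start = smoothed_objective p A b c t' x"
    using g_inside_box[OF ysc] box_centre[OF p t] unfolding Pys s_def by blast
  have g_opt: "g y_opt = smoothed_objective p A b c t' x'"
    using g_inside_box[OF yoptc] x'_in_box unfolding P_y_opt by blast
  have change: "\<bar>smoothed_objective p A b c t z - smoothed_objective p A b c t' z\<bar> \<le> real n * (p / 2 * t powr p)" for z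
  proof -
    have "\<bar>smoothed_objective p A b c t z - smoothed_objective p A b c t' z\<bar>
      = \<bar>\<Sum>i<n. smoothed p t (residual A b z $ i) - smoothed p t' (residual A b z $ i)\<bar>"
      by (simp add: smoothed_objective_def dA sum_subtractf)
    also have "\<dots> \<le> (\<Sum>i<n. \<bar>smoothed p t (residual A b z $ i) - smoothed p t' (residual A b z $ i)\<bar>)" by (rule sum_abs)
    also have "\<dots> \<le> (\<Sum>i<n. p / 2 * t powr p)" by (intro sum_mono smoothed_change[OF p t'])
    finally show ?thesis by simp
  qed
  have "g y_start - g y_opt \<le> (closeness p + real n * p) * t powr p"
  proof -
    have gen: "Gs - Go \<le> (k + N * p) * T"
      if "\<bar>Fx - Gs\<bar> \<le> N * (p / 2 * T)" "\<bar>Fx' - Go\<bar> \<le> N * (p / 2 * T)" "Fx - Fp \<le> k * T" "Fp \<le> Fx'"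
      for Gs Go Fx Fx' Fp k N T :: real
    proof -
      have "Gs - Go \<le> k * T + 2 * (N * (p / 2 * T))" using that by linarith
      thus ?thesis by (simp add: algebra_simps)
    qed
    show ?thesis unfolding g_start g_opt
    proof (rule gen[OF change[of x] change[of x']])
      show "smoothed_objective p A b c t x - smoothed_objective p A b c t (path_point p A b c t) \<le> closeness p * t powr p"
        using near by (simp add: near_path_def)
      show "smoothed_objective p A b c t (path_point p A b c t) \<le> smoothed_objective p A b c t x'"
        by (rule path_point(2)[OF p t A b c xd(2)])
    qed
  qed
  hence "\<delta> * (g y_start - g y_opt) \<le> \<delta> * ((closeness p + real n * p) * t powr p)" using delta by (intro mult_left_mono) auto
  also have "\<dots> = \<delta> * (closeness p + real n * p) * t powr p" by simp
  also have "\<dots> \<le> closeness p / 2 * t powr p" using delta(3) by (intro mult_right_mono) auto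
  also have "\<dots> = closeness p * (1 / 2 * t powr p)" by simp
  also have "\<dots> \<le> closeness p * ((1 - step_h p) powr p * t powr p)"
    using step_h_bounds(4)[OF p] p by (intro mult_left_mono mult_right_mono) (auto simp: closeness_def)
  also have "\<dots> = closeness p * t' powr p" by (simp add: t'_def powr_mult)
  finally have gap: "g y_out - g y_opt \<le> closeness p * t' powr p" using agd(2) by linarith
  \<comment> \<open>Required before a gap of \<open>g\<close> can be read as a gap of the smoothed
    objective, with which it is known to agree in the box.\<close>
  have inside: "box_lo p n t (s $ i) \<le> residual A b (P *\<^sub>v y_out) $ i \<and> residual A b (P *\<^sub>v y_out) $ i \<le> box_hi p n t (s $ i)"
    if i: "i < n" for i
  proof (rule small_bregman_inside_box[OF p t'(1) box_lo_less_hi(1)[OF p t] x'_in_box[OF i]])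
    define B where "B i = L i (residual A b (P *\<^sub>v y_out) $ i) - L i (residual A b x' $ i)
        - L' i (residual A b x' $ i) * (residual A b (P *\<^sub>v y_out) $ i - residual A b x' $ i)" for i
    have "B i \<le> (\<Sum>i<n. B i)" using i L_bregman_nonneg by (intro member_le_sum) (auto simp: B_def)
    hence "B i \<le> closeness p * t' powr p" using gap g_gap[OF yoc] by (simp add: B_def)
    thus "smoothed_ext p t' (box_lo p n t (s $ i)) (box_hi p n t (s $ i)) (residual A b (P *\<^sub>v y_out) $ i)
      - smoothed_ext p t' (box_lo p n t (s $ i)) (box_hi p n t (s $ i)) (residual A b x' $ i)
      - smoothed_ext_d p t' (box_lo p n t (s $ i)) (box_hi p n t (s $ i)) (residual A b x' $ i)
        * (residual A b (P *\<^sub>v y_out) $ i - residual A b x' $ i) \<le> closeness p * t' powr p"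
      by (simp add: B_def L_eq L'_def)
    fix e assume "e \<in> {box_lo p n t (s $ i), box_hi p n t (s $ i)}"
    hence "\<bar>spow e (p / 2) - spow (s $ i) (p / 2)\<bar> = radius p n t"
      using p box_lo_less_hi(2)[OF p t, of n] by (auto simp: box_lo_def box_hi_def spow_inverse)
    \<comment> \<open>\<open>x'\<close> keeps distance \<open>t powr (p / 2) / 8\<close> from the
      box ends while closeness is measured at \<open>t'\<close>; the decrease of the scale makes the
      inequality strict.\<close>
    moreover have "t' powr (p / 2) < t powr (p / 2)"
      using t'(1) step_h_bounds[OF p] t p by (intro powr_less_mono2) (auto simp: t'_def)
    ultimately show "t' powr (p / 2) / 8 < \<bar>spow e (p / 2) - spow (residual A b x' $ i) (p / 2)\<bar>"
      using x'_margin[OF i] by linarith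
  qed
  show "near_path p A b c t' (P *\<^sub>v y_out)"
  proof -
    have "g y_out = smoothed_objective p A b c t' (P *\<^sub>v y_out)"
      by (rule g_inside_box[OF yoc]) (rule inside)
    thus ?thesis using gap[unfolded g_opt] P_facts(1)[OF yoc] unfolding near_path_def x'_def by simp
  qed
qed

end

subsection \<open>Constants and programs\<close>

text \<open>Solves \<open>\<delta> * (2 * n * cond p) = closeness p / 2\<close>, where
  \<open>2 * n * cond p\<close> bounds \<open>closeness p + n * p\<close>; so \<open>2 ^ 19\<close>
  is \<open>2 ^ 17 * 2 * 2\<close>.\<close>

definition accuracy :: "real \<Rightarrow> nat \<Rightarrow> real" where
  "accuracy p n = 1 / (2 ^ 19 * cond p ^ 2 * real n)"

lemma accuracy:
  assumes p: "1 < p" and n: "1 \<le> n"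
  shows "0 < accuracy p n" "accuracy p n < 1 / 2" "accuracy p n * (closeness p + real n * p) \<le> closeness p / 2"
proof -
  define q where "q = cond p"
  have q: "4 \<le> q" "p \<le> q" using cond_bounds[OF p] by (auto simp: q_def)
  have N: "1 \<le> real n" using n by simp
  have acc: "accuracy p n = 1 / (2 ^ 19 * q\<^sup>2 * real n)" by (simp add: accuracy_def q_def)
  show "0 < accuracy p n" using q N unfolding acc by simp
  have "1 \<le> q\<^sup>2" using q by (intro one_le_power) simp
  hence "1 * 1 \<le> q\<^sup>2 * real n" using N by (intro mult_mono) auto
  hence "2 ^ 19 \<le> 2 ^ 19 * q\<^sup>2 * real n" by simp
  hence "accuracy p n \<le> 1 / 2 ^ 19" unfolding acc by (intro divide_left_mono) auto
  thus "accuracy p n < 1 / 2" by simp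
  have cl: "closeness p = 1 / (2 ^ 17 * q)" by (simp add: closeness_def q_def)
  have "closeness p \<le> 1" using q unfolding cl by simp
  moreover have "1 * 1 \<le> real n * q" using q N by (intro mult_mono) auto
  ultimately have "closeness p + real n * p \<le> 2 * (real n * q)" using mult_left_mono[OF q(2), of "real n"] by simp
  hence "accuracy p n * (closeness p + real n * p) \<le> accuracy p n * (2 * (real n * q))"
    using \<open>0 < accuracy p n\<close> by (intro mult_left_mono) auto
  also have "\<dots> = closeness p / 2" unfolding acc cl using q N by (simp add: power2_eq_square)
  finally show "accuracy p n * (closeness p + real n * p) \<le> closeness p / 2" .
qed

text \<open>The logarithm of \<open>\<kappa> / \<delta>\<close> is at most
  \<open>23 * cond p * ln (n + 1)\<close>; with the square root of the condition number this gives
  the constant 184, and 1 for rounding. \<open>ln (n + 1)\<close> stays away from 0 at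
  \<open>n = 1\<close>.\<close>

lemma iterations_bound:
  assumes p: "1 < p" and n: "1 \<le> n"
  shows "real (agd_iterations (condition_bound p n) (accuracy p n))
    \<le> 2 ^ 19 * cond p ^ 3 * real n powr \<bar>1 / 2 - 1 / p\<bar> * ln (real n + 1)"
proof -
  define q where "q = cond p"
  define e where "e = \<bar>1 - 2 / p\<bar>"
  define N where "N = real n"
  define l where "l = ln (N + 1)"
  have q: "4 \<le> q" using cond_bounds[OF p] by (auto simp: q_def)
  have N: "1 \<le> N" using n by (simp add: N_def)
  have e: "0 \<le> e" "e \<le> 1" "\<bar>1 / 2 - 1 / p\<bar> = e / 2"
    using p by (auto simp: e_def abs_if field_simps)
  have cb: "condition_bound p n = 16 * q ^ 3 * N powr e" by (simp add: condition_bound_def q_def e_def N_def)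
  have ac: "accuracy p n = 1 / (2 ^ 19 * q ^ 2 * N)" by (simp add: accuracy_def q_def N_def)
  have "ln 2 \<le> l" unfolding l_def using N by simp
  hence l: "1 / 2 \<le> l" using ln2_ge_two_thirds by simp
  define H where "H = N powr (e / 2)"
  have H: "1 \<le> H" using N e by (auto simp: H_def intro: ge_one_powr_ge_zero)
  have sq: "sqrt (condition_bound p n) \<le> 4 * q\<^sup>2 * H"
  proof (rule real_le_lsqrt)
    have "q ^ 3 \<le> q ^ 4" using q by (intro power_increasing) auto
    hence "16 * q ^ 3 * N powr e \<le> 16 * q ^ 4 * N powr e" by (intro mult_right_mono) auto
    also have "\<dots> = (4 * q\<^sup>2 * H)\<^sup>2"
      by (simp add: H_def power_mult_distrib powr_as_square[of N e] flip: power_mult)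
    finally show "condition_bound p n \<le> (4 * q\<^sup>2 * H)\<^sup>2" unfolding cb .
    show "0 \<le> 4 * q\<^sup>2 * H" using H by simp
  qed
  have ratio: "condition_bound p n / accuracy p n = 2 ^ 23 * q ^ 5 * (N powr e * N)"
    unfolding cb ac by (simp add: power_add[symmetric] mult_ac flip: power_Suc)
  define K where "K = (2::real) ^ 23"
  have K: "0 < K" "ln K = 23 * ln 2" unfolding K_def by simp (subst ln_realpow; simp)
  have "ln (condition_bound p n / accuracy p n) = 23 * ln 2 + 5 * ln q + (e * ln N + ln N)"
    unfolding ratio K_def[symmetric] using q N K by (simp add: ln_mult ln_realpow)
  also have "\<dots> \<le> 23 * 1 + 5 * q + (1 * ln N + ln N)"
  proof -
    have "ln q \<le> q" using q ln_bound[of q] by simp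
    moreover have "ln (2::real) \<le> 1" using ln_bound[of 2] ln_add_one_self_le_self[of 1] by simp
    moreover have "e * ln N \<le> 1 * ln N" using e N by (intro mult_right_mono) auto
    ultimately show ?thesis by simp
  qed
  also have "\<dots> \<le> 6 * q + 5 * q + 2 * l"
  proof -
    have "ln N \<le> l" unfolding l_def using N by simp
    thus ?thesis using q by simp
  qed
  also have "\<dots> \<le> 22 * q * l + 1 * q * l"
  proof -
    have "11 * q * 1 \<le> 11 * q * (2 * l)" using q l by (intro mult_left_mono) auto
    hence "11 * q \<le> 22 * q * l" by (simp add: mult_ac)
    moreover have "2 * l \<le> q * l" using q l by (intro mult_right_mono) auto
    ultimately show ?thesis by (simp only: mult_1)
  qed
  finally have ln: "ln (condition_bound p n / accuracy p n) \<le> 23 * (q * l)" by (simp add: mult_ac)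
  have ql: "2 \<le> q * l" using mult_mono[of 4 q "1 / 2" l] q l by simp
  have "1 \<le> condition_bound p n / accuracy p n"
    using accuracy[OF p n] condition_bound_ge_1[OF p n] by (simp add: le_divide_eq)
  hence ln0: "0 \<le> ln (condition_bound p n / accuracy p n)" by simp
  have "2 * sqrt (condition_bound p n) * ln (condition_bound p n / accuracy p n) \<le> (2 * (4 * q\<^sup>2 * H)) * (23 * (q * l))"
    using sq ln ln0 H condition_bound_ge_1[OF p n] by (intro mult_mono) auto
  moreover have "real (agd_iterations (condition_bound p n) (accuracy p n))
     \<le> 2 * sqrt (condition_bound p n) * ln (condition_bound p n / accuracy p n) + 1"
  proof -
    have "0 \<le> 2 * sqrt (condition_bound p n) * ln (condition_bound p n / accuracy p n)"
      using ln0 condition_bound_ge_1[OF p n] by simp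
    moreover have "real (nat \<lceil>X\<rceil>) \<le> X + 1" if "0 \<le> X" for X :: real
      using that by linarith
    ultimately show ?thesis unfolding agd_iterations_def by blast
  qed
  moreover have "1 \<le> q\<^sup>2 * H * (q * l)"
  proof -
    have "1 \<le> q\<^sup>2" using q by (intro one_le_power) simp
    hence "1 * 1 \<le> q\<^sup>2 * H" using H by (intro mult_mono) auto
    hence "1 * 1 \<le> (q\<^sup>2 * H) * (q * l)" using ql by (intro mult_mono) auto
    thus ?thesis by simp
  qed
  ultimately have "real (agd_iterations (condition_bound p n) (accuracy p n)) \<le> 185 * (q\<^sup>2 * H * (q * l))" by linarith
  also have "\<dots> \<le> 2 ^ 19 * (q\<^sup>2 * H * (q * l))" using q H l by (intro mult_right_mono) auto
  also have "\<dots> = 2 ^ 19 * q ^ 3 * H * l" by (simp add: power2_eq_square power3_eq_cube)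
  finally show ?thesis unfolding e(3) q_def H_def l_def N_def .
qed

text \<open>Registers 0 to 3 hold \<open>b, c, y, z\<close>; 4 to 6 build the residual of
  \<open>P *\<^sub>v z\<close>, 7 the loss derivatives, 8 and 9 the gradient in \<open>x\<close>, 10
  its pullback by \<open>P\<close>, 11 and 12 the new pair. The momentum step is regrouped as
  \<open>(1 + \<beta>) * y' - \<beta> * y\<close> to fit one instruction.\<close>

definition step_program :: "real \<Rightarrow> instr list" where
  "step_program \<kappa> =
     (let \<beta> = (sqrt \<kappa> - 1) / (sqrt \<kappa> + 1)
      in [ApplyP 3, ApplyA 4, Lin 1 5 (- 1) 0, Pointwise 6, ApplyAT 7, Lin 1 8 1 1, ApplyPT 9,
          Lin 1 3 (- (1 / \<kappa>)) 10, Lin (1 + \<beta>) 11 (- \<beta>) 2])"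

lemma step_program_applications: "applications (step_program \<kappa>) = 2"
  by (simp add: applications_def step_program_def Let_def)

lemma step_program_correct:
  assumes A: "A \<in> carrier_mat n d" and b: "b \<in> carrier_vec n" and c: "c \<in> carrier_vec d"
    and P: "P \<in> carrier_mat d m" and m: "m \<le> max n d" and y: "y \<in> carrier_vec m" and z: "z \<in> carrier_vec m"
    and grad: "gradient g z = transpose_mat P *\<^sub>v loss_gradient A b c \<phi> (P *\<^sub>v z)"
  shows "real (work P A \<phi> (step_program \<kappa>) [b, c, y, z]) \<le> 11 * real (nnz A + n + d)"
    and "implements_step (step_program \<kappa>) P A b c \<phi> \<kappa> g y z"
proof -
  have dims: "dim_row A = n" "dim_col A = d" "dim_vec b = n" "dim_vec c = d" "dim_row P = d" "dim_col P = m"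
    "dim_vec y = m" "dim_vec z = m" using A b c P y z by auto
  \<comment> \<open>The exact cost is \<open>4 * nnz A + 5 * n + 4 * d + 6 * m\<close>, and
    \<open>m \<le> max n d\<close>.\<close>
  show "real (work P A \<phi> (step_program \<kappa>) [b, c, y, z]) \<le> 11 * real (nnz A + n + d)"
    using m by (simp add: step_program_def Let_def numeral_eq_Suc dims)
  define w where "w = Matrix.vec n (\<lambda>i. \<phi> i (residual A b (P *\<^sub>v z) $ i))"
  define G where "G = transpose_mat P *\<^sub>v (transpose_mat A *\<^sub>v w + c)"
  have G: "gradient g z = G" "dim_vec G = m" by (simp_all add: grad G_def loss_gradient_def w_def dims)
  have res: "1 \<cdot>\<^sub>v (A *\<^sub>v (P *\<^sub>v z)) + (- 1) \<cdot>\<^sub>v b = residual A b (P *\<^sub>v z)"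
    by (intro eq_vecI) (auto simp: residual_def dims simp del: index_mult_mat_vec)
  have dr: "dim_vec (residual A b (P *\<^sub>v z)) = n" by (simp add: residual_def dims)
  have w': "Matrix.vec (dim_vec (residual A b (P *\<^sub>v z))) (\<lambda>i. \<phi> i (residual A b (P *\<^sub>v z) $ i)) = w"
    by (simp add: w_def dr)
  have G': "transpose_mat P *\<^sub>v (1 \<cdot>\<^sub>v (transpose_mat A *\<^sub>v w) + 1 \<cdot>\<^sub>v c) = G" by (simp add: G_def)
  define y' where "y' = z - (1 / \<kappa>) \<cdot>\<^sub>v G"
  have y': "1 \<cdot>\<^sub>v z + (- (1 / \<kappa>)) \<cdot>\<^sub>v G = y'" by (intro eq_vecI) (auto simp: y'_def G dims)
  define \<beta> where "\<beta> = (sqrt \<kappa> - 1) / (sqrt \<kappa> + 1)"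
  have z': "(1 + \<beta>) \<cdot>\<^sub>v y' + (- \<beta>) \<cdot>\<^sub>v y = y' + \<beta> \<cdot>\<^sub>v (y' - y)"
    by (intro eq_vecI) (auto simp: y'_def G dims algebra_simps add_divide_distrib)
  have regs: "exec P A \<phi> (step_program \<kappa>) [b, c, y, z] =
    [b, c, y, z, P *\<^sub>v z, A *\<^sub>v (P *\<^sub>v z), residual A b (P *\<^sub>v z), w, transpose_mat A *\<^sub>v w,
     1 \<cdot>\<^sub>v (transpose_mat A *\<^sub>v w) + 1 \<cdot>\<^sub>v c, G, y', y' + \<beta> \<cdot>\<^sub>v (y' - y)]"
    unfolding step_program_def Let_def \<beta>_def[symmetric]
    by (simp add: numeral_eq_Suc res[simplified] w' G'[simplified] y'[simplified] z'[simplified])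
  show "implements_step (step_program \<kappa>) P A b c \<phi> \<kappa> g y z"
    unfolding implements_step_def regs Let_def
    by (simp add: agd_step_def Let_def G y'_def \<beta>_def step_program_def)
qed

subsection \<open>The algorithm\<close>

text \<open>Since \<open>c\<close> lies in \<open>ker_perp A\<close>, the vector
  \<open>u = pinv B *\<^sub>v c\<close> satisfies \<open>B *\<^sub>v u = c\<close>, and
  \<open>c \<bullet> u\<close> is the squared length of \<open>A *\<^sub>v u\<close>. If this
  vanishes, so does \<open>c\<close>.\<close>

lemma t_init_pos:
  assumes A: "A \<in> carrier_mat n d" and b: "b \<in> carrier_vec n" and c: "c \<in> ker_perp A"
  shows "0 \<le> t_init p A b c" "t_init p A b c = 0 \<Longrightarrow> b = 0\<^sub>v n \<and> c = 0\<^sub>v d"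
proof -
  have dA[simp]: "dim_row A = n" "dim_col A = d" using A by auto
  have cd: "c \<in> carrier_vec d" using ker_perp_carrier[OF c] by simp
  show "0 \<le> t_init p A b c" by (simp add: t_init_def le_max_iff_disj)
  define B where "B = transpose_mat A * A"
  have Bg: "B = gram A (\<lambda>i. 1)"
  proof -
    have "mat_diag n (\<lambda>i. 1 :: real) = 1\<^sub>m n" by (rule eq_matI) (auto simp: mat_diag_def)
    thus ?thesis unfolding B_def gram_def using A by simp
  qed
  define u where "u = pinv B *\<^sub>v c"
  have u: "u \<in> carrier_vec d" unfolding u_def by (intro carrier_vecI) (simp add: B_def)
  have Bu: "B *\<^sub>v u = c" unfolding u_def Bg by (rule gram_inverse_on_ker_perp(2)[OF _ c]) simp
  assume 0: "t_init p A b c = 0"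
  have "2 * euclid_norm b \<le> 0" "(2 * (c \<bullet> u)) powr (1 / (p - 1)) \<le> 0"
    using 0 unfolding t_init_def B_def[symmetric] u_def[symmetric] by linarith+
  hence nb: "euclid_norm b \<le> 0" and cu: "c \<bullet> u = 0" by simp_all
  have "b \<bullet> b = 0" using nb scalar_prod_self_nonneg[of b] by (simp add: euclid_norm_def)
  hence b0: "b = 0\<^sub>v n" by (rule scalar_prod_self_eq_0[OF b])
  have "u \<bullet> (B *\<^sub>v u) = 0" using cu comm_scalar_prod[OF cd u] unfolding Bu by simp
  hence "(\<Sum>i<n. ((A *\<^sub>v u) $ i)\<^sup>2) = 0" using gram_quadratic[of u A "\<lambda>i. 1"] u unfolding Bg by simp
  hence "\<forall>i\<in>{..<n}. ((A *\<^sub>v u) $ i)\<^sup>2 = 0" by (subst (asm) sum_nonneg_eq_0_iff) auto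
  hence "A *\<^sub>v u = 0\<^sub>v n" by (intro eq_vecI) auto
  hence "c = transpose_mat A *\<^sub>v 0\<^sub>v n"
    using Bu u by (simp add: B_def mat_vec_assoc)
  moreover have "transpose_mat A *\<^sub>v 0\<^sub>v n = 0\<^sub>v d" by (intro eq_vecI) (auto simp: scalar_prod_def)
  ultimately have "c = 0\<^sub>v d" by simp
  with b0 show "b = 0\<^sub>v n \<and> c = 0\<^sub>v d" by simp
qed

lemma homotopy_near_path:
  assumes p: "1 < p" and n: "1 \<le> n" and A: "A \<in> carrier_mat n d" and b: "b \<in> carrier_vec n" and c: "c \<in> ker_perp A"
    and pre: "pre \<in> {precond, precond'}" and t0: "0 < t0"
  shows "near_path p A b c (t_seq p t0 k) (homotopy pre (condition_bound p n) (accuracy p n) p A b c t0 k)"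
proof (induction k)
  case 0
  show ?case using path_point(1)[OF p t0 A b c] p by (simp add: t_seq_def near_path_def closeness_def)
next
  case (Suc k)
  define t where "t = t_seq p t0 k"
  define x where "x = homotopy pre (condition_bound p n) (accuracy p n) p A b c t0 k"
  have t: "0 < t" using t0 step_h_bounds[OF p] by (simp add: t_def t_seq_def)
  interpret lp_phase_near p t A b c x n d pre
    by unfold_locales (use p t n A b c pre Suc in \<open>auto simp: near_path_def t_def x_def\<close>)
  have "t_seq p t0 (Suc k) = (1 - step_h p) * t" by (simp add: t_def t_seq_def)
  hence "t_seq p t0 (Suc k) = t'" unfolding t'_def .
  moreover have "homotopy pre (condition_bound p n) (accuracy p n) p A b c t0 (Suc k)
    = P *\<^sub>v phase_output pre (condition_bound p n) (accuracy p n) p A b c t x"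
    unfolding P_def by (simp add: Let_def t_def x_def)
  ultimately show ?case using phase_output(4)[OF accuracy[OF p n]] by simp
qed

text \<open>Only the difference between the upper smoothing error at \<open>y\<close> and the lower
  one at \<open>x\<close> enters, that is, the width of the band in each coordinate.\<close>

lemma lp_objective_gap:
  assumes p: "1 < p" and t: "0 < t" and A: "A \<in> carrier_mat n d" and b: "b \<in> carrier_vec n" and c: "c \<in> ker_perp A"
    and gap: "smoothed_objective p A b c t x - smoothed_objective p A b c t (path_point p A b c t) \<le> E"
    and y: "y \<in> carrier_vec d"
  shows "lp_objective p A b c x \<le> lp_objective p A b c y + E + real n * (p / 2 * t powr p)"
proof -
  have dA: "dim_row A = n" using A by auto
  define mx where "mx = max 0 (p / 2 - 1) * t powr p"
  define mn where "mn = min 0 (p / 2 - 1) * t powr p"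
  have "lp_objective p A b c x + real n * mn \<le> smoothed_objective p A b c t x"
  proof -
    have "(\<Sum>i<n. \<bar>residual A b x $ i\<bar> powr p + mn) \<le> (\<Sum>i<n. smoothed p t (residual A b x $ i))"
      unfolding mn_def by (intro sum_mono smoothed_error(2)[OF p t])
    thus ?thesis by (simp add: lp_objective_def smoothed_objective_def dA sum.distrib)
  qed
  moreover have "smoothed_objective p A b c t y \<le> lp_objective p A b c y + real n * mx"
  proof -
    have "(\<Sum>i<n. smoothed p t (residual A b y $ i)) \<le> (\<Sum>i<n. \<bar>residual A b y $ i\<bar> powr p + mx)"
      unfolding mx_def by (intro sum_mono smoothed_error(1)[OF p t])
    thus ?thesis by (simp add: lp_objective_def smoothed_objective_def dA sum.distrib)
  qed
  moreover have "real n * mx - real n * mn \<le> real n * (p / 2 * t powr p)"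
  proof -
    have "mx - mn = (max 0 (p / 2 - 1) - min 0 (p / 2 - 1)) * t powr p" by (simp add: mx_def mn_def left_diff_distrib)
    also have "\<dots> \<le> p / 2 * t powr p" using p by (intro mult_right_mono) (auto simp: max_def min_def)
    finally have "real n * (mx - mn) \<le> real n * (p / 2 * t powr p)" by (intro mult_left_mono) auto
    thus ?thesis by (simp only: right_diff_distrib)
  qed
  ultimately show ?thesis using gap path_point(2)[OF p t A b c y] by linarith
qed

text \<open>Each phase multiplies \<open>t powr p\<close> by at most \<open>exp (- 1 / 2)\<close>
  because \<open>p * step_h p = 1 / 2\<close>, so \<open>2 * ln r\<close> phases divide it by
  \<open>r\<close>. The hypothesis \<open>big\<close> says \<open>r > 2\<close>, which lets another
  \<open>2 * ln r\<close> absorb the rounding.\<close>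

lemma phases_suffice:
  fixes p t0 \<epsilon> N :: real
  assumes p: "1 < p" and t0: "0 < t0" and eps: "0 < \<epsilon>" and N: "0 < N"
    and big: "2 * \<epsilon> < N * p * t0 powr p"
  defines "r \<equiv> N * p / \<epsilon> * t0 powr p"
  shows "N * p * t_seq p t0 (nat \<lceil>2 * ln r\<rceil>) powr p \<le> \<epsilon>" "real (nat \<lceil>2 * ln r\<rceil>) \<le> 4 * ln r"
proof -
  define k where "k = nat \<lceil>2 * ln r\<rceil>"
  have r: "2 < r" using big eps by (simp add: r_def field_simps)
  have lnr: "1 / 2 \<le> ln r" using ln_mono[of 2 r] r ln2_ge_two_thirds by linarith
  have "0 \<le> \<lceil>2 * ln r\<rceil>" using lnr by simp
  hence k: "2 * ln r \<le> real k" "real k \<le> 2 * ln r + 1" unfolding k_def by linarith+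
  show "real (nat \<lceil>2 * ln r\<rceil>) \<le> 4 * ln r" using k lnr unfolding k_def by linarith
  note h = step_h_bounds[OF p]
  have "(1 - step_h p) powr p \<le> exp (- step_h p) powr p"
    using h p exp_ge_add_one_self[of "- step_h p"] by (intro powr_mono2) auto
  also have "\<dots> = exp (- (1 / 2))" using h(3) by (simp add: powr_def)
  finally have hp: "(1 - step_h p) powr p \<le> exp (- (1 / 2))" .
  have "t_seq p t0 k powr p = ((1 - step_h p) powr p) ^ k * t0 powr p"
  proof -
    have "((1 - step_h p) ^ k) powr p = ((1 - step_h p) powr p) ^ k"
      using h powr_powr_swap[of "1 - step_h p" "real k" p] by (simp add: powr_realpow)
    thus ?thesis by (simp add: t_seq_def powr_mult)
  qed
  also have "\<dots> \<le> exp (- (1 / 2)) ^ k * t0 powr p"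
    using hp by (intro mult_right_mono power_mono) auto
  also have "exp (- (1 / 2 :: real)) ^ k = exp (- (real k / 2))" by (simp flip: exp_of_nat_mult)
  also have "\<dots> \<le> exp (- ln r)" using k by simp
  also have "\<dots> = 1 / r" using r by (simp add: exp_minus divide_inverse)
  finally have "t_seq p t0 k powr p \<le> 1 / r * t0 powr p" by (simp add: mult_right_mono)
  hence "N * p * t_seq p t0 k powr p \<le> N * p * (1 / r * t0 powr p)" using N p by (intro mult_left_mono) auto
  also have "\<dots> = \<epsilon>" using N p t0 eps by (simp add: r_def)
  finally show "N * p * t_seq p t0 (nat \<lceil>2 * ln r\<rceil>) powr p \<le> \<epsilon>" by (simp add: k_def)
qed

lemma lp_minimiser_exists:
  assumes p: "1 < p" and A: "A \<in> carrier_mat n d" and b: "b \<in> carrier_vec n" and c: "c \<in> ker_perp A"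
  shows "\<exists>x. is_arg_min (lp_objective p A b c) (\<lambda>x. x \<in> carrier_vec d) x"
proof -
  have "continuous_on UNIV (\<lambda>s::real. \<bar>s\<bar> powr p)"
    using DERIV_isCont[OF powr_abs_has_deriv[OF p]] by (intro continuous_at_imp_continuous_on) auto
  then obtain x where "x \<in> ker_perp A" "\<forall>y\<in>carrier_vec d. lp_objective p A b c x \<le> lp_objective p A b c y"
    using composite_minimiser_exists[OF A b c, of "\<lambda>i s. \<bar>s\<bar> powr p"] powr_coercive[OF p]
    unfolding lp_objective_composite by blast
  moreover from this have "x \<in> carrier_vec d" using ker_perp_carrier[of x A] A by simp
  ultimately show ?thesis by (auto simp: is_arg_min_def not_less)
qed

lemma approximate_solution:
  assumes p: "1 < p" and n: "1 \<le> n" and A: "A \<in> carrier_mat n d" and b: "b \<in> carrier_vec n" and c: "c \<in> ker_perp A"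
    and pre: "pre \<in> {precond, precond'}" and t0: "0 < t0" and eps: "0 < \<epsilon>"
  defines "x \<equiv> homotopy pre (condition_bound p n) (accuracy p n) p A b c t0"
  shows "\<exists>k. real k \<le> 2 ^ 19 * max 0 (ln (real n * p / \<epsilon> * t0 powr p)) \<and> x k \<in> carrier_vec d \<and>
    (\<exists>x_opt. is_arg_min (lp_objective p A b c) (\<lambda>x. x \<in> carrier_vec d) x_opt \<and>
      lp_objective p A b c (x k) \<le> \<epsilon> + lp_objective p A b c x_opt)"
proof -
  obtain z where z: "is_arg_min (lp_objective p A b c) (\<lambda>x. x \<in> carrier_vec d) z"
    using lp_minimiser_exists[OF p A b c] by blast
  hence zd: "z \<in> carrier_vec d" by (simp add: is_arg_min_def)
  have xd: "x k \<in> carrier_vec d" for k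
    using homotopy_near_path[OF p n A b c pre t0, of k] ker_perp_carrier[of "x k" A] A
    by (simp add: near_path_def x_def)
  define r where "r = real n * p / \<epsilon> * t0 powr p"
  show ?thesis
  proof (cases "real n * p * t0 powr p \<le> 2 * \<epsilon>")
    \<comment> \<open>The starting point is already good enough, so \<open>k = 0\<close> serves; the
      logarithm may be negative here, whence the \<open>max 0\<close> in the bound.\<close>
    case True
    have "lp_objective p A b c (x 0) \<le> lp_objective p A b c z + 0 + real n * (p / 2 * t0 powr p)"
      by (rule lp_objective_gap[OF p t0 A b c _ zd]) (simp add: x_def)
    hence "lp_objective p A b c (x 0) \<le> \<epsilon> + lp_objective p A b c z" using True by simp
    thus ?thesis using xd[of 0] z by (intro exI[of _ 0]) auto
  next
    case False
    define k where "k = nat \<lceil>2 * ln r\<rceil>"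
    define t where "t = t_seq p t0 k"
    have t: "0 < t" using t0 step_h_bounds[OF p] by (simp add: t_def t_seq_def)
    have k: "real n * p * t powr p \<le> \<epsilon>" "real k \<le> 4 * ln r"
      using phases_suffice[OF p t0 eps, of "real n"] False n unfolding t_def k_def r_def by auto
    have "smoothed_objective p A b c t (x k) - smoothed_objective p A b c t (path_point p A b c t) \<le> closeness p * t powr p"
      using homotopy_near_path[OF p n A b c pre t0, of k] by (simp add: near_path_def x_def t_def)
    also have "\<dots> \<le> real n * (p / 2) * t powr p"
    proof (rule mult_right_mono)
      have "closeness p \<le> 1 / 2" using cond_bounds(1)[OF p] unfolding closeness_def by (intro frac_le) auto
      also have "1 * (1 / 2) \<le> real n * (p / 2)" using n p by (intro mult_mono) auto
      finally show "closeness p \<le> real n * (p / 2)" by simp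
    qed simp
    finally have "lp_objective p A b c (x k) \<le> lp_objective p A b c z + real n * (p / 2) * t powr p + real n * (p / 2 * t powr p)"
      by (rule lp_objective_gap[OF p t A b c _ zd])
    hence "lp_objective p A b c (x k) \<le> \<epsilon> + lp_objective p A b c z" using k(1) by (simp add: mult_ac)
    moreover have "real k \<le> 2 ^ 19 * max 0 (ln r)" using k(2) by simp
    ultimately show ?thesis using xd[of k] z unfolding r_def by blast
  qed
qed

section \<open>The degenerate start and the final assembly\<close>

lemma agd_carrier:
  assumes "y \<in> carrier_vec m"
  shows "agd \<kappa> \<delta> f y \<in> carrier_vec m"
proof -
  have step: "fst (agd_step \<kappa> f s) \<in> carrier_vec m \<and> snd (agd_step \<kappa> f s) \<in> carrier_vec m"
    if "fst s \<in> carrier_vec m \<and> snd s \<in> carrier_vec m" for s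
    using that by (cases s) (auto simp: agd_step_def Let_def gradient_def intro: carrier_vecI)
  have "fst ((agd_step \<kappa> f ^^ k) (y, y)) \<in> carrier_vec m \<and> snd ((agd_step \<kappa> f ^^ k) (y, y)) \<in> carrier_vec m" for k
    by (induction k) (use assms step in auto)
  thus ?thesis by (simp add: agd_def)
qed

text \<open>If \<open>t\<^sub>0 = 0\<close> then \<open>b\<close> and \<open>c\<close> vanish, all weights are \<open>0\<close> (as \<open>0 powr a = 0\<close>) and hence so is
  the preconditioner; every iterate is the exact solution \<open>0\<close>.\<close>

lemma degenerate:
  assumes p: "1 < p" and A: "A \<in> carrier_mat n d" and pre: "pre \<in> {precond, precond'}"
  shows "path_point p A (0\<^sub>v n) (0\<^sub>v d) 0 = 0\<^sub>v d"
    and "phase_precond pre p A (0\<^sub>v n) 0 (0\<^sub>v d) = 0\<^sub>m d (dim_col (phase_precond pre p A (0\<^sub>v n) 0 (0\<^sub>v d)))"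
    and "dim_col (phase_precond pre p A (0\<^sub>v n) 0 (0\<^sub>v d)) \<le> max n d"
proof -
  have dA[simp]: "dim_row A = n" "dim_col A = d" using A by auto
  have sm: "smoothed p 0 s = \<bar>s\<bar> powr p" for s by (auto simp: smoothed_def)
  have obj: "smoothed_objective p A (0\<^sub>v n) (0\<^sub>v d) 0 x = (\<Sum>i<n. \<bar>(A *\<^sub>v x) $ i\<bar> powr p)" if "x \<in> carrier_vec d" for x
    using that by (simp add: smoothed_objective_def sm residual_index[OF A] del: index_mult_mat_vec)
  have k: "x \<in> carrier_vec d" if "x \<in> ker_perp A" for x using ker_perp_carrier[OF that] by simp
  have A0: "A *\<^sub>v 0\<^sub>v d = 0\<^sub>v n" by (intro eq_vecI) (auto simp: scalar_prod_def)
  have obj0: "smoothed_objective p A (0\<^sub>v n) (0\<^sub>v d) 0 (0\<^sub>v d) = 0" by (subst obj) (auto simp: A0 simp del: index_mult_mat_vec)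
  have z: "0\<^sub>v d \<in> ker_perp A" using ker_perp_carrier by (auto simp: ker_perp_def mat_kernel_def)
  have "is_arg_min (smoothed_objective p A (0\<^sub>v n) (0\<^sub>v d) 0) (\<lambda>x. x \<in> ker_perp A) (0\<^sub>v d)"
    unfolding is_arg_min_def obj0 using z k obj by (auto simp: not_less intro!: sum_nonneg)
  hence am: "is_arg_min (smoothed_objective p A (0\<^sub>v n) (0\<^sub>v d) 0) (\<lambda>x. x \<in> ker_perp A) (path_point p A (0\<^sub>v n) (0\<^sub>v d) 0)"
    unfolding path_point_def arg_min_def by (rule someI)
  define y where "y = path_point p A (0\<^sub>v n) (0\<^sub>v d) 0"
  have y: "y \<in> ker_perp A" using am by (simp add: is_arg_min_def y_def)
  have "smoothed_objective p A (0\<^sub>v n) (0\<^sub>v d) 0 y \<le> 0"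
    using am z obj0 by (force simp: is_arg_min_def y_def not_less)
  hence "(\<Sum>i<n. \<bar>(A *\<^sub>v y) $ i\<bar> powr p) \<le> 0" using obj[OF k[OF y]] by simp
  moreover have "0 \<le> (\<Sum>i<n. \<bar>(A *\<^sub>v y) $ i\<bar> powr p)" by (intro sum_nonneg) simp
  ultimately have "(\<Sum>i<n. \<bar>(A *\<^sub>v y) $ i\<bar> powr p) = 0" by linarith
  hence "\<forall>i\<in>{..<n}. \<bar>(A *\<^sub>v y) $ i\<bar> powr p = 0" by (subst (asm) sum_nonneg_eq_0_iff) auto
  hence "A *\<^sub>v y = 0\<^sub>v (dim_row A)" by (intro eq_vecI) auto
  thus "path_point p A (0\<^sub>v n) (0\<^sub>v d) 0 = 0\<^sub>v d" using ker_perp_kernel_0[OF y] by (simp add: y_def)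
  define s where "s = residual A (0\<^sub>v n) (0\<^sub>v d)"
  define P where "P = phase_precond pre p A (0\<^sub>v n) 0 (0\<^sub>v d)"
  have s0: "s = 0\<^sub>v n" unfolding s_def residual_def A0 by (intro eq_vecI) auto
  have W0: "weight p n 0 (s $ i) = 0" if "i < n" for i
    using that by (simp add: weight_def radius_def s0)
  have "dim_vec s = dim_row A" by (simp add: s0)
  note gr = precond_gram[OF pre this p, of 0]
  have Peq: "P = pre p A 0 s" by (simp add: P_def phase_precond_def s_def)
  have "gram A (\<lambda>i. weight p n 0 (s $ i)) = 0\<^sub>m d d"
  proof -
    have "mat_diag n (\<lambda>i. weight p n 0 (s $ i)) = 0\<^sub>m n n" using W0 by (intro eq_matI) (auto simp: mat_diag_def)
    thus ?thesis unfolding gram_def using A by simp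
  qed
  moreover have "pinv (0\<^sub>m d d) = 0\<^sub>m d d"
    by (rule is_pinv_unique[OF is_pinv_pinv]) (simp add: is_pinv_def)
  ultimately have PP: "P * transpose_mat P = 0\<^sub>m d d" using gr(1) unfolding Peq by simp
  have dP: "dim_row P = d" "dim_col P \<le> max n d" using gr(2,3) unfolding Peq by simp_all
  have "transpose_mat P = 0\<^sub>m (dim_col P) d"
    by (rule gram_eq_0) (use PP dP in \<open>auto intro: carrier_matI\<close>)
  hence "transpose_mat (transpose_mat P) = transpose_mat (0\<^sub>m (dim_col P) d)" by simp
  thus "phase_precond pre p A (0\<^sub>v n) 0 (0\<^sub>v d) = 0\<^sub>m d (dim_col (phase_precond pre p A (0\<^sub>v n) 0 (0\<^sub>v d)))"
    by (simp add: P_def)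
  show "dim_col (phase_precond pre p A (0\<^sub>v n) 0 (0\<^sub>v d)) \<le> max n d" using dP by (simp add: P_def)
qed

text \<open>Carries the results of the locale over to the actual iterates. The loss derivative
  appears as \<open>deriv\<close> and is identified with \<open>L'\<close>; the program works for
  all \<open>y\<close> and \<open>z\<close> because the gradient formula holds on the whole
  space.\<close>

lemma phase_guarantee:
  fixes p t0 :: real and A :: "real Matrix.mat" and b c :: "real Matrix.vec" and pre :: precond_fun and k n d :: nat
  assumes p: "1 < p" and n: "1 \<le> n" and A: "A \<in> carrier_mat n d" and b: "b \<in> carrier_vec n" and c: "c \<in> ker_perp A"
    and pre: "pre \<in> {precond, precond'}" and t0: "0 < t0"
  defines "\<xi> \<equiv> homotopy pre (condition_bound p n) (accuracy p n) p A b c t0 k"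
    and "\<tau> \<equiv> t_seq p t0 k"
  defines "Q \<equiv> phase_precond pre p A b \<tau> \<xi>" and "f \<equiv> phase_g pre p A b c \<tau> \<xi>"
    and "y0 \<equiv> phase_start pre p A b \<tau> \<xi>"
    and "y1 \<equiv> phase_output pre (condition_bound p n) (accuracy p n) p A b c \<tau> \<xi>"
    and "\<phi> \<equiv> (\<lambda>i. deriv (phase_loss p \<tau> (residual A b \<xi>) i))"
  shows "Q *\<^sub>v y0 = \<xi>"
    and "\<exists>y_opt. is_arg_min f (\<lambda>y. y \<in> carrier_vec (dim_col Q)) y_opt \<and>
      Q *\<^sub>v y_opt = path_point p A b c (t_seq p t0 (Suc k)) \<and>
      f y1 - f y_opt \<le> accuracy p n * (f y0 - f y_opt)"
    and "\<And>y z. y \<in> carrier_vec (dim_col Q) \<Longrightarrow> z \<in> carrier_vec (dim_col Q) \<Longrightarrow>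
      real (work Q A \<phi> (step_program \<kappa>) [b, c, y, z]) \<le> 11 * real (nnz A + n + d) \<and>
      implements_step (step_program \<kappa>) Q A b c \<phi> \<kappa> f y z"
proof -
  have t: "0 < \<tau>" using t0 step_h_bounds[OF p] by (simp add: \<tau>_def t_seq_def)
  have near: "near_path p A b c \<tau> \<xi>"
    unfolding \<tau>_def \<xi>_def by (rule homotopy_near_path[OF p n A b c pre t0])
  interpret lp_phase_near p \<tau> A b c \<xi> n d pre
    by unfold_locales (use p t n A b c pre near in \<open>auto simp: near_path_def\<close>)
  have Q: "Q = P" and f: "f = g" by (simp_all add: Q_def P_def f_def g_def)
  have m: "dim_col Q = m" by (simp add: Q m_def)
  have t': "t_seq p t0 (Suc k) = t'" unfolding t'_def by (simp add: \<tau>_def t_seq_def)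
  have \<phi>: "\<phi> = L'"
  proof
    fix i
    have pl: "phase_loss p \<tau> (residual A b \<xi>) i = L i" by (simp add: L_def s_def)
    show "\<phi> i = L' i"
      unfolding \<phi>_def pl by (rule ext) (rule DERIV_imp_deriv[OF L_has_deriv])
  qed
  note out = phase_output[OF accuracy[OF p n], folded y0_def y1_def]
  show "Q *\<^sub>v y0 = \<xi>" unfolding Q by (rule out(1))
  have "is_arg_min f (\<lambda>y. y \<in> carrier_vec (dim_col Q)) y_opt"
    unfolding m f is_arg_min_def using y_opt_V V_carrier y_opt_minimal by (auto simp: not_less)
  moreover have "Q *\<^sub>v y_opt = path_point p A b c (t_seq p t0 (Suc k))"
    unfolding Q t' P_y_opt x'_def ..
  moreover have "f y1 - f y_opt \<le> accuracy p n * (f y0 - f y_opt)" unfolding f by (rule out(3))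
  ultimately show "\<exists>y_opt. is_arg_min f (\<lambda>y. y \<in> carrier_vec (dim_col Q)) y_opt \<and>
      Q *\<^sub>v y_opt = path_point p A b c (t_seq p t0 (Suc k)) \<and>
      f y1 - f y_opt \<le> accuracy p n * (f y0 - f y_opt)" by blast
  fix y z :: "real Matrix.vec" assume "y \<in> carrier_vec (dim_col Q)" "z \<in> carrier_vec (dim_col Q)"
  hence yz: "y \<in> carrier_vec m" "z \<in> carrier_vec m" unfolding m by auto
  show "real (work Q A \<phi> (step_program \<kappa>) [b, c, y, z]) \<le> 11 * real (nnz A + n + d) \<and>
      implements_step (step_program \<kappa>) Q A b c \<phi> \<kappa> f y z"
    unfolding Q f \<phi>
    using step_program_correct[OF A b ker_perp_d[OF c] P_carrier P_gram(3) yz gradient_g[OF yz(2)]] by simp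
qed

text \<open>With a zero preconditioner \<open>phase_g\<close> is constant, so every point is a
  minimiser and all gradients vanish, whatever \<open>\<kappa>\<close> and \<open>\<delta>\<close>
  are.\<close>

lemma degenerate_guarantee:
  fixes p \<kappa> \<delta> :: real and A :: "real Matrix.mat" and pre :: precond_fun and n d :: nat
  assumes p: "1 < p" and A: "A \<in> carrier_mat n d" and pre: "pre \<in> {precond, precond'}"
  defines "b \<equiv> 0\<^sub>v n" and "c \<equiv> 0\<^sub>v d"
  defines "Q \<equiv> phase_precond pre p A b 0 (0\<^sub>v d)" and "f \<equiv> phase_g pre p A b c 0 (0\<^sub>v d)"
    and "y0 \<equiv> phase_start pre p A b 0 (0\<^sub>v d)"
    and "y1 \<equiv> phase_output pre \<kappa> \<delta> p A b c 0 (0\<^sub>v d)"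
    and "\<phi> \<equiv> (\<lambda>i. deriv (phase_loss p 0 (residual A b (0\<^sub>v d)) i))"
  shows "y1 \<in> carrier_vec (dim_col Q)"
    and "y \<in> carrier_vec (dim_col Q) \<Longrightarrow> Q *\<^sub>v y = 0\<^sub>v d"
    and "Q *\<^sub>v y0 = 0\<^sub>v d"
    and "\<exists>y_opt. is_arg_min f (\<lambda>y. y \<in> carrier_vec (dim_col Q)) y_opt \<and>
      Q *\<^sub>v y_opt = path_point p A b c 0 \<and> f y1 - f y_opt \<le> \<delta> * (f y0 - f y_opt)"
    and "\<And>y z. y \<in> carrier_vec (dim_col Q) \<Longrightarrow> z \<in> carrier_vec (dim_col Q) \<Longrightarrow>
      real (work Q A \<phi> (step_program \<kappa>) [b, c, y, z]) \<le> 11 * real (nnz A + n + d) \<and>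
      implements_step (step_program \<kappa>) Q A b c \<phi> \<kappa> f y z"
proof -
  define m where "m = dim_col Q"
  note deg = degenerate[OF p A pre]
  have Q: "Q = 0\<^sub>m d m" using deg(2) unfolding Q_def m_def b_def .
  have Qc: "Q \<in> carrier_mat d m" by (simp add: Q)
  have Qy: "Q *\<^sub>v y = 0\<^sub>v d" if "y \<in> carrier_vec m" for y
    using that unfolding Q by (intro eq_vecI) (auto simp: scalar_prod_def)
  thus "y \<in> carrier_vec (dim_col Q) \<Longrightarrow> Q *\<^sub>v y = 0\<^sub>v d" by (simp add: m_def)
  have y0: "y0 \<in> carrier_vec m"
    unfolding y0_def phase_start_def Q_def[symmetric] by (intro carrier_vecI) (simp add: m_def)
  have y1: "y1 \<in> carrier_vec m"
    unfolding y1_def phase_output_def y0_def[symmetric] by (rule agd_carrier[OF y0])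
  thus "y1 \<in> carrier_vec (dim_col Q)" by (simp add: m_def)
  show "Q *\<^sub>v y0 = 0\<^sub>v d" by (rule Qy[OF y0])
  have f: "f y = f (0\<^sub>v m)" if "y \<in> carrier_vec m" for y
    using Qy[OF that] Qy[of "0\<^sub>v m"]
    unfolding f_def phase_g_def phase_objective_composite Q_def[symmetric] by simp
  have "is_arg_min f (\<lambda>y. y \<in> carrier_vec (dim_col Q)) (0\<^sub>v m)"
    unfolding is_arg_min_def m_def[symmetric]
  proof (intro conjI notI)
    assume "\<exists>y. y \<in> carrier_vec m \<and> f y < f (0\<^sub>v m)"
    then obtain y where "y \<in> carrier_vec m" "f y < f (0\<^sub>v m)" by blast
    thus False using f by (metis less_irrefl)
  qed simp
  moreover have "Q *\<^sub>v 0\<^sub>v m = path_point p A b c 0" unfolding b_def c_def deg(1) by (rule Qy) simp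
  moreover have "f y1 - f (0\<^sub>v m) \<le> \<delta> * (f y0 - f (0\<^sub>v m))" unfolding f[OF y0] f[OF y1] by simp
  ultimately show "\<exists>y_opt. is_arg_min f (\<lambda>y. y \<in> carrier_vec (dim_col Q)) y_opt \<and>
      Q *\<^sub>v y_opt = path_point p A b c 0 \<and> f y1 - f y_opt \<le> \<delta> * (f y0 - f y_opt)" by blast
  fix y z :: "real Matrix.vec" assume "y \<in> carrier_vec (dim_col Q)" "z \<in> carrier_vec (dim_col Q)"
  hence yz: "y \<in> carrier_vec m" "z \<in> carrier_vec m" by (auto simp: m_def)
  have cd: "c \<in> carrier_vec d" and bn: "b \<in> carrier_vec n" by (auto simp: b_def c_def)
  have "gradient f z = 0\<^sub>v m"
  proof (rule eq_vecI)
    fix j assume "j < dim_vec (0\<^sub>v m)"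
    hence j: "j < m" by simp
    have dz: "dim_vec z = m" using yz by simp
    have "(\<lambda>r. f (z + r \<cdot>\<^sub>v unit_vec m j)) = (\<lambda>r. f (0\<^sub>v m))" using yz by (intro ext f) simp
    thus "gradient f z $ j = 0\<^sub>v m $ j" using j by (simp add: gradient_def dz)
  qed (use yz in \<open>simp add: gradient_def\<close>)
  also have "\<dots> = transpose_mat Q *\<^sub>v loss_gradient A b c \<phi> (Q *\<^sub>v z)"
    using loss_gradient_carrier[OF A cd, of b \<phi> "Q *\<^sub>v z"] unfolding Q
    by (intro eq_vecI) (auto simp: scalar_prod_def)
  finally have grad: "gradient f z = transpose_mat Q *\<^sub>v loss_gradient A b c \<phi> (Q *\<^sub>v z)" .
  have "m \<le> max n d" using deg(3) unfolding m_def Q_def b_def .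
  from step_program_correct[OF A bn cd Qc this yz grad]
  show "real (work Q A \<phi> (step_program \<kappa>) [b, c, y, z]) \<le> 11 * real (nnz A + n + d) \<and>
      implements_step (step_program \<kappa>) Q A b c \<phi> \<kappa> f y z" by simp
qed

lemma degenerate_homotopy:
  assumes p: "1 < p" and A: "A \<in> carrier_mat n d" and pre: "pre \<in> {precond, precond'}"
  shows "homotopy pre \<kappa> \<delta> p A (0\<^sub>v n) (0\<^sub>v d) 0 k = 0\<^sub>v d"
proof (induction k)
  case 0
  show ?case by (simp add: degenerate(1)[OF p A pre])
next
  case (Suc k)
  have "t_seq p 0 k = 0" by (simp add: t_seq_def)
  thus ?case
    using degenerate_guarantee(2)[OF p A pre degenerate_guarantee(1)[OF p A pre]] Suc by (simp add: Let_def)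
qed

text \<open>The lower bound on \<open>\<delta>\<close> expresses that the accuracy is inverse
  polynomial. \<open>ln (real n + 1)\<close> and \<open>max 0\<close> keep the bounds meaningful for
  \<open>n = 1\<close> and for a negative logarithm.\<close>

theorem theorem1:
  shows "\<exists>(C::real) (m::nat) (\<kappa>::real \<Rightarrow> nat \<Rightarrow> real) (\<delta>::real \<Rightarrow> nat \<Rightarrow> real).
    (\<forall>p n. 1 < p \<longrightarrow> 1 \<le> n \<longrightarrow>
        1 \<le> \<kappa> p n \<and> 0 < \<delta> p n \<and> \<delta> p n < 1 / 2 \<and>
        1 \<le> C * (p\<^sup>2 / (p - 1)) ^ m * real n ^ m * \<delta> p n \<and>
        real (agd_iterations (\<kappa> p n) (\<delta> p n))
          \<le> C * (p\<^sup>2 / (p - 1)) ^ m * real n powr \<bar>1 / 2 - 1 / p\<bar> * ln (real n + 1)) \<and>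
    (\<forall>p n d A b c pre.
        1 < p \<longrightarrow> 1 \<le> d \<longrightarrow> d \<le> n \<longrightarrow>
        A \<in> carrier_mat n d \<longrightarrow> b \<in> carrier_vec n \<longrightarrow> c \<in> ker_perp A \<longrightarrow>
        pre \<in> {precond, precond'} \<longrightarrow>
        (let t\<^sub>0 = t_init p A b c;
             x = homotopy pre (\<kappa> p n) (\<delta> p n) p A b c t\<^sub>0
         in
          (\<forall>\<epsilon>>0. \<exists>k. real k \<le> C * max 0 (ln (real n * p / \<epsilon> * t\<^sub>0 powr p)) \<and>
              x k \<in> carrier_vec d \<and>
              (\<exists>x_opt. is_arg_min (lp_objective p A b c) (\<lambda>x. x \<in> carrier_vec d) x_opt \<and>
                 lp_objective p A b c (x k) \<le> \<epsilon> + lp_objective p A b c x_opt)) \<and>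
          (\<forall>k. let t = t_seq p t\<^sub>0 k;
                   P = phase_precond pre p A b t (x k);
                   g = phase_g pre p A b c t (x k);
                   y_start = phase_start pre p A b t (x k);
                   y_out = phase_output pre (\<kappa> p n) (\<delta> p n) p A b c t (x k);
                   Y = carrier_vec (dim_col P)
               in
                P *\<^sub>v y_start = x k \<and>
                (\<exists>y_opt. is_arg_min g (\<lambda>y. y \<in> Y) y_opt \<and>
                   P *\<^sub>v y_opt = path_point p A b c (t_seq p t\<^sub>0 (Suc k)) \<and>
                   g y_out - g y_opt \<le> \<delta> p n * (g y_start - g y_opt)) \<and>
                (\<exists>prog. real (applications prog) \<le> C \<and>
                   (\<forall>y\<in>Y. \<forall>z\<in>Y.
                      real (work P A (\<lambda>i. deriv (phase_loss p t (residual A b (x k)) i)) prog [b, c, y, z])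
                        \<le> C * real (nnz A + n + d) \<and>
                      implements_step prog P A b c
                        (\<lambda>i. deriv (phase_loss p t (residual A b (x k)) i)) (\<kappa> p n) g y z)))))"
\<comment> \<open>\<open>2 ^ 19\<close> is the constant in \<open>accuracy\<close>, and 3 is the
  power of \<open>cond p\<close> in \<open>iterations_bound\<close>; the other bounds leave
  room.\<close>
proof (rule exI[of _ "2 ^ 19"], rule exI[of _ 3], rule exI[of _ condition_bound], rule exI[of _ accuracy],
    intro conjI allI impI, goal_cases)
  case (1 p n)
  thus ?case by (rule condition_bound_ge_1)
next
  case (2 p n)
  thus ?case by (rule accuracy)
next
  case (3 p n)
  thus ?case by (rule accuracy)
next
  case (4 p n)
  have q: "4 \<le> cond p" using cond_bounds(1)[OF 4(1)] .
  have "1 \<le> cond p" "1 \<le> real n ^ 2" using q 4 by (linarith, simp)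
  hence "1 * 1 \<le> cond p * real n ^ 2" by (rule mult_mono) (use q in linarith, simp)
  also have "\<dots> = 2 ^ 19 * cond p ^ 3 * real n ^ 3 * accuracy p n"
  proof -
    have "q * N ^ 2 = 2 ^ 19 * q ^ 3 * N ^ 3 * (1 / (2 ^ 19 * q ^ 2 * N))" if "q \<noteq> 0" "N \<noteq> 0" for q N :: real
      using that by (simp add: power2_eq_square power3_eq_cube)
    from this[of "cond p" "real n"] q 4 show ?thesis unfolding accuracy_def by simp
  qed
  finally show ?case by simp
next
  case (5 p n)
  thus ?case by (rule iterations_bound)
next
  case (6 p n d A b c pre)
  hence p: "1 < p" and n: "1 \<le> n" and A: "A \<in> carrier_mat n d" and b: "b \<in> carrier_vec n" and c: "c \<in> ker_perp A"
    and pre: "pre \<in> {precond, precond'}" by auto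
  define t0 where "t0 = t_init p A b c"
  define x where "x = homotopy pre (condition_bound p n) (accuracy p n) p A b c t0"
  have prog2: "real (applications (step_program \<kappa>)) \<le> 2 ^ 19" for \<kappa> by (simp add: step_program_applications)
  have work: "11 * real (nnz A + n + d) \<le> 2 ^ 19 * real (nnz A + n + d)" by simp
  show ?case
  proof (cases "t0 = 0")
    case False
    hence t0: "0 < t0" using t_init_pos(1)[OF A b c, of p] by (simp add: t0_def)
    note sol = approximate_solution[OF p n A b c pre t0, folded x_def]
    note ph = phase_guarantee[OF p n A b c pre t0, folded x_def]
    show ?thesis
      unfolding Let_def t0_def[symmetric] x_def[symmetric]
    proof (intro conjI allI impI, goal_cases)
      case (1 \<epsilon>)
      thus ?case by (rule sol)
    next
      case (2 k)
      show ?case by (rule ph(1))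
    next
      case (3 k)
      show ?case by (rule ph(2))
    next
      case (4 k)
      show ?case
        using prog2 order_trans[OF _ work] ph(3)[of _ k] by (intro exI[of _ "step_program (condition_bound p n)"]) blast
    qed
  next
    case True
    have bc: "b = 0\<^sub>v n" "c = 0\<^sub>v d" using t_init_pos(2)[OF A b c, of p] True by (auto simp: t0_def)
    have xk: "x k = 0\<^sub>v d" for k unfolding x_def bc True by (rule degenerate_homotopy[OF p A pre])
    have ts: "t_seq p t0 k = 0" for k by (simp add: t_seq_def True)
    note ph = degenerate_guarantee[OF p A pre]
    have obj: "lp_objective p A b c y \<ge> 0" if "y \<in> carrier_vec d" for y
      using that unfolding lp_objective_def bc by (simp add: sum_nonneg)
    have obj0: "lp_objective p A b c (0\<^sub>v d) = 0"
    proof -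
      have "residual A b (0\<^sub>v d) $ i = 0" if "i < n" for i
        unfolding residual_index[OF A b that] unfolding bc using that A by (simp add: scalar_prod_def)
      thus ?thesis using A by (simp add: lp_objective_def bc)
    qed
    show ?thesis
      unfolding Let_def t0_def[symmetric] x_def[symmetric] xk ts unfolding bc
    proof (intro conjI allI impI, goal_cases)
      case (1 \<epsilon>)
      have "is_arg_min (lp_objective p A b c) (\<lambda>x. x \<in> carrier_vec d) (0\<^sub>v d)"
        using obj obj0 by (auto simp: is_arg_min_def not_less)
      thus ?case using 1 unfolding bc by (intro exI[of _ 0]) (auto simp: True)
    next
      case (2 k)
      show ?case by (rule ph(3))
    next
      case (3 k)
      show ?case by (rule ph(4))
    next
      case (4 k)
      show ?case
        using prog2 order_trans[OF _ work] ph(5) by (intro exI[of _ "step_program (condition_bound p n)"]) blast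
    qed
  qed
qed

end
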